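(* Let $\mathcal{X},\mathcal{Y}$ be finite alphabets, $P_{Y|X}$ a channel from $\mathcal{X}$ to $\mathcal{Y}$, $m$ a fixed positive integer and $P_{\bar X}$ a fixed $m$-type on $\mathcal{X}$. For $n$ a multiple of $m$, let $R_{\breve X^n}$ be the uniform distribution on the type class $\mathcal{T}^n_{P_{\bar X}}$ and $R_{\breve Y^n}$ the output distribution obtained by passing $R_{\breve X^n}$ through the memoryless channel $P_{Y^n|X^n}$; assume non-degeneracy $P_{Y^n|X^n}\neq R_{\breve Y^n}$. For any $R>I(P_{\bar X},P_{Y|X})$ let $M=\lceil\exp(nR)\rceil$ and let $P_{\breve Y^n|\mathscr{D}_M^n}$ be the induced output distribution of the random constant-composition codebook $\mathscr{D}_M^n$. Then, with $n\to\infty$ along multiples of $m$, \[ \lim_{n\to\infty}-\frac1n\log\mathbb{E}\left[\left\|P_{\breve Y^n|\mathscr{D}_M^n}-R_{\breve Y^n}\right\|_1\right] =\min_{Q_{Y|X}\in\mathcal{P}(\mathcal{Y}|\mathcal{X})}\Big\{D(P_{\bar X}Q_{Y|X}\|P_{\bar X}P_{Y|X})+\tfrac12\big[R-D(P_{\bar X}Q_{Y|X}\|P_{\bar X}Q_Y)\big]_+\Big\} =\max_{\lambda\in[1,2]}\Big\{\frac{\lambda-1}{\lambda}\big(R-I^{\mathsf{c}}_\lambda(P_{\bar X},P_{Y|X})\big)\Big\}, \] where $Q_Y=\sum_xP_{\bar X}(x)Q_{Y|X}(\cdot|x)$ and $[f]_+=\max\{0,f\}$.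
   Context: Logarithms and exponentials are to an arbitrary but common base. An $m$-type is a distribution all of whose probabilities lie in $\{0,1/m,\dots,1\}$; the type class $\mathcal{T}^n_{P_{\bar X}}$ is the set of $x^n\in\mathcal{X}^n$ whose empirical distribution is $P_{\bar X}$. $P_{Y^n|X^n}(y^n|x^n)=\prod_iP_{Y|X}(y_i|x_i)$. The random constant-composition codebook $\mathscr{D}_M^n=\{\breve X_1^n,\dots,\breve X_M^n\}$ has codewords drawn independently and identically from $R_{\breve X^n}$, and $P_{\breve Y^n|\mathscr{D}_M^n}(y^n)=\frac1M\sum_{j=1}^MP_{Y^n|X^n}(y^n|\breve X_j^n)$. $\|P-Q\|_1=\sum|P-Q|$ (no factor $1/2$). $\mathcal{P}(\mathcal{Y}|\mathcal{X})$ is the set of all channels from $\mathcal{X}$ to $\mathcal{Y}$. $D$ is relative entropy, $I$ mutual information. Csiszár's $\alpha$-mutual information of order $\lambda$ is $I^{\mathsf{c}}_\lambda(P_X,P_{Y|X})=\min_{S_Y\in\mathcal{P}(\mathcal{Y})}\sum_xP_X(x)D_\lambda(P_{Y|X}(\cdot|x)\|S_Y)$, where $D_\lambda(P\|Q)=\frac{1}{\lambda-1}\log\sum_yP(y)^\lambda Q(y)^{1-\lambda}$ is the Rényi divergence ($D_1$ = relative entropy). *)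

theory Defs
  imports "HOL-Analysis.Analysis" "HOL-Library.FuncSet" "HOL-Library.Extended_Real"
begin

text \<open>All logarithms/exponentials are to a common base b > 1.
Alphabets are finite types; sequences of length n are lists of length n.\<close>

definition pdist :: "('a::finite \<Rightarrow> real) \<Rightarrow> bool" where
  "pdist p \<longleftrightarrow> (\<forall>a. 0 \<le> p a) \<and> sum p UNIV = 1"

definition stoch :: "('x::finite \<Rightarrow> 'y::finite \<Rightarrow> real) \<Rightarrow> bool" where
  "stoch W \<longleftrightarrow> (\<forall>x. pdist (W x))"

definition m_type :: "nat \<Rightarrow> ('x::finite \<Rightarrow> real) \<Rightarrow> bool" where
  "m_type m P \<longleftrightarrow> pdist P \<and> (\<forall>a. \<exists>k::nat. P a = real k / real m)"

definition typ_class :: "nat \<Rightarrow> ('x::finite \<Rightarrow> real) \<Rightarrow> 'x list set" where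
  "typ_class n P = {xs. length xs = n \<and> (\<forall>a. real (count_list xs a) = real n * P a)}"

definition chan_n :: "('x \<Rightarrow> 'y \<Rightarrow> real) \<Rightarrow> 'x list \<Rightarrow> 'y list \<Rightarrow> real" where
  "chan_n W xs ys = (\<Prod>i<length xs. W (xs ! i) (ys ! i))"

definition out_dist :: "nat \<Rightarrow> ('x::finite \<Rightarrow> real) \<Rightarrow> ('x \<Rightarrow> 'y \<Rightarrow> real) \<Rightarrow> 'y list \<Rightarrow> real" where
  "out_dist n P W ys = (\<Sum>xs\<in>typ_class n P. chan_n W xs ys) / real (card (typ_class n P))"

definition codebook_out :: "('x \<Rightarrow> 'y \<Rightarrow> real) \<Rightarrow> (nat \<Rightarrow> 'x list) \<Rightarrow> nat \<Rightarrow> 'y list \<Rightarrow> real" where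
  "codebook_out W c M ys = (\<Sum>j<M. chan_n W (c j) ys) / real M"

text \<open>E[ || P_{Y^n|D_M^n} - R_{Y^n} ||_1 ] with M = ceil(b^(nR)) codewords drawn
  i.i.d. uniformly from the type class.\<close>
definition exp_l1 :: "real \<Rightarrow> nat \<Rightarrow> real \<Rightarrow> ('x::finite \<Rightarrow> real) \<Rightarrow> ('x \<Rightarrow> 'y::finite \<Rightarrow> real) \<Rightarrow> real" where
  "exp_l1 b n R P W =
     (let M = nat \<lceil>b powr (real n * R)\<rceil>; T = typ_class n P in
      (\<Sum>c\<in>PiE {..<M} (\<lambda>_. T).
          \<Sum>ys\<in>{ys::'y list. length ys = n}. \<bar>codebook_out W c M ys - out_dist n P W ys\<bar>)
      / real (card T) ^ M)"

definition divKL :: "real \<Rightarrow> ('a::finite \<Rightarrow> real) \<Rightarrow> ('a \<Rightarrow> real) \<Rightarrow> ereal" where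
  "divKL b p q = (if \<exists>a. p a > 0 \<and> q a = 0 then \<infinity>
                  else ereal (\<Sum>a | p a > 0. p a * log b (p a / q a)))"

definition joint :: "('x \<Rightarrow> real) \<Rightarrow> ('x \<Rightarrow> 'y \<Rightarrow> real) \<Rightarrow> 'x \<times> 'y \<Rightarrow> real" where
  "joint P Q = (\<lambda>(x, y). P x * Q x y)"

definition marginal :: "('x::finite \<Rightarrow> real) \<Rightarrow> ('x \<Rightarrow> 'y \<Rightarrow> real) \<Rightarrow> 'y \<Rightarrow> real" where
  "marginal P Q y = (\<Sum>x\<in>UNIV. P x * Q x y)"

definition prodd :: "('x \<Rightarrow> real) \<Rightarrow> ('y \<Rightarrow> real) \<Rightarrow> 'x \<times> 'y \<Rightarrow> real" where
  "prodd P q = (\<lambda>(x, y). P x * q y)"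

text \<open>Mutual information I(P,W) = D(P W || P x (P W)_Y) (always finite).\<close>
definition mutinf :: "real \<Rightarrow> ('x::finite \<Rightarrow> real) \<Rightarrow> ('x \<Rightarrow> 'y::finite \<Rightarrow> real) \<Rightarrow> real" where
  "mutinf b P W = real_of_ereal (divKL b (joint P W) (prodd P (marginal P W)))"

text \<open>Renyi divergence of order l (used for l >= 1); order 1 is relative entropy.\<close>
definition renyi :: "real \<Rightarrow> real \<Rightarrow> ('a::finite \<Rightarrow> real) \<Rightarrow> ('a \<Rightarrow> real) \<Rightarrow> ereal" where
  "renyi b l p q = (if l = 1 then divKL b p q
     else if \<exists>a. p a > 0 \<and> q a = 0 then \<infinity>
     else ereal (1 / (l - 1) * log b (\<Sum>a | p a > 0. p a powr l * q a powr (1 - l))))"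

definition csiszar :: "real \<Rightarrow> real \<Rightarrow> ('x::finite \<Rightarrow> real) \<Rightarrow> ('x \<Rightarrow> 'y::finite \<Rightarrow> real) \<Rightarrow> ereal" where
  "csiszar b l P W = (INF S\<in>{S. pdist S}. \<Sum>x | P x > 0. ereal (P x) * renyi b l (W x) S)"

end

theory Submission
  imports Defs "HOL-Combinatorics.Multiset_Permutations" "HOL-Real_Asymp.Real_Asymp"
begin

text \<open>
Fix an output sequence \<open>y\<close> and let \<open>X\<close> be its likelihood under a random codeword; the contribution
of \<open>y\<close> to the expected distance is the mean absolute deviation of an average of \<open>M\<close> independent
copies of \<open>X\<close>.

Achievability: truncating \<open>X\<close> at a multiple of \<open>S\<^sup>n(y)\<close>, using variances below and means above the
truncation level, bounds the sum over \<open>y\<close> by \<open>3 exp (- n G)\<close> with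
\<open>G = (\<lambda> - 1) / \<lambda> (R - \<Sum>x. P x D\<^sub>\<lambda>(W x, S))\<close>, for every output law \<open>S\<close> and every \<open>\<lambda> \<in> [1, 2]\<close>.

Converse: for any channel \<open>Q\<close> at least as good as \<open>W\<close> in the minimisation, let \<open>A\<close> be the set of
codewords jointly \<open>Q\<close>-typical with \<open>y\<close>. On \<open>A\<close> the likelihood is at least twice its mean, so by
Jensen the deviation is at least that of a binomial count of hits in \<open>A\<close>. Typicality is defined by
likelihood ratios, hence a change of measure and Chebyshev's inequality suffice; non-degeneracy
enters through \<open>I(P, W) > 0\<close>.

The bounds meet: at a minimiser \<open>Q\<close> a separating hyperplane in the plane linearises the positive
part with a slope \<open>\<rho> \<in> [0, 1/2]\<close>, and with \<open>\<lambda> = 1 / (1 - \<rho>)\<close> and \<open>S\<close> the output law of \<open>Q\<close> the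
value at \<open>Q\<close> is at most \<open>G\<close>. In particular the inequality \<open>max \<le> min\<close> needs no proof of its own,
since both sides sandwich the same limit.
\<close>

section \<open>Expectations over an i.i.d. codebook\<close>

text \<open>Two facts shape the exponents. Additive functionals of a codeword are constant on a type
  class, so sums attached to a single codeword are exact exponentials; comparing the uniform law on
  the class with a product law costs only a factor polynomial in the blocklength. The 1/2 before the
  positive part is the square-root law: a set of codewords of relative size p is hit about M p
  times, with fluctuation sqrt(M p) when M p is large, while for small M p a single hit is already a
  full deviation. The expression sqrt(1 + 3 M p) covers both regimes and so produces [.]_+. The
  obstacle in the converse is that codewords outside the typical set also contribute to the mean
  likelihood; a likelihood of at least twice the mean keeps the hits visible. Describing typicality
  by two log-likelihood ratios lets the argument run at the exact real-valued minimiser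
  \<open>Q\<close>, without rounding it to joint types.\<close>

definition avg :: "'a set \<Rightarrow> ('a \<Rightarrow> real) \<Rightarrow> real" where
  "avg T f = (\<Sum>t\<in>T. f t) / real (card T)"

text \<open>Codebooks are extensional functions on \<open>{..<M}\<close>, as in
  \<open>exp_l1\<close>, so the expectation is a finite sum divided by the number of
  codebooks.\<close>

definition cb_exp :: "'a set \<Rightarrow> nat \<Rightarrow> ((nat \<Rightarrow> 'a) \<Rightarrow> real) \<Rightarrow> real" where
  "cb_exp T M g = (\<Sum>c\<in>PiE {..<M} (\<lambda>_. T). g c) / real (card T) ^ M"

lemma avg_add: "avg T (\<lambda>t. f t + g t) = avg T f + avg T g"
  by (simp add: avg_def sum.distrib add_divide_distrib)

lemma avg_diff: "avg T (\<lambda>t. f t - g t) = avg T f - avg T g"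
  by (simp add: avg_def sum_subtractf diff_divide_distrib)

lemma avg_cmult: "avg T (\<lambda>t. a * f t) = a * avg T f"
  by (simp add: avg_def sum_distrib_left)

lemma avg_const: "finite T \<Longrightarrow> T \<noteq> {} \<Longrightarrow> avg T (\<lambda>t. a) = a"
  by (simp add: avg_def)

lemma avg_mono: "(\<And>t. t \<in> T \<Longrightarrow> f t \<le> g t) \<Longrightarrow> avg T f \<le> avg T g"
  by (simp add: avg_def divide_right_mono sum_mono)

lemma cb_exp_add: "cb_exp T M (\<lambda>c. f c + g c) = cb_exp T M f + cb_exp T M g"
  by (simp add: cb_exp_def sum.distrib add_divide_distrib)

lemma cb_exp_diff: "cb_exp T M (\<lambda>c. f c - g c) = cb_exp T M f - cb_exp T M g"
  by (simp add: cb_exp_def sum_subtractf diff_divide_distrib)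

lemma cb_exp_cmult: "cb_exp T M (\<lambda>c. a * f c) = a * cb_exp T M f"
  by (simp add: cb_exp_def sum_distrib_left)

lemma cb_exp_const: "finite T \<Longrightarrow> T \<noteq> {} \<Longrightarrow> cb_exp T M (\<lambda>c. a) = a"
  by (simp add: cb_exp_def card_PiE)

lemma cb_exp_mono:
  "(\<And>c. c \<in> PiE {..<M} (\<lambda>_. T) \<Longrightarrow> f c \<le> g c) \<Longrightarrow> cb_exp T M f \<le> cb_exp T M g"
  by (simp add: cb_exp_def divide_right_mono sum_mono)

lemma cb_exp_avg: "cb_exp T M (\<lambda>c. avg T (\<lambda>t. g c t)) = avg T (\<lambda>t. cb_exp T M (\<lambda>c. g c t))"
  by (simp add: cb_exp_def avg_def sum_divide_distrib mult.commute sum.swap[of _ _ T])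

text \<open>Independence of the codewords, in the form that drives the inductions on
  \<open>M\<close>: the last codeword can be averaged by itself.\<close>

lemma cb_exp_Suc:
  "cb_exp T (Suc M) g = cb_exp T M (\<lambda>c. avg T (\<lambda>t. g (c(M := t))))"
proof -
  have "(\<Sum>c\<in>PiE {..<Suc M} (\<lambda>_. T). g c)
      = (\<Sum>(t, c)\<in>T \<times> PiE {..<M} (\<lambda>_. T). g (c(M := t)))"
  proof (rule sum.reindex_cong)
    show "inj_on (\<lambda>(t, c). c(M := t)) (T \<times> PiE {..<M} (\<lambda>_. T))"
      using inj_combinator[of M "{..<M}" "\<lambda>_. T"] by simp
    show "PiE {..<Suc M} (\<lambda>_. T) = (\<lambda>(t, c). c(M := t)) ` (T \<times> PiE {..<M} (\<lambda>_. T))"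
      by (simp add: lessThan_Suc PiE_insert_eq)
  qed auto
  also have "\<dots> = (\<Sum>c\<in>PiE {..<M} (\<lambda>_. T). \<Sum>t\<in>T. g (c(M := t)))"
    by (simp add: sum.cartesian_product[symmetric] sum.swap[of _ T])
  finally show ?thesis
    by (simp add: cb_exp_def avg_def sum_divide_distrib)
qed

text \<open>The function \<open>\<phi>\<close> stays a parameter because one more summand only
  shifts its argument; moments and comparisons then follow by induction on \<open>M\<close>.\<close>

definition iid_exp :: "'a set \<Rightarrow> ('a \<Rightarrow> real) \<Rightarrow> nat \<Rightarrow> (real \<Rightarrow> real) \<Rightarrow> real" where
  "iid_exp T d M \<phi> = cb_exp T M (\<lambda>c. \<phi> (\<Sum>j<M. d (c j)))"

lemma iid_exp_0: "iid_exp T d 0 \<phi> = \<phi> 0"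
  by (simp add: iid_exp_def cb_exp_def)

lemma iid_exp_Suc: "iid_exp T d (Suc M) \<phi> = avg T (\<lambda>t. iid_exp T d M (\<lambda>s. \<phi> (s + d t)))"
proof -
  have "(\<Sum>j<M. d ((c(M := t)) j)) = (\<Sum>j<M. d (c j))" for c t
    by (rule sum.cong) auto
  then show ?thesis by (simp add: iid_exp_def cb_exp_Suc cb_exp_avg del: fun_upd_apply) simp
qed

lemma iid_exp_add:
  "iid_exp T d M (\<lambda>s. f s + g s) = iid_exp T d M (\<lambda>s. f s) + iid_exp T d M (\<lambda>s. g s)"
  by (simp add: iid_exp_def cb_exp_add)

lemma iid_exp_diff:
  "iid_exp T d M (\<lambda>s. f s - g s) = iid_exp T d M (\<lambda>s. f s) - iid_exp T d M (\<lambda>s. g s)"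
  by (simp add: iid_exp_def cb_exp_diff)

lemma iid_exp_cmult: "iid_exp T d M (\<lambda>s. a * f s) = a * iid_exp T d M (\<lambda>s. f s)"
  by (simp add: iid_exp_def cb_exp_cmult)

lemma iid_exp_const: "finite T \<Longrightarrow> T \<noteq> {} \<Longrightarrow> iid_exp T d M (\<lambda>s. a) = a"
  by (simp add: iid_exp_def cb_exp_const)

lemma iid_exp_mono: "(\<And>s. f s \<le> g s) \<Longrightarrow> iid_exp T d M f \<le> iid_exp T d M g"
  by (simp add: iid_exp_def cb_exp_mono)

section \<open>Moments of centred i.i.d. sums\<close>

context
  fixes T :: "'a set" and d :: "'a \<Rightarrow> real"
  assumes T: "finite T" "T \<noteq> {}" and centered: "avg T d = 0"
begin

lemma iid_exp_moment1: "iid_exp T d M (\<lambda>s. s) = 0"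
  by (induction M) (simp_all add: iid_exp_0 iid_exp_Suc iid_exp_add iid_exp_const T centered)

lemma iid_exp_moment2: "iid_exp T d M (\<lambda>s. s\<^sup>2) = real M * avg T (\<lambda>t. (d t)\<^sup>2)"
proof (induction M)
  case (Suc M)
  have "iid_exp T d M (\<lambda>s. (s + d t)\<^sup>2) = iid_exp T d M (\<lambda>s. s\<^sup>2) + (d t)\<^sup>2" for t
  proof -
    have "iid_exp T d M (\<lambda>s. (s + d t)\<^sup>2) = iid_exp T d M (\<lambda>s. s\<^sup>2 + (2 * d t) * s + (d t)\<^sup>2)"
      by (rule arg_cong[of _ _ "iid_exp T d M"]) (auto simp: power2_sum)
    also have "\<dots> = iid_exp T d M (\<lambda>s. s\<^sup>2) + (d t)\<^sup>2"
      by (simp add: iid_exp_add iid_exp_cmult iid_exp_const T iid_exp_moment1)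
    finally show ?thesis .
  qed
  then show ?case by (simp add: iid_exp_Suc avg_add avg_const T Suc algebra_simps)
qed (simp add: iid_exp_0)

text \<open>After expansion only four equal indices or two pairs of equal indices survive; the pairs
  account for \<open>3 * M * (M - 1)\<close>.\<close>

lemma iid_exp_moment4:
  "iid_exp T d M (\<lambda>s. s ^ 4)
    = real M * avg T (\<lambda>t. d t ^ 4) + 3 * real M * (real M - 1) * (avg T (\<lambda>t. (d t)\<^sup>2))\<^sup>2"
proof (induction M)
  case (Suc M)
  let ?s2 = "avg T (\<lambda>t. (d t)\<^sup>2)"
  have "iid_exp T d M (\<lambda>s. (s + d t) ^ 4) = iid_exp T d M (\<lambda>s. s ^ 4)
      + (4 * iid_exp T d M (\<lambda>s. s ^ 3)) * d t + (6 * (real M * ?s2)) * (d t)\<^sup>2 + d t ^ 4" for t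
  proof -
    have "iid_exp T d M (\<lambda>s. (s + d t) ^ 4) = iid_exp T d M
        (\<lambda>s. s ^ 4 + (4 * d t) * s ^ 3 + (6 * (d t)\<^sup>2) * s\<^sup>2 + (4 * d t ^ 3) * s + d t ^ 4)"
      by (rule arg_cong[of _ _ "iid_exp T d M"]) (auto simp: algebra_simps power4_eq_xxxx power2_eq_square power3_eq_cube)
    also have "\<dots> = iid_exp T d M (\<lambda>s. s ^ 4)
        + (4 * iid_exp T d M (\<lambda>s. s ^ 3)) * d t + (6 * (real M * ?s2)) * (d t)\<^sup>2 + d t ^ 4"
      by (simp add: iid_exp_add iid_exp_cmult iid_exp_const T iid_exp_moment1 iid_exp_moment2)
    finally show ?thesis .
  qed
  \<comment> \<open>The third moment is never evaluated: it is multiplied by \<open>avg T d\<close>,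
    which is zero.\<close>
  then have "iid_exp T d (Suc M) (\<lambda>s. s ^ 4) = iid_exp T d M (\<lambda>s. s ^ 4)
      + 6 * real M * ?s2 * ?s2 + avg T (\<lambda>t. d t ^ 4)"
    by (simp add: iid_exp_Suc avg_add avg_cmult avg_const T centered)
  then show ?case by (simp add: Suc algebra_simps power2_eq_square)
qed (simp add: iid_exp_0)

text \<open>With \<open>u = |s| / c\<close> this is \<open>u^2 - u^4 <= u\<close> for
  \<open>u >= 0\<close>. It bounds a first absolute moment from below by two even moments, with
  \<open>c\<close> left free to balance them.\<close>

lemma iid_exp_abs_lower:
  assumes "c > 0"
  shows "iid_exp T d M (\<lambda>s. s\<^sup>2) / c - iid_exp T d M (\<lambda>s. s ^ 4) / c ^ 3 \<le> iid_exp T d M (\<lambda>s. \<bar>s\<bar>)"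
proof -
  have "(1 / c) * s\<^sup>2 - (1 / c ^ 3) * s ^ 4 \<le> \<bar>s\<bar>" for s :: real
  proof -
    have *: "s\<^sup>2 * c\<^sup>2 - s ^ 4 \<le> \<bar>s\<bar> * c ^ 3"
    proof (cases "\<bar>s\<bar> \<le> c")
      case True
      have "s\<^sup>2 * c\<^sup>2 = \<bar>s\<bar> * (\<bar>s\<bar> * c\<^sup>2)" by (simp add: power2_eq_square)
      also have "\<dots> \<le> \<bar>s\<bar> * (c * c\<^sup>2)" using True by (intro mult_left_mono mult_right_mono) auto
      finally have "s\<^sup>2 * c\<^sup>2 \<le> \<bar>s\<bar> * c ^ 3" by (simp add: power3_eq_cube power2_eq_square)
      moreover have "0 \<le> s ^ 4" by simp
      ultimately show ?thesis by linarith
    next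
      case False
      then have "c\<^sup>2 \<le> s\<^sup>2" using assms by (intro abs_le_square_iff[THEN iffD1]) auto
      then have "s\<^sup>2 * c\<^sup>2 \<le> s\<^sup>2 * s\<^sup>2" by (intro mult_left_mono) auto
      moreover have "s\<^sup>2 * s\<^sup>2 = s ^ 4" by (simp add: power2_eq_square power4_eq_xxxx)
      moreover have "0 \<le> \<bar>s\<bar> * c ^ 3" using assms by simp
      ultimately show ?thesis by linarith
    qed
    have "(1 / c) * s\<^sup>2 - (1 / c ^ 3) * s ^ 4 = (s\<^sup>2 * c\<^sup>2 - s ^ 4) / c ^ 3"
      using assms by (simp add: field_simps power2_eq_square power3_eq_cube)
    also have "\<dots> \<le> \<bar>s\<bar>" using assms * by (simp add: divide_le_eq)
    finally show ?thesis .
  qed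
  then have "iid_exp T d M (\<lambda>s. (1 / c) * s\<^sup>2 - (1 / c ^ 3) * s ^ 4) \<le> iid_exp T d M (\<lambda>s. \<bar>s\<bar>)"
    by (rule iid_exp_mono)
  then show ?thesis by (simp only: iid_exp_diff iid_exp_cmult) simp
qed

end

text \<open>Summands are exchanged one at a time; the others act as a constant meanwhile, which is
  why the hypothesis is asked for every shift \<open>a\<close>.\<close>

lemma iid_exp_convex_order:
  assumes "\<And>a. avg T (\<lambda>t. \<bar>a + d' t\<bar>) \<le> avg T (\<lambda>t. \<bar>a + d t\<bar>)"
  shows "iid_exp T d' M (\<lambda>s. \<bar>a + s\<bar>) \<le> iid_exp T d M (\<lambda>s. \<bar>a + s\<bar>)"
proof (induction M arbitrary: a)
  case (Suc M)
  have "iid_exp T d' (Suc M) (\<lambda>s. \<bar>a + s\<bar>)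
      = avg T (\<lambda>t. iid_exp T d' M (\<lambda>s. \<bar>(a + d' t) + s\<bar>))"
    by (simp add: iid_exp_Suc algebra_simps)
  also have "\<dots> \<le> avg T (\<lambda>t. iid_exp T d M (\<lambda>s. \<bar>(a + d' t) + s\<bar>))"
    by (intro avg_mono Suc)
  also have "\<dots> = cb_exp T M (\<lambda>c. avg T (\<lambda>t. \<bar>(a + (\<Sum>j<M. d (c j))) + d' t\<bar>))"
    by (simp add: iid_exp_def cb_exp_avg algebra_simps)
  also have "\<dots> \<le> cb_exp T M (\<lambda>c. avg T (\<lambda>t. \<bar>(a + (\<Sum>j<M. d (c j))) + d t\<bar>))"
    by (intro cb_exp_mono assms)
  also have "\<dots> = iid_exp T d (Suc M) (\<lambda>s. \<bar>a + s\<bar>)"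
    unfolding iid_exp_Suc by (simp add: iid_exp_def cb_exp_avg algebra_simps)
  finally show ?case .
qed (simp add: iid_exp_0)

lemma iid_exp_mean_abs:
  assumes "M > 0"
  shows "cb_exp T M (\<lambda>c. \<bar>(\<Sum>j<M. X (c j)) / real M - \<mu>\<bar>)
    = iid_exp T (\<lambda>t. X t - \<mu>) M (\<lambda>s. \<bar>s\<bar>) / real M"
proof -
  have "\<bar>(\<Sum>j<M. X (c j)) / real M - \<mu>\<bar> = (1 / real M) * \<bar>\<Sum>j<M. X (c j) - \<mu>\<bar>" for c
  proof -
    have "(\<Sum>j<M. X (c j)) / real M - \<mu> = (1 / real M) * (\<Sum>j<M. X (c j) - \<mu>)"
      using assms by (simp add: sum_subtractf field_simps)
    then show ?thesis by (simp only: abs_mult) simp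
  qed
  then show ?thesis unfolding iid_exp_def by (simp add: cb_exp_cmult[of T M "1 / real M", simplified])
qed

lemma avg_two_valued:
  assumes "finite T" "T \<noteq> {}" "A \<subseteq> T"
  shows "avg T (\<lambda>t. if t \<in> A then u else v)
    = real (card A) / real (card T) * u + (1 - real (card A) / real (card T)) * v"
proof -
  have "real (card T) > 0" using assms by (simp add: card_gt_0_iff)
  moreover have "T \<inter> {t. t \<in> A} = A" "T \<inter> - {t. t \<in> A} = T - A" using assms by auto
  moreover have "card (T - A) = card T - card A" "card A \<le> card T"
    using assms by (auto simp: card_Diff_subset finite_subset card_mono)
  ultimately show ?thesis
    using assms by (simp add: avg_def sum.If_cases field_simps of_nat_diff)
qed

lemma sum_abs_ge_card_mult:
  fixes X :: "'a \<Rightarrow> real" and a m :: real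
  assumes "card A * m = (\<Sum>t\<in>A. X t)"
  shows "card A * \<bar>a + m\<bar> \<le> (\<Sum>t\<in>A. \<bar>a + X t\<bar>)"
proof -
  have "card A * \<bar>a + m\<bar> = \<bar>card A * (a + m)\<bar>" by (simp add: abs_mult)
  also have "card A * (a + m) = (\<Sum>t\<in>A. a + X t)"
    using assms by (simp add: sum.distrib distrib_left)
  finally show ?thesis by (simp only: sum_abs)
qed

text \<open>By Jensen, \<^term>\<open>X\<close> may be replaced by its conditional means on \<^term>\<open>A\<close> and on the complement;
  the fourth moment of the resulting two-valued sum is controlled by its variance.\<close>

lemma cb_exp_abs_dev_lower:
  fixes X :: "'a \<Rightarrow> real"
  assumes T: "finite T" "T \<noteq> {}" and M: "M > 0"
    and X: "\<And>t. t \<in> T \<Longrightarrow> 0 \<le> X t"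
    and A: "A \<subseteq> T" "\<And>t. t \<in> A \<Longrightarrow> 2 * avg T X \<le> X t"
  shows "(\<Sum>t\<in>A. X t) / card T / (8 * sqrt (1 + 3 * (M * (card A / card T))))
    \<le> cb_exp T M (\<lambda>c. \<bar>(\<Sum>j<M. X (c j)) / real M - avg T X\<bar>)" (is "?L \<le> ?R")
proof (cases "(\<Sum>t\<in>A. X t) = 0")
  case True
  have "cb_exp T M (\<lambda>c. 0) \<le> ?R" by (rule cb_exp_mono) simp
  then show ?thesis using True T by (simp add: cb_exp_const)
next
  case False
  have finA: "finite A" using A T finite_subset by blast
  have N: "real (card T) > 0" using T by (simp add: card_gt_0_iff)
  have "0 \<le> (\<Sum>t\<in>A. X t)" using X A by (intro sum_nonneg) auto
  with False have pos: "(\<Sum>t\<in>A. X t) > 0" by simp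
  then have Ane: "A \<noteq> {}" by auto
  then have a: "real (card A) > 0" using finA by (simp add: card_gt_0_iff)
  define \<mu> where "\<mu> = avg T X"
  have sumT: "(\<Sum>t\<in>T. X t) = card T * \<mu>" using N by (simp add: \<mu>_def avg_def)
  have sumA: "(\<Sum>t\<in>A. X t) \<ge> card A * (2 * \<mu>)"
    using sum_mono[of A "\<lambda>_. 2 * \<mu>" X] A by (simp add: \<mu>_def)
  \<comment> \<open>Otherwise the mean over \<open>T\<close>, which would be positive, would be at
    least twice itself.\<close>
  have "A \<noteq> T"
  proof
    assume "A = T"
    then have "card T * \<mu> \<le> 0" using sumA[unfolded \<open>A = T\<close>] sumT by linarith
    with sumT pos[unfolded \<open>A = T\<close>] show False by linarith
  qed
  with A T have "card A < card T" by (simp add: psubset_card_mono psubset_eq)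
  define p where "p = card A / card T"
  have p: "0 < p" "p < 1" using a N \<open>card A < card T\<close> by (auto simp: p_def)
  define mA where "mA = (\<Sum>t\<in>A. X t) / card A"
  define mB where "mB = (\<Sum>t\<in>T-A. X t) / card (T - A)"
  define w where "w = mA - mB"
  have cB: "real (card (T - A)) = real (card T) - real (card A)"
    using A T finA \<open>card A < card T\<close> by (simp add: card_Diff_subset of_nat_diff)
  have mA: "card A * mA = (\<Sum>t\<in>A. X t)" using a by (simp add: mA_def)
  have mB: "card (T - A) * mB = (\<Sum>t\<in>T-A. X t)"
    using cB \<open>card A < card T\<close> by (simp add: mB_def)
  have split: "(\<Sum>t\<in>T. g t) = (\<Sum>t\<in>A. g t) + (\<Sum>t\<in>T-A. g t)" for g :: "'a \<Rightarrow> real"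
    using A T by (simp add: sum.subset_diff add.commute)
  have "card T * \<mu> = card A * mA + (real (card T) - real (card A)) * mB"
    using sumT split[of X] mA mB cB by simp
  then have \<mu>: "\<mu> = p * mA + (1 - p) * mB"
    using N by (simp add: p_def field_simps)
  have w1: "w * (1 - p) = mA - \<mu>" and w2: "w * p = \<mu> - mB"
    by (simp_all add: w_def \<mu> algebra_simps)
  have "card A * mA \<ge> card A * (2 * \<mu>)" using mA sumA by simp
  then have "mA \<ge> 2 * \<mu>" using a by simp
  have "mA > 0" using pos a by (simp add: mA_def)
  have wp: "w * (1 - p) \<ge> mA / 2" using w1 \<open>mA \<ge> 2 * \<mu>\<close> by simp
  then have w: "w > 0" using \<open>mA > 0\<close> p
    by (smt (verit) divide_pos_pos mult_nonneg_nonneg mult_nonpos_nonneg)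
  \<comment> \<open>The conditional mean of \<open>X - \<mu>\<close> given membership in
    \<open>A\<close>: a centred two-valued variable with jump \<open>w\<close>.\<close>
  define d where "d = (\<lambda>t. if t \<in> A then w * (1 - p) else - (w * p))"
  have avg2: "avg T (\<lambda>t. if t \<in> A then u else v) = p * u + (1 - p) * v" for u v
    using avg_two_valued T A by (simp add: p_def)
  have d0: "avg T d = 0" unfolding d_def avg2 by (simp add: algebra_simps)
  have if_fun: "(if t \<in> A then x else y) ^ n = (if t \<in> A then x ^ n else y ^ n)" for t n and x y :: real
    by simp
  have d2: "avg T (\<lambda>t. (d t)\<^sup>2) = w\<^sup>2 * (p * (1 - p))"
    unfolding d_def if_fun avg2 by (simp add: algebra_simps power2_eq_square)
  have d4: "avg T (\<lambda>t. d t ^ 4) \<le> w ^ 4 * (p * (1 - p))"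
  proof -
    have "avg T (\<lambda>t. d t ^ 4) = w ^ 4 * (p * (1 - p)) * ((1 - p) ^ 3 + p ^ 3)"
      unfolding d_def if_fun avg2
      by (simp add: power_mult_distrib power4_eq_xxxx power3_eq_cube) (simp add: algebra_simps)
    also have "\<dots> \<le> w ^ 4 * (p * (1 - p)) * 1"
    proof (rule mult_left_mono)
      have "(1 - p) ^ 3 \<le> 1 - p" "p ^ 3 \<le> p"
        using p power_decreasing[of 1 3 "1 - p"] power_decreasing[of 1 3 p] by auto
      then show "(1 - p) ^ 3 + p ^ 3 \<le> 1" by simp
    qed (use w p in simp)
    finally show ?thesis by simp
  qed
  have d_eq: "d t = (if t \<in> A then mA - \<mu> else mB - \<mu>)" for t
    by (simp add: d_def w1 w2)
  have order: "avg T (\<lambda>t. \<bar>a + d t\<bar>) \<le> avg T (\<lambda>t. \<bar>a + (X t - \<mu>)\<bar>)" for a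
  proof -
    have "(\<Sum>t\<in>A. \<bar>a + d t\<bar>) = card A * \<bar>(a - \<mu>) + mA\<bar>"
      by (simp add: d_eq algebra_simps)
    also have "\<dots> \<le> (\<Sum>t\<in>A. \<bar>(a - \<mu>) + X t\<bar>)"
      using mA by (rule sum_abs_ge_card_mult)
    finally have 1: "(\<Sum>t\<in>A. \<bar>a + d t\<bar>) \<le> (\<Sum>t\<in>A. \<bar>a + (X t - \<mu>)\<bar>)" by (simp add: algebra_simps)
    have "(\<Sum>t\<in>T-A. \<bar>a + d t\<bar>) = card (T-A) * \<bar>(a - \<mu>) + mB\<bar>"
      using cB by (simp add: d_eq algebra_simps)
    also have "\<dots> \<le> (\<Sum>t\<in>T-A. \<bar>(a - \<mu>) + X t\<bar>)"
      using mB by (rule sum_abs_ge_card_mult)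
    finally have 2: "(\<Sum>t\<in>T-A. \<bar>a + d t\<bar>) \<le> (\<Sum>t\<in>T-A. \<bar>a + (X t - \<mu>)\<bar>)" by (simp add: algebra_simps)
    show ?thesis unfolding avg_def split using 1 2 by (intro divide_right_mono) auto
  qed
  define s where "s = M * (p * (1 - p))"
  have s: "0 \<le> s" "s \<le> M * p" using p by (auto simp: s_def mult_left_mono mult_le_cancel_left1)
  \<comment> \<open>The cut in \<open>iid_exp_abs_lower\<close> will be \<open>c = w * q\<close>.
    This \<open>q\<close> makes the bound on the fourth-moment term exactly half of the
    second-moment term.\<close>
  define q where "q = sqrt (2 * (1 + 3 * s))"
  have q: "q > 0" "q\<^sup>2 = 2 * (1 + 3 * s)" using s by (auto simp: q_def)
  have m2: "iid_exp T d M (\<lambda>s. s\<^sup>2) = w\<^sup>2 * s"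
    by (simp add: iid_exp_moment2[OF T d0] d2 s_def)
  have m4: "iid_exp T d M (\<lambda>s. s ^ 4) \<le> w ^ 4 * (s + 3 * s\<^sup>2)"
  proof -
    have "iid_exp T d M (\<lambda>s. s ^ 4) \<le> M * (w ^ 4 * (p * (1 - p))) + 3 * real M * (real M - 1) * (w\<^sup>2 * (p * (1 - p)))\<^sup>2"
      unfolding iid_exp_moment4[OF T d0] d2 using d4 by (intro add_right_mono mult_left_mono) auto
    also have "\<dots> \<le> M * (w ^ 4 * (p * (1 - p))) + 3 * real M * real M * (w\<^sup>2 * (p * (1 - p)))\<^sup>2"
      by (intro add_left_mono mult_right_mono mult_left_mono) auto
    also have "\<dots> = w ^ 4 * (s + 3 * s\<^sup>2)"
      by (simp add: s_def power2_eq_square power4_eq_xxxx algebra_simps)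
    finally show ?thesis .
  qed
  have "w * s / (2 * q) = (w\<^sup>2 * s) / (w * q) - w ^ 4 * (s + 3 * s\<^sup>2) / (w * q) ^ 3"
  proof -
    have "w ^ 4 * (s + 3 * s\<^sup>2) / (w * q) ^ 3 = w * s * (1 + 3 * s) / (q * q\<^sup>2)"
    proof -
      have "w ^ 4 * (s + 3 * s\<^sup>2) = w ^ 3 * (w * s * (1 + 3 * s))"
        by (simp add: power2_eq_square power3_eq_cube power4_eq_xxxx algebra_simps)
      moreover have "(w * q) ^ 3 = w ^ 3 * (q * q\<^sup>2)"
        by (simp add: power2_eq_square power3_eq_cube algebra_simps)
      ultimately show ?thesis using w by simp
    qed
    also have "q * q\<^sup>2 = (2 * q) * (1 + 3 * s)" by (simp add: q(2))
    also have "w * s * (1 + 3 * s) / ((2 * q) * (1 + 3 * s)) = w * s / (2 * q)"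
      using s by (intro nonzero_mult_divide_mult_cancel_right) auto
    finally show ?thesis using w q by (simp add: power2_eq_square)
  qed
  also have "\<dots> \<le> iid_exp T d M (\<lambda>s. s\<^sup>2) / (w * q) - iid_exp T d M (\<lambda>s. s ^ 4) / (w * q) ^ 3"
    using m2 m4 w q by (intro diff_mono divide_right_mono) auto
  also have "\<dots> \<le> iid_exp T d M (\<lambda>s. \<bar>s\<bar>)"
    using w q by (intro iid_exp_abs_lower[OF T d0]) auto
  also have "\<dots> \<le> iid_exp T (\<lambda>t. X t - \<mu>) M (\<lambda>s. \<bar>s\<bar>)"
    using iid_exp_convex_order[OF order, of M 0] by simp
  also have "\<dots> = M * ?R"
    using iid_exp_mean_abs[OF M, of T X \<mu>] M by (simp add: \<mu>_def)
  finally have main: "w * s / (2 * q) \<le> M * ?R" .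
  have ws: "w * s \<ge> M * ((\<Sum>t\<in>A. X t) / card T) / 2"
  proof -
    have "w * s = M * p * (w * (1 - p))" by (simp add: s_def)
    moreover have "M * p * (mA / 2) \<le> M * p * (w * (1 - p))" using wp p by (intro mult_left_mono) auto
    moreover have "M * p * (mA / 2) = M * ((\<Sum>t\<in>A. X t) / card T) / 2"
      using a by (simp add: p_def mA_def)
    ultimately show ?thesis by linarith
  qed
  have qle: "q \<le> 2 * sqrt (1 + 3 * (M * p))"
  proof -
    have "q \<le> sqrt (4 * (1 + 3 * (M * p)))" unfolding q_def using s by (intro real_sqrt_le_mono) auto
    also have "\<dots> = 2 * sqrt (1 + 3 * (M * p))" unfolding real_sqrt_mult by simp
    finally show ?thesis .
  qed
  \<comment> \<open>The constant 8 collects a 2 from \<open>ws\<close>, a 2 from halving the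
    second-moment term and a 2 from \<open>qle\<close>.\<close>
  have "M * ?L = (M * ((\<Sum>t\<in>A. X t) / card T) / 2) / (2 * (2 * sqrt (1 + 3 * (M * p))))"
    by (simp add: p_def)
  also have "\<dots> \<le> w * s / (2 * q)"
    using ws qle q w s by (intro frac_le) auto
  finally have "M * ?L \<le> M * ?R" using main by linarith
  moreover have "real M > 0" using M by simp
  ultimately show ?thesis by (simp only: mult_le_cancel_left_pos)
qed

lemma cb_exp_sum_coord:
  assumes "finite T" "T \<noteq> {}"
  shows "cb_exp T M (\<lambda>c. \<Sum>j<M. f (c j)) = M * avg T f"
proof -
  have "iid_exp T f M (\<lambda>s. s) = M * avg T f"
    by (induction M) (simp_all add: iid_exp_0 iid_exp_Suc iid_exp_add iid_exp_const assms avg_add avg_const algebra_simps)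
  then show ?thesis by (simp add: iid_exp_def)
qed

text \<open>Second moment of the part of \<^term>\<open>X\<close> below \<^term>\<open>\<tau>\<close>, first moment of the part above.\<close>

lemma cb_exp_abs_dev_upper:
  fixes X :: "'a \<Rightarrow> real"
  assumes T: "finite T" "T \<noteq> {}" and M: "M > 0"
    and X: "\<And>t. t \<in> T \<Longrightarrow> 0 \<le> X t" and \<tau>: "\<tau> > 0" and l: "1 \<le> l" "l \<le> 2"
  shows "cb_exp T M (\<lambda>c. \<bar>(\<Sum>j<M. X (c j)) / real M - avg T X\<bar>)
    \<le> 5 / 2 * (\<tau> powr (1 - l) * avg T (\<lambda>t. X t powr l)) + \<tau> / (2 * M)"
proof -
  define Y where "Y = (\<lambda>t. if X t \<le> \<tau> then X t else 0)"
  define Z where "Z = (\<lambda>t. if X t \<le> \<tau> then 0 else X t)"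
  have XYZ: "X t = Y t + Z t" for t by (simp add: Y_def Z_def)
  have Z0: "0 \<le> Z t" if "t \<in> T" for t using X[OF that] by (simp add: Z_def)
  let ?B = "\<tau> powr (1 - l) * avg T (\<lambda>t. X t powr l)"
  let ?y = "\<lambda>c. (\<Sum>j<M. Y (c j)) / real M - avg T Y"
  have avgX: "avg T X = avg T Y + avg T Z" by (simp add: XYZ[abs_def] avg_add)
  have Zle: "avg T Z \<le> ?B"
  proof -
    have "Z t \<le> \<tau> powr (1 - l) * X t powr l" if "t \<in> T" for t
    proof (cases "X t \<le> \<tau>")
      case False
      then have "X t > 0" using \<tau> by simp
      have "X t = X t powr (1 - l) * X t powr l" using \<open>X t > 0\<close> by (simp flip: powr_add)
      also have "\<dots> \<le> \<tau> powr (1 - l) * X t powr l"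
        using False \<tau> l by (intro mult_right_mono powr_mono2') auto
      finally show ?thesis using False by (simp add: Z_def)
    qed (simp add: Z_def)
    then show ?thesis unfolding avg_cmult[symmetric] by (rule avg_mono)
  qed
  have Y2: "avg T (\<lambda>t. (Y t - avg T Y)\<^sup>2) \<le> \<tau> * ?B"
  proof -
    \<comment> \<open>Below the cut \<open>X^2 = X^(2-l) * X^l\<close>, and
      \<open>2 - l >= 0\<close> lets the first factor grow to \<open>\<tau>^(2-l)\<close>. This is
      what limits the order to 2.\<close>
    have "(Y t)\<^sup>2 \<le> \<tau> powr (2 - l) * X t powr l" if "t \<in> T" for t
    proof (cases "0 < X t \<and> X t \<le> \<tau>")
      case True
      then have "(Y t)\<^sup>2 = X t powr 2" by (simp add: Y_def powr_numeral)
      also have "\<dots> = X t powr (2 - l) * X t powr l" using True by (simp flip: powr_add)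
      also have "\<dots> \<le> \<tau> powr (2 - l) * X t powr l"
        using True l by (intro mult_right_mono powr_mono2) auto
      finally show ?thesis .
    next
      case False
      then have "Y t = 0" using X[OF that] by (auto simp: Y_def)
      then show ?thesis by simp
    qed
    then have "avg T (\<lambda>t. (Y t)\<^sup>2) \<le> \<tau> powr (2 - l) * avg T (\<lambda>t. X t powr l)"
      unfolding avg_cmult[symmetric] by (rule avg_mono)
    also have "\<tau> powr (2 - l) = \<tau> * \<tau> powr (1 - l)"
      using \<tau> powr_add[of \<tau> 1 "1 - l"] by simp
    finally have 1: "avg T (\<lambda>t. (Y t)\<^sup>2) \<le> \<tau> * ?B" by (simp add: mult.assoc)
    have "avg T (\<lambda>t. (Y t - avg T Y)\<^sup>2) = avg T (\<lambda>t. (Y t)\<^sup>2 - 2 * avg T Y * Y t + (avg T Y)\<^sup>2)"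
      by (rule arg_cong[of _ _ "avg T"]) (auto simp: power2_diff)
    also have "\<dots> = avg T (\<lambda>t. (Y t)\<^sup>2) - (avg T Y)\<^sup>2"
      by (simp add: avg_add avg_diff avg_cmult avg_const T power2_eq_square)
    finally show ?thesis using 1 by (smt (verit) zero_le_power2)
  qed
  have Ecb: "cb_exp T M (\<lambda>c. (?y c)\<^sup>2) \<le> \<tau> * ?B / M"
  proof -
    have "avg T (\<lambda>t. Y t - avg T Y) = 0" by (simp add: avg_diff avg_const T)
    note m2 = iid_exp_moment2[OF T this, of M]
    have "(?y c)\<^sup>2 = (1 / (real M)\<^sup>2) * (\<Sum>j<M. Y (c j) - avg T Y)\<^sup>2" for c
    proof -
      have "?y c = (\<Sum>j<M. Y (c j) - avg T Y) / M" using M by (simp add: sum_subtractf field_simps)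
      then show ?thesis by (simp add: power_divide)
    qed
    then have "cb_exp T M (\<lambda>c. (?y c)\<^sup>2)
        = (1 / (real M)\<^sup>2) * (M * avg T (\<lambda>t. (Y t - avg T Y)\<^sup>2))"
      using m2 by (simp only: cb_exp_cmult iid_exp_def)
    also have "\<dots> = avg T (\<lambda>t. (Y t - avg T Y)\<^sup>2) / M" using M by (simp add: power2_eq_square)
    also have "\<dots> \<le> \<tau> * ?B / M" using Y2 by (rule divide_right_mono) simp
    finally show ?thesis .
  qed
  have pointwise: "\<bar>(\<Sum>j<M. X (c j)) / real M - avg T X\<bar>
      \<le> (M / (2 * \<tau>)) * (?y c)\<^sup>2 + (1 / M) * (\<Sum>j<M. Z (c j)) + (\<tau> / (2 * M) + avg T Z)"
    if c: "c \<in> PiE {..<M} (\<lambda>_. T)" for c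
  proof -
    have sp: "(\<Sum>j<M. X (c j)) / real M - avg T X = ?y c + ((\<Sum>j<M. Z (c j)) / M - avg T Z)"
      unfolding avgX by (simp add: XYZ sum.distrib add_divide_distrib)
    have Zc: "0 \<le> (\<Sum>j<M. Z (c j)) / M" "0 \<le> avg T Z"
      using c Z0 by (auto intro!: divide_nonneg_nonneg sum_nonneg simp: avg_def)
    \<comment> \<open>The arithmetic-geometric mean inequality replaces Cauchy-Schwarz to get an
      error term linear in \<open>\<tau>\<close>: for a level proportional to \<open>S^n(y)\<close>
      it can be summed over all outputs.\<close>
    have "\<bar>?y c\<bar> \<le> (M / (2 * \<tau>)) * (?y c)\<^sup>2 + \<tau> / (2 * M)"
    proof -
      have "0 \<le> (\<bar>?y c\<bar> * M - \<tau>)\<^sup>2 / (2 * \<tau> * M)" using \<tau> by simp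
      also have "\<dots> = (M / (2 * \<tau>)) * (?y c)\<^sup>2 + \<tau> / (2 * M) - \<bar>?y c\<bar>"
        using \<tau> M by (simp add: power2_diff power_mult_distrib) (simp add: field_simps power2_eq_square)
      finally show ?thesis by simp
    qed
    then show ?thesis unfolding sp using Zc by simp
  qed
  have "cb_exp T M (\<lambda>c. \<bar>(\<Sum>j<M. X (c j)) / real M - avg T X\<bar>)
      \<le> cb_exp T M (\<lambda>c. (M / (2 * \<tau>)) * (?y c)\<^sup>2 + (1 / M) * (\<Sum>j<M. Z (c j)) + (\<tau> / (2 * M) + avg T Z))"
    by (rule cb_exp_mono) (rule pointwise)
  also have "\<dots> = (M / (2 * \<tau>)) * cb_exp T M (\<lambda>c. (?y c)\<^sup>2) + (1 / M) * (M * avg T Z) + (\<tau> / (2 * M) + avg T Z)"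
    by (simp only: cb_exp_add cb_exp_cmult cb_exp_const[OF T] cb_exp_sum_coord[OF T])
  \<comment> \<open>The lower part costs half of \<open>?B\<close>; the upper part costs
    \<open>?B\<close> twice, once in the codebook and once in the mean.\<close>
  also have "\<dots> \<le> (M / (2 * \<tau>)) * (\<tau> * ?B / M) + ?B + (\<tau> / (2 * M) + ?B)"
    using Ecb Zle M \<tau> by (intro add_mono mult_left_mono) auto
  also have "\<dots> = 5 / 2 * ?B + \<tau> / (2 * M)" using M \<tau> by simp
  finally show ?thesis .
qed

section \<open>Memoryless channels and type classes\<close>

lemma chan_n_Nil [simp]: "chan_n U [] ys = 1"
  by (simp add: chan_n_def)

lemma chan_n_Cons [simp]: "chan_n U (x # xs) (y # ys) = U x y * chan_n U xs ys"
  by (simp add: chan_n_def prod.lessThan_Suc_shift del: prod.lessThan_Suc)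

lemma sum_lists_Suc:
  fixes g :: "'a::finite list \<Rightarrow> 'b::comm_monoid_add"
  shows "(\<Sum>ys\<in>{ys. length ys = Suc n}. g ys) = (\<Sum>y\<in>UNIV. \<Sum>ys\<in>{ys. length ys = n}. g (y # ys))"
proof -
  have "(\<Sum>ys\<in>{ys. length ys = Suc n}. g ys) = (\<Sum>(y, ys)\<in>UNIV \<times> {ys. length ys = n}. g (y # ys))"
    by (rule sum.reindex_bij_witness[of _ "\<lambda>(y, ys). y # ys" "\<lambda>l. (hd l, tl l)"])
      (auto simp: length_Suc_conv)
  then show ?thesis by (simp add: sum.cartesian_product)
qed

lemma finite_lists_length [simp]: "finite {ys::'a::finite list. length ys = n}"
  using finite_lists_length_eq[of "UNIV :: 'a set" n] by simp

text \<open>The kernel \<open>U\<close> is arbitrary because the formula is also applied to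
  \<open>W^l * S^(1-l)\<close>, whose row sums are \<open>rsum\<close>.\<close>

lemma sum_chan_n:
  fixes U :: "'x \<Rightarrow> 'y::finite \<Rightarrow> real"
  shows "(\<Sum>ys\<in>{ys. length ys = length xs}. chan_n U xs ys) = (\<Prod>x\<leftarrow>xs. \<Sum>y\<in>UNIV. U x y)"
proof (induction xs)
  case (Cons x xs)
  then show ?case
    by (simp add: sum_lists_Suc sum_distrib_left[symmetric] sum_distrib_right[symmetric])
qed simp

lemma sum_chan_n_stoch:
  fixes U :: "'x::finite \<Rightarrow> 'y::finite \<Rightarrow> real"
  assumes "stoch U"
  shows "(\<Sum>ys\<in>{ys. length ys = length xs}. chan_n U xs ys) = 1"
  unfolding sum_chan_n using assms by (induction xs) (simp_all add: stoch_def pdist_def)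

text \<open>The same factorisation with the inputs summed; for the kernel \<open>P x * Q x y\<close>
  each factor is an output marginal.\<close>

lemma sum_chan_n_fst:
  fixes U :: "'x::finite \<Rightarrow> 'y \<Rightarrow> real"
  shows "(\<Sum>xs\<in>{xs. length xs = length ys}. chan_n U xs ys) = (\<Prod>y\<leftarrow>ys. \<Sum>x\<in>UNIV. U x y)"
proof (induction ys)
  case (Cons y ys)
  then show ?case
    by (simp add: sum_lists_Suc sum_distrib_left[symmetric] sum_distrib_right[symmetric])
qed simp

lemma chan_n_nonneg: "(\<And>x y. 0 \<le> U x y) \<Longrightarrow> 0 \<le> chan_n U xs ys"
  by (simp add: chan_n_def prod_nonneg)

lemma prod_list_nonneg': "(\<And>x. (0::real) \<le> f x) \<Longrightarrow> 0 \<le> (\<Prod>x\<leftarrow>xs. f x)"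
  by (induction xs) auto

lemma sum_prod_list:
  fixes S :: "'a::finite \<Rightarrow> real"
  shows "(\<Sum>ys\<in>{ys. length ys = n}. \<Prod>y\<leftarrow>ys. S y) = (\<Sum>y\<in>UNIV. S y) ^ n"
  by (induction n) (simp_all add: sum_lists_Suc sum_distrib_left[symmetric] sum_distrib_right[symmetric])

section \<open>Type classes and their size\<close>

lemma finite_typ_class [simp]: "finite (typ_class n P)"
  by (rule finite_subset[OF _ finite_lists_length[of n]]) (auto simp: typ_class_def)

text \<open>Only the letter counts of \<open>xs\<close> matter, and the class fixes them. This is
  what constant composition buys: additive functionals do not fluctuate over the codewords.\<close>

lemma sum_list_typ_class:
  assumes "xs \<in> typ_class n P"
  shows "(\<Sum>x\<leftarrow>xs. f x) = real n * (\<Sum>x\<in>UNIV. P x * f x)"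
proof -
  have "(\<Sum>x\<leftarrow>xs. f x) = (\<Sum>x\<in>UNIV. real (count_list xs x) * f x)"
  proof (induction xs)
    case (Cons a xs)
    have "real (count_list (a # xs) x) * f x = real (count_list xs x) * f x + (if x = a then f a else 0)" for x
      by (simp add: algebra_simps)
    then show ?case by (simp only: sum.distrib Cons[symmetric]) simp
  qed simp
  also have "\<dots> = real n * (\<Sum>x\<in>UNIV. P x * f x)"
    using assms by (simp add: typ_class_def sum_distrib_left mult.assoc)
  finally show ?thesis .
qed

lemma typ_class_pos:
  assumes "xs \<in> typ_class n P" "x \<in> set xs" "pdist P"
  shows "P x > 0"
proof -
  have "count_list xs x \<noteq> 0" using assms by (simp add: count_list_0_iff)
  moreover have "real (count_list xs x) = real n * P x" using assms(1) by (simp add: typ_class_def)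
  ultimately have "P x \<noteq> 0" by force
  then show ?thesis using assms(3) by (auto simp: pdist_def less_le)
qed

lemma prod_list_exp_ln:
  fixes f :: "'a \<Rightarrow> real"
  assumes "\<And>x. x \<in> set xs \<Longrightarrow> f x > 0"
  shows "(\<Prod>x\<leftarrow>xs. f x) = exp (\<Sum>x\<leftarrow>xs. ln (f x))"
  using assms by (induction xs) (auto simp: exp_add)

lemma prod_list_typ_class:
  assumes "xs \<in> typ_class n P" "pdist P" "\<And>x. P x > 0 \<Longrightarrow> f x > 0"
  shows "(\<Prod>x\<leftarrow>xs. f x) = exp (real n * (\<Sum>x\<in>UNIV. P x * ln (f x)))"
  using assms typ_class_pos[OF assms(1) _ assms(2)]
  by (simp add: prod_list_exp_ln sum_list_typ_class[OF assms(1)])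

text \<open>\<open>n^n / n!\<close> is one term of the exponential series at
  \<open>n\<close>.\<close>

lemma fact_lower_exp: "(real n / exp 1) ^ n \<le> fact n"
proof -
  have "real n ^ n / fact n \<le> (\<Sum>k\<le>n. real n ^ k / fact k)"
    by (rule member_le_sum) auto
  also have "\<dots> = (\<Sum>k\<le>n. real n ^ k /\<^sub>R fact k)" by (simp add: divide_inverse mult.commute)
  also have "\<dots> \<le> exp (real n)"
    unfolding exp_def by (rule sum_le_suminf[OF summable_exp_generic]) auto
  finally have "real n ^ n \<le> exp 1 ^ n * fact n"
    by (simp add: field_simps exp_of_nat_mult[symmetric])
  then show ?thesis by (simp add: power_divide field_simps)
qed

text \<open>The induction step amounts to \<open>exp 1 <= (1 + 1/n)^(n+1)\<close>, which is
  \<open>ln u <= u - 1\<close> at \<open>u = n / (n+1)\<close>.\<close>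

lemma fact_upper_exp: "n > 0 \<Longrightarrow> fact n \<le> exp 1 * real n * (real n / exp 1) ^ n"
proof (induction n rule: nat_induct_non_zero)
  case (Suc n)
  then have n: "real n > 0" by simp
  have "exp 1 \<le> ((1 + real n) / real n) ^ Suc n"
  proof -
    have "ln (real n / (1 + real n)) \<le> real n / (1 + real n) - 1"
      using n by (intro ln_le_minus_one) auto
    then have "1 / (1 + real n) \<le> ln ((1 + real n) / real n)"
      using n by (simp add: ln_div field_simps)
    then have "1 \<le> real (Suc n) * ln ((1 + real n) / real n)"
      using n by (simp add: field_simps)
    then have "exp 1 \<le> exp (real (Suc n) * ln ((1 + real n) / real n))" by simp
    also have "\<dots> = ((1 + real n) / real n) ^ Suc n"
      using n by (subst exp_of_nat_mult) auto
    finally show ?thesis .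
  qed
  then have key: "exp 1 * real n ^ Suc n \<le> (1 + real n) ^ Suc n"
    using n by (simp add: power_divide field_simps)
  have "fact (Suc n) \<le> (1 + real n) * (exp 1 * real n * (real n / exp 1) ^ n)"
    using Suc by (simp add: mult_left_mono)
  also have "\<dots> = (1 + real n) * (exp 1 * real n ^ Suc n) / exp 1 ^ n"
    by (simp add: power_divide)
  also have "\<dots> \<le> (1 + real n) * (1 + real n) ^ Suc n / exp 1 ^ n"
    using key by (intro divide_right_mono mult_left_mono) auto
  also have "\<dots> = exp 1 * real (Suc n) * (real (Suc n) / exp 1) ^ Suc n"
    by (simp add: power_divide)
  finally show ?case .
qed simp

lemma m_type_counts:
  assumes "m_type m P" "m > 0"
  obtains a :: "'x::finite \<Rightarrow> nat" where "\<And>x. real (a x) = real m * P x" "(\<Sum>x\<in>UNIV. a x) = m"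
proof -
  from assms obtain a :: "'x \<Rightarrow> nat" where a: "\<And>x. P x = real (a x) / real m"
    unfolding m_type_def by metis
  have 1: "real (a x) = real m * P x" for x using a assms(2) by simp
  have "real (\<Sum>x\<in>UNIV. a x) = real m * (\<Sum>x\<in>UNIV. P x)" by (simp add: 1 sum_distrib_left)
  also have "\<dots> = real m" using assms(1) by (simp add: m_type_def pdist_def)
  finally have "(\<Sum>x\<in>UNIV. a x) = m" by linarith
  with 1 show thesis using that by blast
qed

text \<open>The multinomial formula: the class consists of the permutations of a single
  multiset.\<close>

lemma card_typ_class:
  fixes P :: "'x::finite \<Rightarrow> real"
  assumes c: "\<And>x. real (c x) = real n * P x" "(\<Sum>x\<in>UNIV. c x) = n"
  shows "real (card (typ_class n P)) * (\<Prod>x\<in>UNIV. fact (c x)) = fact n"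
proof -
  define A where "A = Abs_multiset c"
  have cnt: "count A x = c x" for x by (simp add: A_def count_Abs_multiset)
  have size: "size A = n"
  proof -
    have "size A = (\<Sum>x\<in>UNIV. count A x)"
      unfolding size_multiset_overloaded_eq by (rule sum.mono_neutral_left) (auto simp: not_in_iff)
    then show ?thesis by (simp add: cnt c)
  qed
  have "typ_class n P = permutations_of_multiset A"
  proof (intro set_eqI iffI)
    fix xs assume "xs \<in> typ_class n P"
    then have "real (count_list xs x) = real (c x)" for x by (simp add: typ_class_def c)
    then have "mset xs = A" by (intro multiset_eqI) (simp add: cnt count_mset)
    then show "xs \<in> permutations_of_multiset A" by (simp add: permutations_of_multiset_def)
  next
    fix xs assume "xs \<in> permutations_of_multiset A"
    then have *: "mset xs = A" by (simp add: permutations_of_multiset_def)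
    then have "length xs = n" using size by (metis size_mset)
    moreover have "count_list xs x = c x" for x by (metis * cnt count_mset)
    ultimately show "xs \<in> typ_class n P" by (simp add: typ_class_def c)
  qed
  moreover have "(\<Prod>x\<in>set_mset A. fact (count A x)) = (\<Prod>x\<in>UNIV. fact (c x) :: nat)"
    unfolding cnt by (rule prod.mono_neutral_left) (auto simp: not_in_iff cnt)
  ultimately have "card (typ_class n P) * (\<Prod>x\<in>UNIV. fact (c x)) = fact n"
    using card_permutations_of_multiset_aux[of A] by (simp add: size)
  then have "real (card (typ_class n P) * (\<Prod>x\<in>UNIV. fact (c x))) = real (fact n)" by simp
  then show ?thesis by (simp add: of_nat_prod)
qed

text \<open>Stirling bounds on the multinomial coefficient give the class at least
  \<open>exp (n H(P)) / (e n)^|X|\<close> elements. In the form \<open>1 <= ...\<close> the bound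
  can be inserted as a multiplier.\<close>

lemma card_typ_class_lower:
  fixes P :: "'x::finite \<Rightarrow> real"
  assumes P: "m_type m P" "m > 0" and k: "k > 0" and n: "n = m * k"
  shows "1 \<le> (exp 1 * n) ^ card (UNIV :: 'x set)
    * (card (typ_class n P) * exp (n * (\<Sum>x\<in>UNIV. P x * ln (P x))))"
proof -
  have pd: "pdist P" using P by (simp add: m_type_def)
  obtain a where a: "\<And>x. real (a x) = real m * P x" "(\<Sum>x\<in>UNIV. a x) = m"
    using m_type_counts[OF P] by blast
  define c where "c x = a x * k" for x
  have c: "\<And>x. real (c x) = real n * P x" "(\<Sum>x\<in>UNIV. c x) = n"
    by (simp_all add: c_def n a sum_distrib_right[symmetric])
  have n0: "n > 0" using k P n by simp
  have fact_c: "fact (c x) \<le> (exp 1 * n) * (real (c x) / exp 1) ^ c x" for x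
  proof (cases "c x = 0")
    case True
    have "1 \<le> exp 1 * real n" using n0 by (intro mult_ge1_I) auto
    then show ?thesis using True by simp
  next
    case False
    then have "fact (c x) \<le> exp 1 * real (c x) * (real (c x) / exp 1) ^ c x"
      by (intro fact_upper_exp) simp
    also have "\<dots> \<le> exp 1 * real n * (real (c x) / exp 1) ^ c x"
    proof -
      have "c x \<le> n" unfolding c(2)[symmetric] by (rule member_le_sum) auto
      then show ?thesis by (intro mult_right_mono mult_left_mono) auto
    qed
    finally show ?thesis .
  qed
  have "(real n / exp 1) ^ n \<le> fact n" by (rule fact_lower_exp)
  also have "\<dots> = real (card (typ_class n P)) * (\<Prod>x\<in>UNIV. fact (c x))"
    using card_typ_class[OF c] by simp
  also have "\<dots> \<le> real (card (typ_class n P)) * (\<Prod>x\<in>UNIV. (exp 1 * n) * (real (c x) / exp 1) ^ c x)"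
    using fact_c by (intro mult_left_mono prod_mono) auto
  also have "(\<Prod>x\<in>UNIV. (exp 1 * n) * (real (c x) / exp 1) ^ c x)
      = (exp 1 * n) ^ card (UNIV :: 'x set) * (\<Prod>x\<in>UNIV. (real (c x) / exp 1) ^ c x)"
    by (simp add: prod.distrib)
  also have "(\<Prod>x\<in>UNIV. (real (c x) / exp 1) ^ c x)
      = (real n / exp 1) ^ n * exp (n * (\<Sum>x\<in>UNIV. P x * ln (P x)))"
  proof -
    have "(\<Prod>x\<in>UNIV. (real (c x) / exp 1) ^ c x) = (\<Prod>x\<in>UNIV. (real n / exp 1) ^ c x * P x ^ c x)"
      by (intro prod.cong refl) (simp add: c power_mult_distrib[symmetric])
    also have "\<dots> = (real n / exp 1) ^ n * (\<Prod>x\<in>UNIV. P x ^ c x)"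
      by (simp add: prod.distrib c(2) power_sum[symmetric])
    also have "(\<Prod>x\<in>UNIV. P x ^ c x) = exp (\<Sum>x\<in>UNIV. c x * ln (P x))"
      unfolding exp_sum[OF finite]
    proof (rule prod.cong)
      fix x show "P x ^ c x = exp (c x * ln (P x))"
      proof (cases "P x = 0")
        case True then show ?thesis using c(1)[of x] by simp
      next
        case False then have "P x > 0" using pd by (simp add: pdist_def less_le)
        then show ?thesis by (simp add: exp_of_nat_mult)
      qed
    qed simp
    also have "(\<Sum>x\<in>UNIV. c x * ln (P x)) = n * (\<Sum>x\<in>UNIV. P x * ln (P x))"
      by (simp add: c sum_distrib_left mult.assoc)
    finally show ?thesis .
  qed
  finally have "(real n / exp 1) ^ n * 1 \<le> (real n / exp 1) ^ n * ((exp 1 * n) ^ card (UNIV :: 'x set)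
      * (card (typ_class n P) * exp (n * (\<Sum>x\<in>UNIV. P x * ln (P x)))))"
    by (simp add: mult_ac)
  moreover have "(real n / exp 1) ^ n > 0" using n0 by simp
  ultimately show ?thesis by (simp only: mult_le_cancel_left_pos)
qed

lemma typ_class_nonempty:
  assumes "m_type m P" "m > 0" "k > 0"
  shows "typ_class (m * k) P \<noteq> {}"
  using card_typ_class_lower[OF assms refl] by force

lemma out_dist_nonneg: "(\<And>x y. 0 \<le> U x y) \<Longrightarrow> 0 \<le> out_dist n P U ys"
  by (simp add: out_dist_def sum_nonneg chan_n_nonneg)

text \<open>Every codeword of the class has probability \<open>h\<close> under the product law of
  \<open>P\<close>, and \<open>card T * h\<close> is at least a reciprocal polynomial. Hence the
  product law, times that polynomial, dominates the uniform law on the class.\<close>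

lemma out_dist_le_iid:
  fixes P :: "'x::finite \<Rightarrow> real"
  assumes P: "m_type m P" "m > 0" and k: "k > 0" and n: "n = m * k" and len: "length ys = n"
    and Q: "\<And>x y. 0 \<le> Q x y"
  shows "out_dist n P Q ys \<le> (exp 1 * n) ^ card (UNIV :: 'x set) * (\<Prod>y\<leftarrow>ys. marginal P Q y)"
proof -
  have pd: "pdist P" using P by (simp add: m_type_def)
  then have P0: "0 \<le> P x" for x by (simp add: pdist_def)
  let ?T = "typ_class n P"
  define h where "h = exp (n * (\<Sum>x\<in>UNIV. P x * ln (P x)))"
  have chan: "h * chan_n Q xs ys = chan_n (\<lambda>x y. P x * Q x y) xs ys" if "xs \<in> ?T" for xs
  proof -
    have "(\<Prod>x\<leftarrow>xs. P x) = h"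
      unfolding h_def using prod_list_typ_class[OF that pd, of P] by simp
    moreover have "(\<Prod>x\<leftarrow>xs. P x) = (\<Prod>i<length xs. P (xs ! i))"
      by (simp add: prod.list_conv_set_nth atLeast0LessThan)
    ultimately show ?thesis by (simp add: chan_n_def prod.distrib)
  qed
  have "h * (\<Sum>xs\<in>?T. chan_n Q xs ys) = (\<Sum>xs\<in>?T. chan_n (\<lambda>x y. P x * Q x y) xs ys)"
    by (simp add: sum_distrib_left chan)
  also have "\<dots> \<le> (\<Sum>xs\<in>{xs. length xs = length ys}. chan_n (\<lambda>x y. P x * Q x y) xs ys)"
    by (rule sum_mono2) (auto simp: typ_class_def len P0 Q intro!: chan_n_nonneg)
  also have "\<dots> = (\<Prod>y\<leftarrow>ys. marginal P Q y)"
    by (simp add: sum_chan_n_fst marginal_def)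
  finally have 1: "h * (\<Sum>xs\<in>?T. chan_n Q xs ys) \<le> (\<Prod>y\<leftarrow>ys. marginal P Q y)" .
  let ?e = "(exp 1 * n) ^ card (UNIV :: 'x set)"
  have ne: "real (card ?T) > 0" using typ_class_nonempty[OF P k] n by (simp add: card_gt_0_iff)
  have "out_dist n P Q ys = 1 * out_dist n P Q ys" by simp
  also have "\<dots> \<le> (?e * (card ?T * h)) * out_dist n P Q ys"
    unfolding h_def using card_typ_class_lower[OF P k n] out_dist_nonneg[OF Q]
    by (intro mult_right_mono) auto
  also have "\<dots> = ?e * (h * (\<Sum>xs\<in>?T. chan_n Q xs ys))"
    using ne by (simp add: out_dist_def)
  also have "\<dots> \<le> ?e * (\<Prod>y\<leftarrow>ys. marginal P Q y)"
    using 1 by (intro mult_left_mono) auto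
  finally show ?thesis .
qed

section \<open>The minimax identity\<close>

definition eta :: "real \<Rightarrow> real" where "eta u = u * ln u"

lemma eta_0 [simp]: "eta 0 = 0" by (simp add: eta_def)

lemma eta_ge_tangent:
  assumes "u \<ge> 0" "c > 0"
  shows "u * ln c + u - c \<le> eta u"
proof (cases "u = 0")
  case False
  with assms have u: "u > 0" by simp
  have "ln (c / u) \<le> c / u - 1" using assms u by (intro ln_le_minus_one) auto
  then have "u * ln (c / u) \<le> u * (c / u - 1)" using u by (intro mult_left_mono) auto
  then show ?thesis using assms u by (simp add: eta_def ln_div algebra_simps)
qed (use assms in simp)

text \<open>A divergence summand is at most the chi-squared summand, by \<open>ln z <= z - 1\<close>
  at \<open>z = u / c\<close>. The linear remainder cancels when two laws are summed, leaving a
  second-order bound.\<close>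

lemma eta_le_chi: "u \<ge> 0 \<Longrightarrow> c \<ge> 0 \<Longrightarrow> (c = 0 \<Longrightarrow> u = 0) \<Longrightarrow> eta u - u * ln c \<le> (u - c)\<^sup>2 / c + (u - c)"
proof (cases "u = 0")
  case False
  assume a: "u \<ge> 0" "c \<ge> 0" "c = 0 \<Longrightarrow> u = 0"
  with False have u: "u > 0" "c > 0" by (auto simp: less_le)
  have "ln (u / c) \<le> u / c - 1" using u by (intro ln_le_minus_one) auto
  then have "u * ln (u / c) \<le> u * (u / c - 1)" using u by (intro mult_left_mono) auto
  also have "\<dots> = (u - c)\<^sup>2 / c + (u - c)" using u by (simp add: field_simps power2_eq_square)
  finally show ?thesis using u by (simp add: eta_def ln_div algebra_simps)
qed (simp add: power2_eq_square)

text \<open>The tangent inequality at the mixture point is averaged over the two endpoints, so no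
  derivative at 0 enters.\<close>

lemma eta_convex:
  assumes "a \<ge> 0" "b \<ge> 0" "0 \<le> t" "t \<le> 1"
  shows "eta ((1 - t) * a + t * b) \<le> (1 - t) * eta a + t * eta b"
proof (cases "(1 - t) * a + t * b = 0")
  case True
  then have "(1 - t) * a = 0" "t * b = 0"
    using assms by (auto simp: add_nonneg_eq_0_iff)
  then show ?thesis by (auto simp: eta_def)
next
  case False
  define c where "c = (1 - t) * a + t * b"
  have "c \<ge> 0" using assms by (auto simp: c_def)
  with False have c: "c > 0" unfolding c_def by linarith
  have "(1 - t) * (a * ln c + a - c) + t * (b * ln c + b - c) \<le> (1 - t) * eta a + t * eta b"
    using assms c by (intro add_mono mult_left_mono eta_ge_tangent) auto
  moreover have "(1 - t) * (a * ln c + a - c) + t * (b * ln c + b - c)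
      = ((1 - t) * a + t * b) * ln c + (((1 - t) * a + t * b) - c)"
    by (simp add: algebra_simps)
  ultimately show ?thesis by (simp add: eta_def flip: c_def)
qed

lemma continuous_on_eta: "continuous_on {0..} eta"
proof (rule continuous_on_eq_continuous_within[THEN iffD2], rule ballI)
  fix u :: real assume "u \<in> {0..}"
  show "continuous (at u within {0..}) eta"
  proof (cases "u = 0")
    case True
    have "((\<lambda>x::real. x * ln x) \<longlongrightarrow> 0) (at_right 0)" by real_asymp
    then show ?thesis
      by (simp add: True continuous_within at_within_Ici_at_right eta_def[abs_def])
  next
    case False
    then have "isCont eta u" using \<open>u \<in> {0..}\<close> unfolding eta_def by (auto intro!: continuous_intros)
    then show ?thesis by (rule continuous_at_imp_continuous_at_within)
  qed
qed

text \<open>\<open>C\<close> carries no linear structure, only points \<open>r\<close> doing at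
  least as well as each mixture. The upward closure of the image of \<open>(f, g)\<close> is
  therefore convex and is separated from the open quadrant below \<open>(v, v)\<close>.\<close>

lemma convexlike_max_ge_combination:
  fixes f g :: "'q \<Rightarrow> real"
  assumes conv: "\<And>p q t. p \<in> C \<Longrightarrow> q \<in> C \<Longrightarrow> 0 \<le> t \<Longrightarrow> t \<le> 1 \<Longrightarrow>
      \<exists>r\<in>C. f r \<le> (1 - t) * f p + t * f q \<and> g r \<le> (1 - t) * g p + t * g q"
    and ge: "\<And>q. q \<in> C \<Longrightarrow> v \<le> max (f q) (g q)" and ne: "C \<noteq> {}"
  obtains s where "0 \<le> s" "s \<le> 1" "\<And>q. q \<in> C \<Longrightarrow> v \<le> (1 - s) * f q + s * g q"
proof -
  define A where "A = {(a, b). \<exists>q\<in>C. f q \<le> a \<and> g q \<le> b}"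
  define B where "B = {..<v} \<times> {..<v}"
  have "convex A"
  proof (rule convexI, clarify)
    fix a b a' b' u w :: real
    assume *: "(a, b) \<in> A" "(a', b') \<in> A" and uw: "0 \<le> u" "0 \<le> w" "u + w = 1"
    from * obtain p q where p: "p \<in> C" "f p \<le> a" "g p \<le> b" and q: "q \<in> C" "f q \<le> a'" "g q \<le> b'"
      by (auto simp: A_def)
    have u: "u = 1 - w" using uw by simp
    obtain r where r: "r \<in> C" "f r \<le> u * f p + w * f q" "g r \<le> u * g p + w * g q"
      using conv[OF p(1) q(1), of w] uw unfolding u by auto
    have "f r \<le> u * a + w * a'" "g r \<le> u * b + w * b'"
      using r p q uw by (smt (verit) mult_left_mono)+
    then show "u *\<^sub>R (a, b) + w *\<^sub>R (a', b') \<in> A" using r(1) by (auto simp: A_def)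
  qed
  moreover have "convex B" unfolding B_def by (intro convex_Times) auto
  moreover have "A \<noteq> {}" using ne by (auto simp: A_def)
  moreover have "B \<noteq> {}" by (auto simp: B_def)
  moreover have "A \<inter> B = {}" using ge by (fastforce simp: A_def B_def)
  ultimately obtain z c where z: "z \<noteq> 0" "\<And>x. x \<in> B \<Longrightarrow> inner z x \<le> c" "\<And>x. x \<in> A \<Longrightarrow> c \<le> inner z x"
    using separating_hyperplane_sets[of B A] by (metis inf_commute)
  obtain z1 z2 where zz: "z = (z1, z2)" by (cases z)
  obtain q0 where q0: "q0 \<in> C" using ne by auto
  have up: "c \<le> z1 * a + z2 * b" if "q \<in> C" "f q \<le> a" "g q \<le> b" for a b q
    using z(3)[of "(a, b)"] that by (auto simp: A_def zz)
  \<comment> \<open>\<open>A\<close> is closed upwards, so a negative coefficient would make the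
    functional unbounded below on \<open>A\<close>; the shift \<open>k\<close> already takes it
    below \<open>c\<close>.\<close>
  have z1: "z1 \<ge> 0"
  proof (rule ccontr)
    assume "\<not> z1 \<ge> 0"
    define k where "k = max 0 ((z1 * f q0 + z2 * g q0 - c + 1) / (- z1))"
    have "c \<le> z1 * (f q0 + k) + z2 * g q0" by (rule up[OF q0]) (auto simp: k_def)
    moreover have "z1 * k \<le> - (z1 * f q0 + z2 * g q0 - c + 1)"
    proof -
      have "(z1 * f q0 + z2 * g q0 - c + 1) / (- z1) \<le> k" by (simp add: k_def)
      then show ?thesis using \<open>\<not> z1 \<ge> 0\<close> by (simp add: field_simps)
    qed
    ultimately show False by (simp add: algebra_simps)
  qed
  have z2: "z2 \<ge> 0"
  proof (rule ccontr)
    assume "\<not> z2 \<ge> 0"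
    define k where "k = max 0 ((z1 * f q0 + z2 * g q0 - c + 1) / (- z2))"
    have "c \<le> z1 * f q0 + z2 * (g q0 + k)" by (rule up[OF q0]) (auto simp: k_def)
    moreover have "z2 * k \<le> - (z1 * f q0 + z2 * g q0 - c + 1)"
    proof -
      have "(z1 * f q0 + z2 * g q0 - c + 1) / (- z2) \<le> k" by (simp add: k_def)
      then show ?thesis using \<open>\<not> z2 \<ge> 0\<close> by (simp add: field_simps)
    qed
    ultimately show False by (simp add: algebra_simps)
  qed
  have pos: "z1 + z2 > 0" using z1 z2 z(1) zz by (auto simp: zero_prod_def add_nonneg_eq_0_iff less_le)
  \<comment> \<open>The corner \<open>(v, v)\<close> lies outside the open quadrant and is
    approached along the diagonal.\<close>
  have low: "(z1 + z2) * v \<le> c"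
  proof (rule field_le_epsilon)
    fix e :: real assume "e > 0"
    have "inner z (v - e / (z1 + z2), v - e / (z1 + z2)) \<le> c"
      using pos \<open>e > 0\<close> by (intro z(2)) (auto simp: B_def)
    then have "(z1 + z2) * (v - e / (z1 + z2)) \<le> c" by (simp add: zz distrib_right)
    moreover have "(z1 + z2) * (v - e / (z1 + z2)) = (z1 + z2) * v - e" using pos by (simp add: right_diff_distrib)
    ultimately show "(z1 + z2) * v \<le> c + e" by linarith
  qed
  show thesis
  proof (rule that[of "z2 / (z1 + z2)"])
    show "0 \<le> z2 / (z1 + z2)" "z2 / (z1 + z2) \<le> 1" using z1 z2 pos by auto
    fix q assume "q \<in> C"
    then have "(z1 + z2) * v \<le> z1 * f q + z2 * g q" using up[of q "f q" "g q"] low by simp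
    moreover have "1 - z2 / (z1 + z2) = z1 / (z1 + z2)" using pos by (simp add: field_simps)
    then have "(1 - z2 / (z1 + z2)) * f q + z2 / (z1 + z2) * g q = (z1 * f q + z2 * g q) / (z1 + z2)"
      by (simp add: add_divide_distrib)
    ultimately show "v \<le> (1 - z2 / (z1 + z2)) * f q + z2 / (z1 + z2) * g q"
      using pos by (simp add: le_divide_eq mult.commute)
  qed
qed

definition mix :: "real \<Rightarrow> ('x \<Rightarrow> 'y \<Rightarrow> real) \<Rightarrow> ('x \<Rightarrow> 'y \<Rightarrow> real) \<Rightarrow> 'x \<Rightarrow> 'y \<Rightarrow> real" where
  "mix t Q V = (\<lambda>x y. (1 - t) * Q x y + t * V x y)"

lemma marginal_mix: "marginal P (mix t Q V) y = (1 - t) * marginal P Q y + t * marginal P V y"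
  by (simp add: marginal_def mix_def sum.distrib sum_subtractf sum_distrib_left algebra_simps)

lemma stoch_mix: "stoch Q \<Longrightarrow> stoch V \<Longrightarrow> 0 \<le> t \<Longrightarrow> t \<le> 1 \<Longrightarrow> stoch (mix t Q V)"
  by (simp add: stoch_def pdist_def mix_def sum.distrib sum_distrib_left[symmetric])

section \<open>Convex objectives on the set of channels\<close>

locale channel =
  fixes P :: "'x::finite \<Rightarrow> real" and W :: "'x \<Rightarrow> 'y::finite \<Rightarrow> real"
  assumes P: "pdist P" and W: "stoch W"
begin

lemma P_nonneg: "0 \<le> P x" using P by (simp add: pdist_def)
lemma P_sum: "(\<Sum>x\<in>UNIV. P x) = 1" using P by (simp add: pdist_def)

text \<open>The channels at finite divergence from \<open>W\<close>. Because \<open>ln 0 = 0\<close>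
  in HOL, the real formula \<open>cdiv\<close> represents the divergence only on this set.\<close>

definition dom :: "('x \<Rightarrow> 'y \<Rightarrow> real) set" where
  "dom = {Q. stoch Q \<and> (\<forall>x y. 0 < P x \<longrightarrow> W x y = 0 \<longrightarrow> Q x y = 0)}"

definition cdiv :: "('x \<Rightarrow> 'y \<Rightarrow> real) \<Rightarrow> real" where
  "cdiv Q = (\<Sum>x\<in>UNIV. P x * (\<Sum>y\<in>UNIV. eta (Q x y) - Q x y * ln (W x y)))"

text \<open>Mutual information in nats, written as \<open>H(Y) - H(Y|X)\<close> so that the convex
  parts of the objectives become visible.\<close>

definition minf :: "('x \<Rightarrow> 'y \<Rightarrow> real) \<Rightarrow> real" where
  "minf Q = (\<Sum>x\<in>UNIV. P x * (\<Sum>y\<in>UNIV. eta (Q x y))) - (\<Sum>y\<in>UNIV. eta (marginal P Q y))"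

definition obj :: "real \<Rightarrow> ('x \<Rightarrow> 'y \<Rightarrow> real) \<Rightarrow> real" where
  "obj \<rho> Q = cdiv Q - \<rho> * minf Q"

text \<open>Subtracting \<open>\<rho>\<close> times the divergence of the output law from
  \<open>S\<close> cancels the output entropy and leaves a term linear in \<open>Q\<close>, see
  \<open>tobj_eq\<close>. At \<open>S = marginal P Q\<close> nothing is subtracted.\<close>

definition tobj :: "real \<Rightarrow> ('y \<Rightarrow> real) \<Rightarrow> ('x \<Rightarrow> 'y \<Rightarrow> real) \<Rightarrow> real" where
  "tobj \<rho> S Q = obj \<rho> Q - \<rho> * (\<Sum>y\<in>UNIV. eta (marginal P Q y) - marginal P Q y * ln (S y))"

lemma stoch_nonneg: "stoch Q \<Longrightarrow> 0 \<le> Q x y"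
  by (simp add: stoch_def pdist_def)

lemma stoch_sum: "stoch Q \<Longrightarrow> (\<Sum>y\<in>UNIV. Q x y) = 1"
  by (simp add: stoch_def pdist_def)

lemma marginal_nonneg: "stoch Q \<Longrightarrow> 0 \<le> marginal P Q y"
  by (simp add: marginal_def sum_nonneg P_nonneg stoch_nonneg)

lemma marginal_sum: "stoch Q \<Longrightarrow> (\<Sum>y\<in>UNIV. marginal P Q y) = 1"
  unfolding marginal_def by (subst sum.swap) (simp add: sum_distrib_left[symmetric] stoch_sum P_sum)

lemma marginal_pos: "stoch Q \<Longrightarrow> 0 < P x \<Longrightarrow> 0 < Q x y \<Longrightarrow> 0 < marginal P Q y"
  unfolding marginal_def
  by (rule sum_pos2[of _ x]) (auto simp: P_nonneg stoch_nonneg)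

lemma W_dom: "W \<in> dom" using W by (simp add: dom_def)

lemma dom_stoch: "Q \<in> dom \<Longrightarrow> stoch Q" by (simp add: dom_def)

lemma mix_dom: "Q \<in> dom \<Longrightarrow> V \<in> dom \<Longrightarrow> 0 \<le> t \<Longrightarrow> t \<le> 1 \<Longrightarrow> mix t Q V \<in> dom"
  by (auto simp: dom_def stoch_mix) (simp add: mix_def)

lemma obj_eq: "obj \<rho> Q = (1 - \<rho>) * (\<Sum>x\<in>UNIV. P x * (\<Sum>y\<in>UNIV. eta (Q x y)))
    + \<rho> * (\<Sum>y\<in>UNIV. eta (marginal P Q y)) - (\<Sum>x\<in>UNIV. P x * (\<Sum>y\<in>UNIV. Q x y * ln (W x y)))"
  by (simp add: obj_def cdiv_def minf_def sum_subtractf algebra_simps)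

lemma tobj_eq: "tobj \<rho> S Q = (1 - \<rho>) * (\<Sum>x\<in>UNIV. P x * (\<Sum>y\<in>UNIV. eta (Q x y)))
    + \<rho> * (\<Sum>y\<in>UNIV. marginal P Q y * ln (S y)) - (\<Sum>x\<in>UNIV. P x * (\<Sum>y\<in>UNIV. Q x y * ln (W x y)))"
  by (simp add: tobj_def obj_eq sum_subtractf algebra_simps)

lemma lin_mix: "(\<Sum>x\<in>UNIV. P x * (\<Sum>y\<in>UNIV. mix t Q V x y * l x y))
    = (1 - t) * (\<Sum>x\<in>UNIV. P x * (\<Sum>y\<in>UNIV. Q x y * l x y)) + t * (\<Sum>x\<in>UNIV. P x * (\<Sum>y\<in>UNIV. V x y * l x y))"
  by (simp add: mix_def sum.distrib sum_subtractf sum_distrib_left algebra_simps)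

lemma eta_mix:
  assumes "stoch Q" "stoch V" "0 \<le> t" "t \<le> 1"
  shows "(\<Sum>x\<in>UNIV. P x * (\<Sum>y\<in>UNIV. eta (mix t Q V x y)))
    \<le> (1 - t) * (\<Sum>x\<in>UNIV. P x * (\<Sum>y\<in>UNIV. eta (Q x y))) + t * (\<Sum>x\<in>UNIV. P x * (\<Sum>y\<in>UNIV. eta (V x y)))"
proof -
  have "(\<Sum>x\<in>UNIV. P x * (\<Sum>y\<in>UNIV. eta (mix t Q V x y)))
      \<le> (\<Sum>x\<in>UNIV. P x * (\<Sum>y\<in>UNIV. (1 - t) * eta (Q x y) + t * eta (V x y)))"
    unfolding mix_def using assms
    by (intro sum_mono mult_left_mono eta_convex P_nonneg) (auto simp: stoch_nonneg)
  also have "\<dots> = (1 - t) * (\<Sum>x\<in>UNIV. P x * (\<Sum>y\<in>UNIV. eta (Q x y))) + t * (\<Sum>x\<in>UNIV. P x * (\<Sum>y\<in>UNIV. eta (V x y)))"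
    by (simp add: sum.distrib sum_subtractf sum_distrib_left algebra_simps)
  finally show ?thesis .
qed

lemma eta_marginal_mix:
  assumes "stoch Q" "stoch V" "0 \<le> t" "t \<le> 1"
  shows "(\<Sum>y\<in>UNIV. eta (marginal P (mix t Q V) y))
    \<le> (1 - t) * (\<Sum>y\<in>UNIV. eta (marginal P Q y)) + t * (\<Sum>y\<in>UNIV. eta (marginal P V y))"
proof -
  have "(\<Sum>y\<in>UNIV. eta (marginal P (mix t Q V) y))
      \<le> (\<Sum>y\<in>UNIV. (1 - t) * eta (marginal P Q y) + t * eta (marginal P V y))"
    unfolding marginal_mix using assms
    by (intro sum_mono eta_convex marginal_nonneg) auto
  then show ?thesis by (simp add: sum.distrib sum_distrib_left)
qed

text \<open>In \<open>obj_eq\<close> the \<open>eta\<close> sums have the nonnegative weights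
  \<open>1 - \<rho>\<close> and \<open>\<rho>\<close> and the rest is linear: the divergence
  compensates the part of the mutual information that would spoil convexity.\<close>

lemma obj_mix:
  assumes "stoch Q" "stoch V" "0 \<le> t" "t \<le> 1" "0 \<le> \<rho>" "\<rho> \<le> 1"
  shows "obj \<rho> (mix t Q V) \<le> (1 - t) * obj \<rho> Q + t * obj \<rho> V"
proof -
  have "(1 - \<rho>) * (\<Sum>x\<in>UNIV. P x * (\<Sum>y\<in>UNIV. eta (mix t Q V x y)))
      \<le> (1 - \<rho>) * ((1 - t) * (\<Sum>x\<in>UNIV. P x * (\<Sum>y\<in>UNIV. eta (Q x y))) + t * (\<Sum>x\<in>UNIV. P x * (\<Sum>y\<in>UNIV. eta (V x y))))"
    using assms by (intro mult_left_mono eta_mix) auto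
  moreover have "\<rho> * (\<Sum>y\<in>UNIV. eta (marginal P (mix t Q V) y))
      \<le> \<rho> * ((1 - t) * (\<Sum>y\<in>UNIV. eta (marginal P Q y)) + t * (\<Sum>y\<in>UNIV. eta (marginal P V y)))"
    using assms by (intro mult_left_mono eta_marginal_mix) auto
  ultimately show ?thesis unfolding obj_eq lin_mix by (simp add: algebra_simps)
qed

lemma tobj_mix:
  assumes "stoch Q" "stoch V" "0 \<le> t" "t \<le> 1" "0 \<le> \<rho>" "\<rho> \<le> 1"
  shows "tobj \<rho> S (mix t Q V) \<le> (1 - t) * tobj \<rho> S Q + t * tobj \<rho> S V"
proof -
  have "(1 - \<rho>) * (\<Sum>x\<in>UNIV. P x * (\<Sum>y\<in>UNIV. eta (mix t Q V x y)))
      \<le> (1 - \<rho>) * ((1 - t) * (\<Sum>x\<in>UNIV. P x * (\<Sum>y\<in>UNIV. eta (Q x y))) + t * (\<Sum>x\<in>UNIV. P x * (\<Sum>y\<in>UNIV. eta (V x y))))"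
    using assms by (intro mult_left_mono eta_mix) auto
  moreover have "\<rho> * (\<Sum>y\<in>UNIV. marginal P (mix t Q V) y * ln (S y))
      = \<rho> * ((1 - t) * (\<Sum>y\<in>UNIV. marginal P Q y * ln (S y)) + t * (\<Sum>y\<in>UNIV. marginal P V y * ln (S y)))"
    unfolding marginal_mix by (simp add: sum.distrib sum_subtractf sum_distrib_left algebra_simps)
  ultimately show ?thesis unfolding tobj_eq lin_mix by (simp add: algebra_simps)
qed


definition expo :: "real \<Rightarrow> ('x \<Rightarrow> 'y \<Rightarrow> real) \<Rightarrow> real" where
  "expo R Q = cdiv Q + 1 / 2 * max 0 (R - minf Q)"

text \<open>Compactness: the constraints of \<open>dom\<close> are closed conditions on coordinates
  and \<open>eta\<close> is continuous up to 0. Channels are carried to \<open>real^'y^'x\<close> to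
  use its topology.\<close>

lemma ex_expo_minimiser: "\<exists>Q\<in>dom. \<forall>V\<in>dom. expo R Q \<le> expo R V"
proof -
  define fn :: "real^'y^'x \<Rightarrow> 'x \<Rightarrow> 'y \<Rightarrow> real" where "fn v = (\<lambda>x y. v $ x $ y)" for v
  define K where "K = {v. fn v \<in> dom}"
  have "closed K"
    unfolding K_def dom_def stoch_def pdist_def fn_def mem_Collect_eq
    by (intro closed_Collect_conj closed_Collect_all closed_Collect_imp closed_Collect_le
        closed_Collect_eq open_Collect_const continuous_intros)
  moreover have "bounded K"
  proof (rule boundedI)
    fix v assume "v \<in> K"
    then have st: "stoch (fn v)" by (simp add: K_def dom_def)
    have "norm (v $ x) \<le> (\<Sum>y\<in>(UNIV::'y set). 1)" for x
    proof -
      have "\<bar>v $ x $ y\<bar> \<le> 1" for y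
      proof -
        have "fn v x y \<le> (\<Sum>y\<in>UNIV. fn v x y)"
          by (rule member_le_sum) (auto simp: stoch_nonneg[OF st])
        then show ?thesis using stoch_sum[OF st] stoch_nonneg[OF st, of x y] by (simp add: fn_def)
      qed
      then have "(\<Sum>y\<in>UNIV. \<bar>v $ x $ y\<bar>) \<le> (\<Sum>y\<in>(UNIV::'y set). 1)" by (intro sum_mono) auto
      then show ?thesis using norm_le_l1_cart[of "v $ x"] by linarith
    qed
    then have "(\<Sum>x\<in>UNIV. norm (v $ x)) \<le> (\<Sum>x\<in>(UNIV::'x set). \<Sum>y\<in>(UNIV::'y set). 1)"
      by (intro sum_mono) auto
    then show "norm v \<le> (\<Sum>x\<in>(UNIV::'x set). \<Sum>y\<in>(UNIV::'y set). 1)"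
      using L2_set_le_sum[of UNIV "\<lambda>x. norm (v $ x)"] unfolding norm_vec_def[of v] by fastforce
  qed
  ultimately have "compact K" by (simp add: compact_eq_bounded_closed)
  moreover have fn_lambda: "fn (\<chi> x y. V x y) = V" for V by (simp add: fn_def)
  then have "K \<noteq> {}" using W_dom unfolding K_def by (metis empty_iff mem_Collect_eq)
  moreover have "continuous_on K (\<lambda>v. expo R (fn v))"
  proof -
    have nn: "0 \<le> fn v x y" "0 \<le> marginal P (fn v) y" if "v \<in> K" for v x y
      using that by (auto simp: K_def dom_def stoch_nonneg marginal_nonneg)
    have c: "continuous_on K (\<lambda>v. fn v x y)" for x y
      unfolding fn_def by (intro continuous_intros)
    then have cm: "continuous_on K (\<lambda>v. marginal P (fn v) y)" for y
      unfolding marginal_def by (intro continuous_intros)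
    have "continuous_on K (\<lambda>v. eta (fn v x y))" for x y
      by (rule continuous_on_compose2[OF continuous_on_eta c]) (use nn in auto)
    moreover have "continuous_on K (\<lambda>v. eta (marginal P (fn v) y))" for y
      by (rule continuous_on_compose2[OF continuous_on_eta cm]) (use nn in auto)
    ultimately show ?thesis
      using c unfolding expo_def cdiv_def minf_def by (intro continuous_intros)
  qed
  ultimately obtain v where v: "v \<in> K" "\<forall>u\<in>K. expo R (fn v) \<le> expo R (fn u)"
    using continuous_attains_inf by blast
  have "\<forall>V\<in>dom. expo R (fn v) \<le> expo R V"
    using v(2) fn_lambda unfolding K_def by (metis mem_Collect_eq)
  then show ?thesis using v(1) by (auto simp: K_def)
qed

text \<open>The derivative of \<^term>\<open>eta\<close> at zero is \<open>- \<infinity>\<close>, so a minimiser cannot vanish where the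
  channel does not.\<close>

lemma minimiser_support:
  assumes Q: "Q \<in> dom" and \<rho>: "0 \<le> \<rho>" "\<rho> < 1"
    and min: "\<And>V. V \<in> dom \<Longrightarrow> obj \<rho> Q \<le> obj \<rho> V"
    and x0: "0 < P x0" "0 < W x0 y0"
  shows "0 < Q x0 y0"
proof (rule ccontr)
  note st = dom_stoch[OF Q]
  assume "\<not> 0 < Q x0 y0"
  then have Q0: "Q x0 y0 = 0" using stoch_nonneg[OF st, of x0 y0] by simp
  \<comment> \<open>The coefficient of \<open>t * ln t\<close> that the entry at
    \<open>(x0, y0)\<close> contributes to the objective on the segment from \<open>Q\<close> to
    \<open>W\<close>.\<close>
  define \<kappa> where "\<kappa> = (1 - \<rho>) * (P x0 * W x0 y0)"
  have \<kappa>: "\<kappa> > 0" using \<rho> x0 by (simp add: \<kappa>_def)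
  define G where "G = obj \<rho> W - obj \<rho> Q"
  have G: "G \<ge> 0" using min[OF W_dom] by (simp add: G_def)
  have bound: "0 \<le> G + \<kappa> * ln t" if t: "0 < t" "t < 1" for t
  proof -
    let ?c = "W x0 y0 * t * ln t"
    have pt: "eta (mix t Q W x y) \<le> (1 - t) * eta (Q x y) + t * eta (W x y)
        + (if x = x0 then if y = y0 then ?c else 0 else 0)" for x y
    proof (cases "x = x0 \<and> y = y0")
      case True
      then show ?thesis using Q0 x0 t by (simp add: mix_def eta_def ln_mult algebra_simps)
    next
      case False
      then show ?thesis
        using eta_convex[OF stoch_nonneg[OF st] stoch_nonneg[OF W], of t x y x y] t by (auto simp: mix_def)
    qed
    have "(\<Sum>x\<in>UNIV. P x * (\<Sum>y\<in>UNIV. eta (mix t Q W x y)))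
        \<le> (\<Sum>x\<in>UNIV. P x * (\<Sum>y\<in>UNIV. (1 - t) * eta (Q x y) + t * eta (W x y)
        + (if x = x0 then if y = y0 then ?c else 0 else 0)))"
      by (intro sum_mono mult_left_mono pt P_nonneg)
    also have "\<dots> = (\<Sum>x\<in>UNIV. P x * (\<Sum>y\<in>UNIV. (1 - t) * eta (Q x y) + t * eta (W x y))
        + (if x = x0 then P x * ?c else 0))"
      by (intro sum.cong refl) (auto simp: sum.distrib distrib_left)
    also have "\<dots> = (1 - t) * (\<Sum>x\<in>UNIV. P x * (\<Sum>y\<in>UNIV. eta (Q x y)))
        + t * (\<Sum>x\<in>UNIV. P x * (\<Sum>y\<in>UNIV. eta (W x y))) + P x0 * ?c"
      by (simp add: sum.distrib sum_subtractf sum_distrib_left algebra_simps)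
    finally have "(1 - \<rho>) * (\<Sum>x\<in>UNIV. P x * (\<Sum>y\<in>UNIV. eta (mix t Q W x y)))
        \<le> (1 - \<rho>) * ((1 - t) * (\<Sum>x\<in>UNIV. P x * (\<Sum>y\<in>UNIV. eta (Q x y)))
        + t * (\<Sum>x\<in>UNIV. P x * (\<Sum>y\<in>UNIV. eta (W x y))) + P x0 * ?c)"
      using \<rho> by (intro mult_left_mono) auto
    moreover have "\<rho> * (\<Sum>y\<in>UNIV. eta (marginal P (mix t Q W) y))
        \<le> \<rho> * ((1 - t) * (\<Sum>y\<in>UNIV. eta (marginal P Q y)) + t * (\<Sum>y\<in>UNIV. eta (marginal P W y)))"
      using \<rho> t by (intro mult_left_mono eta_marginal_mix st W) auto
    ultimately have "obj \<rho> (mix t Q W) \<le> (1 - t) * obj \<rho> Q + t * obj \<rho> W + t * (\<kappa> * ln t)"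
      unfolding obj_eq lin_mix \<kappa>_def by (simp add: algebra_simps)
    moreover have "obj \<rho> Q \<le> obj \<rho> (mix t Q W)"
      using t by (intro min mix_dom Q W_dom) auto
    ultimately have "0 \<le> t * (G + \<kappa> * ln t)" by (simp add: G_def algebra_simps)
    then show ?thesis using t by (simp add: zero_le_mult_iff)
  qed
  \<comment> \<open>This value of \<open>t\<close> makes the right-hand side equal to -1.\<close>
  have "0 \<le> G + \<kappa> * ln (exp (- (G + 1) / \<kappa>))"
    using G \<kappa> by (intro bound) (auto simp: divide_less_0_iff)
  then show False using \<kappa> by simp
qed

text \<open>Linearising the concave part at the minimiser costs only a term quadratic in the step.\<close>

lemma minimiser_tobj:
  assumes Q: "Q \<in> dom" and \<rho>: "0 \<le> \<rho>" "\<rho> < 1"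
    and min: "\<And>V. V \<in> dom \<Longrightarrow> obj \<rho> Q \<le> obj \<rho> V" and V: "V \<in> dom"
  shows "obj \<rho> Q \<le> tobj \<rho> (marginal P Q) V"
proof -
  note sQ = dom_stoch[OF Q] and sV = dom_stoch[OF V]
  define S where "S = marginal P Q"
  have S0: "S y \<ge> 0" for y using marginal_nonneg[OF sQ] by (simp add: S_def)
  \<comment> \<open>The chi-squared bound needs the output of \<open>V\<close> to live where
    \<open>S\<close> does. On the inputs used by \<open>P\<close>, \<open>V\<close> is supported
    inside \<open>W\<close>, and the minimiser \<open>Q\<close> covers the support of
    \<open>W\<close>.\<close>
  have supp: "marginal P V y = 0" if "S y = 0" for y
  proof -
    have *: "P x * V x y = 0" for x
    proof (cases "0 < P x")
      case True
      then have "\<not> 0 < Q x y" using marginal_pos[OF sQ True, of y] that by (auto simp: S_def)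
      then have "\<not> 0 < W x y" using minimiser_support[OF Q \<rho> min True] by blast
      then show ?thesis using V True stoch_nonneg[OF W, of x y] by (simp add: dom_def)
    qed (use P_nonneg[of x] in simp)
    show ?thesis unfolding marginal_def * by simp
  qed
  define K where "K = (\<Sum>y\<in>UNIV. (marginal P V y - S y)\<^sup>2 / S y)"
  have K: "K \<ge> 0" unfolding K_def by (intro sum_nonneg) (simp add: S0)
  have tQ: "tobj \<rho> S Q = obj \<rho> Q" by (simp add: tobj_def S_def eta_def)
  \<comment> \<open>Minimality and convexity compare terms of order \<open>t\<close>, the
    linearisation error is of order \<open>t^2\<close>; dividing by \<open>t\<close> leaves an error
    that vanishes with \<open>t\<close>.\<close>
  have step: "obj \<rho> Q \<le> tobj \<rho> S V + t * (\<rho> * K)" if t: "0 < t" "t \<le> 1" for t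
  proof -
    let ?m = "marginal P (mix t Q V)"
    have diff: "?m y - S y = t * (marginal P V y - S y)" for y
      by (simp add: marginal_mix S_def algebra_simps)
    have "(\<Sum>y\<in>UNIV. eta (?m y) - ?m y * ln (S y)) \<le> (\<Sum>y\<in>UNIV. (?m y - S y)\<^sup>2 / S y + (?m y - S y))"
    proof (intro sum_mono eta_le_chi S0)
      show "0 \<le> ?m y" for y using t by (intro marginal_nonneg stoch_mix sQ sV) auto
      show "?m y = 0" if "S y = 0" for y using that supp[OF that] by (simp add: marginal_mix S_def)
    qed
    also have "\<dots> = t\<^sup>2 * K + ((\<Sum>y\<in>UNIV. ?m y) - (\<Sum>y\<in>UNIV. S y))"
    proof -
      have "(\<Sum>y\<in>UNIV. (?m y - S y)\<^sup>2 / S y) = t\<^sup>2 * K"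
        unfolding diff K_def by (simp add: power_mult_distrib sum_distrib_left)
      then show ?thesis by (simp add: sum.distrib sum_subtractf)
    qed
    also have "\<dots> = t\<^sup>2 * K"
      using marginal_sum[OF sQ] marginal_sum[OF stoch_mix[OF sQ sV, of t]] t by (simp add: S_def)
    finally have "\<rho> * (\<Sum>y\<in>UNIV. eta (?m y) - ?m y * ln (S y)) \<le> \<rho> * (t\<^sup>2 * K)"
      using \<rho> by (intro mult_left_mono) auto
    then have "obj \<rho> (mix t Q V) \<le> tobj \<rho> S (mix t Q V) + \<rho> * (t\<^sup>2 * K)"
      by (simp add: tobj_def)
    also have "tobj \<rho> S (mix t Q V) \<le> (1 - t) * tobj \<rho> S Q + t * tobj \<rho> S V"
      using t \<rho> by (intro tobj_mix sQ sV) auto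
    finally have "obj \<rho> (mix t Q V) \<le> (1 - t) * obj \<rho> Q + t * tobj \<rho> S V + \<rho> * (t\<^sup>2 * K)"
      by (simp add: tQ)
    moreover have "obj \<rho> Q \<le> obj \<rho> (mix t Q V)"
      using t by (intro min mix_dom Q V) auto
    ultimately have "t * obj \<rho> Q \<le> t * (tobj \<rho> S V + t * (\<rho> * K))"
      by (simp add: algebra_simps power2_eq_square)
    then show ?thesis using t by simp
  qed
  have "obj \<rho> Q \<le> tobj \<rho> S V"
  proof (rule field_le_epsilon)
    fix e :: real assume e: "e > 0"
    have rK: "0 \<le> \<rho> * K" using \<rho> K by simp
    define t where "t = min 1 (e / (\<rho> * K + 1))"
    have t: "0 < t" "t \<le> 1" "t \<le> e / (\<rho> * K + 1)" using e rK by (auto simp: t_def)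
    have "t * (\<rho> * K) \<le> e / (\<rho> * K + 1) * (\<rho> * K + 1)"
      using t rK by (intro mult_mono) auto
    also have "\<dots> = e" using rK by simp
    finally show "obj \<rho> Q \<le> tobj \<rho> S V + e" using step[OF t(1,2)] by simp
  qed
  then show ?thesis by (simp add: S_def)
qed

text \<open>When \<open>S\<close> is positive on the support of \<open>W x\<close>,
  \<open>ln (rsum l S x)\<close> is \<open>l - 1\<close> times the Renyi divergence in nats. Other
  letters drop out because \<open>0 powr l = 0\<close>.\<close>

definition rsum :: "real \<Rightarrow> ('y \<Rightarrow> real) \<Rightarrow> 'x \<Rightarrow> real" where
  "rsum l S x = (\<Sum>y\<in>UNIV. W x y powr l * S y powr (1 - l))"

text \<open>The condition for the averaged Renyi divergence of order above 1 to be finite, see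
  \<open>renyi_sum_eq\<close>.\<close>

definition dominates :: "('y \<Rightarrow> real) \<Rightarrow> bool" where
  "dominates S \<longleftrightarrow> (\<forall>y. 0 \<le> S y) \<and> (\<forall>x y. 0 < P x \<longrightarrow> 0 < W x y \<longrightarrow> 0 < S y)"

lemma ex_W_pos: "\<exists>y. 0 < W x y"
proof (rule ccontr)
  assume "\<nexists>y. 0 < W x y"
  then have "W x y = 0" for y using stoch_nonneg[OF W, of x y] by (metis less_le)
  then show False using stoch_sum[OF W, of x] by simp
qed

lemma rsum_pos:
  assumes "dominates S" "0 < P x"
  shows "0 < rsum l S x"
proof -
  obtain y where y: "0 < W x y" using ex_W_pos by blast
  then have "0 < S y" using assms by (auto simp: dominates_def)
  with y show ?thesis unfolding rsum_def by (intro sum_pos2[of _ y]) auto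
qed

text \<open>With the output term linear, the objective splits over the input letters, so each row
  can be optimised separately.\<close>

lemma tobj_eq_sum: "tobj \<rho> S Q = (\<Sum>x\<in>UNIV. P x * (\<Sum>y\<in>UNIV.
    (1 - \<rho>) * eta (Q x y) + \<rho> * (Q x y * ln (S y)) - Q x y * ln (W x y)))"
proof -
  have "(\<Sum>y\<in>UNIV. marginal P Q y * ln (S y)) = (\<Sum>x\<in>UNIV. P x * (\<Sum>y\<in>UNIV. Q x y * ln (S y)))"
    unfolding marginal_def sum_distrib_right sum_distrib_left
    by (subst sum.swap) (simp add: mult.assoc)
  then show ?thesis
    by (simp add: tobj_eq sum.distrib sum_subtractf sum_distrib_left algebra_simps)
qed

text \<open>Stationarity of a row reads
  \<open>(1 - \<rho>) * ln V = ln W - \<rho> * ln S + const\<close>. Solving for \<open>V\<close>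
  gives the exponents \<open>l = 1 / (1 - \<rho>)\<close> and \<open>1 - l\<close>, normalised by
  \<open>rsum\<close>; rows outside the support of \<open>P\<close> are filled with
  \<open>W x\<close> to keep \<open>V\<close> stochastic.\<close>

lemma ex_tilted:
  assumes S: "dominates S" and \<rho>: "0 \<le> \<rho>" "\<rho> < 1" and l: "l = 1 / (1 - \<rho>)"
  obtains V where "V \<in> dom" "tobj \<rho> S V = - (1 - \<rho>) * (\<Sum>x\<in>UNIV. P x * ln (rsum l S x))"
proof -
  define V where "V x y = (if 0 < P x then W x y powr l * S y powr (1 - l) / rsum l S x else W x y)" for x y
  have "V \<in> dom"
  proof -
    have "0 \<le> V x y" for x y
      using rsum_pos[OF S, of x l] by (auto simp: V_def stoch_nonneg[OF W] intro!: divide_nonneg_nonneg)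
    moreover have "(\<Sum>y\<in>UNIV. V x y) = 1" for x
      using rsum_pos[OF S, of x l]
      by (cases "0 < P x") (auto simp: V_def stoch_sum[OF W] sum_divide_distrib[symmetric] rsum_def[symmetric])
    ultimately show ?thesis by (auto simp: dom_def stoch_def pdist_def V_def)
  qed
  moreover have "tobj \<rho> S V = (\<Sum>x\<in>UNIV. P x * (- (1 - \<rho>) * ln (rsum l S x)))"
    unfolding tobj_eq_sum
  proof (rule sum.cong[OF refl])
    fix x
    show "P x * (\<Sum>y\<in>UNIV. (1 - \<rho>) * eta (V x y) + \<rho> * (V x y * ln (S y)) - V x y * ln (W x y))
      = P x * (- (1 - \<rho>) * ln (rsum l S x))"
    proof (cases "0 < P x")
      case True
      have "(1 - \<rho>) * eta (V x y) + \<rho> * (V x y * ln (S y)) - V x y * ln (W x y)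
          = V x y * (- (1 - \<rho>) * ln (rsum l S x))" for y
      proof (cases "0 < W x y")
        case W: True
        then have "0 < S y" using S True by (auto simp: dominates_def)
        then have lnV: "ln (V x y) = l * ln (W x y) + (1 - l) * ln (S y) - ln (rsum l S x)"
          using W True rsum_pos[OF S True, of l]
          by (simp add: V_def ln_div ln_mult ln_powr)
        have "(1 - \<rho>) * ln (V x y)
            = ((1 - \<rho>) * l) * ln (W x y) + ((1 - \<rho>) * (1 - l)) * ln (S y) - (1 - \<rho>) * ln (rsum l S x)"
          unfolding lnV by (simp add: algebra_simps)
        moreover have "(1 - \<rho>) * l = 1" "(1 - \<rho>) * (1 - l) = - \<rho>"
          using \<rho> by (simp_all add: l right_diff_distrib)
        ultimately have "(1 - \<rho>) * ln (V x y) = ln (W x y) - \<rho> * ln (S y) - (1 - \<rho>) * ln (rsum l S x)"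
          by simp
        moreover have "(1 - \<rho>) * eta (V x y) + \<rho> * (V x y * ln (S y)) - V x y * ln (W x y)
          = V x y * ((1 - \<rho>) * ln (V x y) + \<rho> * ln (S y) - ln (W x y))"
          by (simp add: eta_def algebra_simps)
        ultimately show ?thesis by (simp only:) (simp add: algebra_simps)
      next
        case False
        then have "W x y = 0" using stoch_nonneg[OF W, of x y] by simp
        then show ?thesis using True by (simp add: V_def)
      qed
      then show ?thesis
        using stoch_sum[OF dom_stoch[OF \<open>V \<in> dom\<close>], of x] by (simp add: sum_distrib_right[symmetric])
    qed (use P_nonneg[of x] in simp)
  qed
  then have "tobj \<rho> S V = - (1 - \<rho>) * (\<Sum>x\<in>UNIV. P x * ln (rsum l S x))"
    by (simp add: sum_distrib_left sum_negf algebra_simps)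
  ultimately show thesis using that by blast
qed

lemma minimax:
  obtains Q \<rho> S where "Q \<in> dom" "\<And>V. V \<in> dom \<Longrightarrow> expo R Q \<le> expo R V" "0 \<le> \<rho>" "\<rho> \<le> 1 / 2"
    "pdist S" "dominates S"
    "expo R Q \<le> \<rho> * R - (1 - \<rho>) * (\<Sum>x\<in>UNIV. P x * ln (rsum (1 / (1 - \<rho>)) S x))"
proof -
  obtain Q where Q: "Q \<in> dom" and min: "\<And>V. V \<in> dom \<Longrightarrow> expo R Q \<le> expo R V"
    using ex_expo_minimiser by blast
  \<comment> \<open>The positive part makes the exponent a maximum of two objectives, of slopes 0
    and 1/2, so a mixing weight \<open>s\<close> becomes the slope \<open>s / 2\<close>.\<close>
  define f where "f V = obj 0 V" for V
  define g where "g V = obj (1/2) V + R / 2" for V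
  have expo: "expo R V = max (f V) (g V)" for V
    by (simp add: expo_def f_def g_def obj_def max_def field_simps)
  obtain s where s: "0 \<le> s" "s \<le> 1" and sv: "\<And>V. V \<in> dom \<Longrightarrow> expo R Q \<le> (1 - s) * f V + s * g V"
  proof (rule convexlike_max_ge_combination[of dom f g "expo R Q"])
    fix V U and t :: real assume VU: "V \<in> dom" "U \<in> dom" and t: "0 \<le> t" "t \<le> 1"
    have "obj (1/2) (mix t V U) \<le> (1 - t) * obj (1/2) V + t * obj (1/2) U"
      using VU t by (intro obj_mix dom_stoch) auto
    then have "g (mix t V U) \<le> (1 - t) * g V + t * g U"
      by (simp add: g_def field_simps)
    moreover have "f (mix t V U) \<le> (1 - t) * f V + t * f U"
      unfolding f_def using VU t by (intro obj_mix dom_stoch) auto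
    ultimately show "\<exists>r\<in>dom. f r \<le> (1 - t) * f V + t * f U \<and> g r \<le> (1 - t) * g V + t * g U"
      using mix_dom[OF VU t] by blast
  next
    show "\<And>V. V \<in> dom \<Longrightarrow> expo R Q \<le> max (f V) (g V)" using min by (simp add: expo)
    show "dom \<noteq> {}" using W_dom by auto
  qed blast
  define \<rho> where "\<rho> = s / 2"
  have \<rho>: "0 \<le> \<rho>" "\<rho> \<le> 1/2" "\<rho> < 1" using s by (auto simp: \<rho>_def)
  have comb: "(1 - s) * f V + s * g V = obj \<rho> V + \<rho> * R" for V
    by (simp add: f_def g_def \<rho>_def obj_def field_simps)
  \<comment> \<open>A convex combination is at most the maximum, so equality holds at
    \<open>Q\<close>, and \<open>Q\<close> also minimises \<open>obj \<rho>\<close>.\<close>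
  have "(1 - s) * f Q + s * g Q \<le> expo R Q"
    unfolding expo using s by (intro convex_bound_le) auto
  then have eq: "expo R Q = obj \<rho> Q + \<rho> * R" using sv[OF Q] comb[of Q] by simp
  have minobj: "obj \<rho> Q \<le> obj \<rho> V" if "V \<in> dom" for V
    using sv[OF that] comb[of V] eq by simp
  define S where "S = marginal P Q"
  have dS: "dominates S"
    using marginal_nonneg[OF dom_stoch[OF Q]] marginal_pos[OF dom_stoch[OF Q]]
      minimiser_support[OF Q \<rho>(1,3) minobj]
    by (auto simp: dominates_def S_def)
  have pS: "pdist S"
    using marginal_nonneg[OF dom_stoch[OF Q]] marginal_sum[OF dom_stoch[OF Q]] by (simp add: pdist_def S_def)
  obtain V where V: "V \<in> dom" "tobj \<rho> S V = - (1 - \<rho>) * (\<Sum>x\<in>UNIV. P x * ln (rsum (1 / (1 - \<rho>)) S x))"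
    using ex_tilted[OF dS \<rho>(1,3) refl] by blast
  have "obj \<rho> Q \<le> tobj \<rho> S V"
    unfolding S_def by (rule minimiser_tobj[OF Q \<rho>(1,3) minobj V(1)])
  then have "expo R Q \<le> \<rho> * R - (1 - \<rho>) * (\<Sum>x\<in>UNIV. P x * ln (rsum (1 / (1 - \<rho>)) S x))"
    using eq V(2) by linarith
  then show thesis using that[OF Q min \<rho>(1,2) pS dS] by blast
qed

end

section \<open>Achievability\<close>

lemma exp_l1_eq:
  fixes P :: "'x::finite \<Rightarrow> real" and W :: "'x \<Rightarrow> 'y::finite \<Rightarrow> real"
  assumes "M = nat \<lceil>b powr (real n * R)\<rceil>" "T = typ_class n P"
  shows "exp_l1 b n R P W = (\<Sum>ys\<in>{ys. length ys = n}. cb_exp T M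
    (\<lambda>c. \<bar>(\<Sum>j<M. chan_n W (c j) ys) / real M - avg T (\<lambda>xs. chan_n W xs ys)\<bar>))"
  unfolding exp_l1_def Let_def assms[symmetric] cb_exp_def codebook_out_def out_dist_def avg_def
    sum_divide_distrib[symmetric]
  by (subst sum.swap) simp

lemma chan_n_const_fst: "length xs = length ys \<Longrightarrow> chan_n (\<lambda>_. S) xs ys = (\<Prod>y\<leftarrow>ys. S y)"
  by (induction rule: list_induct2) auto

lemma chan_n_pos_iff:
  assumes "length xs = length ys" "\<And>x y. 0 \<le> U x y"
  shows "0 < chan_n U xs ys \<longleftrightarrow> (\<forall>(x, y)\<in>set (zip xs ys). 0 < U x y)"
  using assms(1)
proof (induction rule: list_induct2)
  case (Cons x xs y ys)
  have "0 \<le> chan_n U xs ys" by (intro chan_n_nonneg assms)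
  with Cons show ?case using assms(2)[of x y] by (auto simp: zero_less_mult_iff)
qed simp

lemma chan_n_exp_ln:
  assumes "length xs = length ys" "\<forall>(x, y)\<in>set (zip xs ys). 0 < U x y"
  shows "chan_n U xs ys = exp (\<Sum>(x, y)\<leftarrow>zip xs ys. ln (U x y))"
  using assms by (induction rule: list_induct2) (auto simp: exp_add)

lemma chan_n_powr:
  assumes "length xs = length ys" "\<And>x y. 0 \<le> U x y" "\<And>y. 0 \<le> S y"
  shows "chan_n (\<lambda>x y. U x y powr a * S y powr b) xs ys = chan_n U xs ys powr a * (\<Prod>y\<leftarrow>ys. S y) powr b"
  using assms(1)
proof (induction rule: list_induct2)
  case (Cons x xs y ys)
  then show ?case
    using assms by (simp add: powr_mult chan_n_nonneg prod_list_nonneg' mult_ac)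
qed simp

lemma set_zip_typ_class_pos:
  assumes "xs \<in> typ_class n P" "pdist P" "(x, y) \<in> set (zip xs ys)"
  shows "0 < P x"
  using typ_class_pos[OF assms(1) set_zip_leftD[OF assms(3)] assms(2)] .

context channel begin

lemma codebook_deviation_upper:
  fixes n :: nat
  assumes T: "T = typ_class n P" "T \<noteq> {}" and M: "M > 0" and l: "1 \<le> l" "l \<le> 2"
    and S: "pdist S" "dominates S"
  shows "(\<Sum>ys\<in>{ys. length ys = n}. cb_exp T M
      (\<lambda>c. \<bar>(\<Sum>j<M. chan_n W (c j) ys) / real M - avg T (\<lambda>xs. chan_n W xs ys)\<bar>))
    \<le> 3 * exp (n * (\<Sum>x\<in>UNIV. P x * ln (rsum l S x)) / l - (l - 1) / l * ln M)"
proof -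
  define B where "B = exp (n * (\<Sum>x\<in>UNIV. P x * ln (rsum l S x)))"
  \<comment> \<open>balances the two terms of the truncation bound\<close>
  define \<tau> where "\<tau> = (M * B) powr (1 / l)"
  have \<tau>: "\<tau> > 0" using M by (simp add: \<tau>_def B_def)
  have S0: "0 \<le> S y" for y using S by (simp add: pdist_def)
  define Sn where "Sn ys = (\<Prod>y\<leftarrow>ys. S y)" for ys :: "'y list"
  have Sn0: "0 \<le> Sn ys" for ys unfolding Sn_def by (intro prod_list_nonneg' S0)
  have finT: "finite T" by (simp add: T)
  have W0: "0 \<le> W x y" for x y by (rule stoch_nonneg[OF W])
  have chan0: "0 \<le> chan_n W xs ys" for xs ys by (intro chan_n_nonneg W0)
  have lenT: "length xs = n" if "xs \<in> T" for xs using that T by (simp add: typ_class_def)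
  let ?g = "\<lambda>ys. avg T (\<lambda>xs. chan_n W xs ys powr l)"
  let ?E = "\<lambda>ys. cb_exp T M (\<lambda>c. \<bar>(\<Sum>j<M. chan_n W (c j) ys) / real M - avg T (\<lambda>xs. chan_n W xs ys)\<bar>)"
  have each: "?E ys \<le> 5 / 2 * \<tau> powr (1 - l) * (Sn ys powr (1 - l) * ?g ys) + \<tau> / (2 * M) * Sn ys"
    if len: "length ys = n" for ys
  proof (cases "Sn ys = 0")
    case False
    then have pos: "Sn ys > 0" using Sn0[of ys] by simp
    have "?E ys \<le> 5 / 2 * ((\<tau> * Sn ys) powr (1 - l) * ?g ys) + \<tau> * Sn ys / (2 * M)"
      using pos \<tau> l M by (intro cb_exp_abs_dev_upper finT T chan0) auto
    then show ?thesis using pos \<tau> by (simp add: powr_mult mult_ac)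
  next
    \<comment> \<open>Here the truncation level would be 0, but by domination no codeword of the
      class can produce \<open>ys\<close>.\<close>
    case True
    have zero: "chan_n W xs ys = 0" if "xs \<in> T" for xs
    proof (rule ccontr)
      assume "chan_n W xs ys \<noteq> 0"
      then have "0 < chan_n W xs ys" using chan0[of xs ys] by simp
      moreover have ll: "length xs = length ys" using lenT[OF that] len by simp
      ultimately have "\<forall>(x, y)\<in>set (zip xs ys). 0 < W x y" using chan_n_pos_iff W0 by blast
      moreover have "0 < P x" if "(x, y) \<in> set (zip xs ys)" for x y
        using set_zip_typ_class_pos[OF _ P that] \<open>xs \<in> T\<close> T by simp
      ultimately have "\<forall>(x, y)\<in>set (zip xs ys). 0 < S y" using S(2) unfolding dominates_def by blast
      then have "0 < chan_n (\<lambda>_. S) xs ys" by (subst chan_n_pos_iff[OF ll]) (auto simp: S0)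
      then show False using True by (simp add: chan_n_const_fst[OF ll] Sn_def)
    qed
    have "(\<Sum>j<M. chan_n W (c j) ys) = 0" if "c \<in> PiE {..<M} (\<lambda>_. T)" for c
      using that by (intro sum.neutral) (auto intro: zero PiE_mem)
    then have "?E ys \<le> cb_exp T M (\<lambda>c. 0)"
      by (intro cb_exp_mono) (simp add: avg_def zero)
    then show ?thesis using True finT T by (simp add: cb_exp_const)
  qed
  \<comment> \<open>The sum attached to a codeword factorises over its letters and hence equals
    \<open>B\<close> throughout the class.\<close>
  have sumB: "(\<Sum>ys\<in>{ys. length ys = n}. Sn ys powr (1 - l) * ?g ys) = B"
  proof -
    have "(\<Sum>ys\<in>{ys. length ys = n}. Sn ys powr (1 - l) * ?g ys)
        = avg T (\<lambda>xs. \<Sum>ys\<in>{ys. length ys = n}. chan_n W xs ys powr l * Sn ys powr (1 - l))"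
      unfolding avg_cmult[symmetric] avg_def sum_divide_distrib[symmetric]
      by (subst sum.swap) (simp add: sum_distrib_left sum_divide_distrib mult.commute)
    also have "\<dots> = avg T (\<lambda>xs. B)"
      unfolding avg_def
    proof (intro arg_cong2[where f = "(/)"] sum.cong refl)
      fix xs assume xs: "xs \<in> T"
      have "(\<Sum>ys\<in>{ys. length ys = n}. chan_n W xs ys powr l * Sn ys powr (1 - l))
          = (\<Sum>ys\<in>{ys. length ys = length xs}. chan_n (\<lambda>x y. W x y powr l * S y powr (1 - l)) xs ys)"
        using lenT[OF xs] by (intro sum.cong) (auto simp: chan_n_powr W0 S0 Sn_def)
      also have "\<dots> = (\<Prod>x\<leftarrow>xs. rsum l S x)" by (simp add: sum_chan_n rsum_def)
      also have "\<dots> = B"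
        unfolding B_def using xs T by (intro prod_list_typ_class P rsum_pos S) auto
      finally show "(\<Sum>ys\<in>{ys. length ys = n}. chan_n W xs ys powr l * Sn ys powr (1 - l)) = B" .
    qed
    finally show ?thesis using finT T by (simp add: avg_const)
  qed
  have sumS: "(\<Sum>ys\<in>{ys. length ys = n}. Sn ys) = 1"
    using S(1) by (simp add: Sn_def sum_prod_list pdist_def)
  have "(\<Sum>ys\<in>{ys. length ys = n}. ?E ys)
      \<le> (\<Sum>ys\<in>{ys. length ys = n}. 5 / 2 * \<tau> powr (1 - l) * (Sn ys powr (1 - l) * ?g ys) + \<tau> / (2 * M) * Sn ys)"
    using each by (intro sum_mono) auto
  also have "\<dots> = 5 / 2 * \<tau> powr (1 - l) * B + \<tau> / (2 * M)"
    by (simp only: sum.distrib sum_distrib_left[symmetric] sumB sumS mult_1_right)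
  also have "\<tau> powr (1 - l) * B = \<tau> / M"
  proof -
    have "\<tau> powr l = M * B" using M l by (simp add: \<tau>_def powr_powr B_def)
    moreover have "\<tau> powr (1 - l) * \<tau> powr l = \<tau>" using \<tau> by (simp flip: powr_add)
    ultimately have "\<tau> powr (1 - l) * (M * B) = \<tau>" by simp
    then show ?thesis using M by (simp add: field_simps)
  qed
  then have "5 / 2 * \<tau> powr (1 - l) * B + \<tau> / (2 * M) = 3 * (\<tau> / M)"
    by (simp add: mult.assoc)
  also have "\<tau> / M = exp (n * (\<Sum>x\<in>UNIV. P x * ln (rsum l S x)) / l - (l - 1) / l * ln M)"
  proof -
    have "\<tau> = exp (1 / l * (ln M + n * (\<Sum>x\<in>UNIV. P x * ln (rsum l S x))))"
      using M by (simp add: \<tau>_def powr_def ln_mult B_def)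
    moreover have "real M = exp (ln M)" using M by simp
    ultimately have "\<tau> / M = exp (1 / l * (ln M + n * (\<Sum>x\<in>UNIV. P x * ln (rsum l S x))) - ln M)"
      by (metis exp_diff)
    also have "1 / l * (ln M + n * (\<Sum>x\<in>UNIV. P x * ln (rsum l S x))) - ln M
        = n * (\<Sum>x\<in>UNIV. P x * ln (rsum l S x)) / l - (l - 1) / l * ln M"
      using l by (simp add: field_simps)
    finally show ?thesis .
  qed
  finally show ?thesis .
qed

end

section \<open>Converse\<close>

lemma avg_sum: "avg T (\<lambda>t. \<Sum>i\<in>I. f t i) = (\<Sum>i\<in>I. avg T (\<lambda>t. f t i))"
  unfolding avg_def by (subst sum.swap) (simp add: sum_divide_distrib)

text \<open>Output letters are independent given \<open>xs\<close> and \<open>d\<close> is centred,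
  so cross terms vanish. Both claims share one induction because the cross term of the second moment
  contains the first.\<close>

lemma chan_n_variance:
  fixes Q :: "'x::finite \<Rightarrow> 'y::finite \<Rightarrow> real"
  assumes Q: "stoch Q" and d: "\<And>x. (\<Sum>y\<in>UNIV. Q x y * d x y) = 0"
  shows "(\<Sum>ys\<in>{ys. length ys = length xs}. chan_n Q xs ys * (\<Sum>(x, y)\<leftarrow>zip xs ys. d x y)) = 0
    \<and> (\<Sum>ys\<in>{ys. length ys = length xs}. chan_n Q xs ys * (\<Sum>(x, y)\<leftarrow>zip xs ys. d x y)\<^sup>2)
      = (\<Sum>x\<leftarrow>xs. \<Sum>y\<in>UNIV. Q x y * (d x y)\<^sup>2)"
proof (induction xs)
  case (Cons x xs)
  let ?Y = "{ys. length ys = length xs} :: 'y list set"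
  let ?D = "\<lambda>ys. \<Sum>(x, y)\<leftarrow>zip xs ys. d x y"
  have one: "(\<Sum>ys\<in>?Y. chan_n Q xs ys) = 1" by (rule sum_chan_n_stoch[OF Q])
  have Q1: "(\<Sum>y\<in>UNIV. Q x y) = 1" using Q by (simp add: stoch_def pdist_def)
  have "(\<Sum>ys\<in>{ys. length ys = length (x # xs)}. chan_n Q (x # xs) ys * (\<Sum>(x, y)\<leftarrow>zip (x # xs) ys. d x y))
      = (\<Sum>y\<in>UNIV. \<Sum>ys\<in>?Y. (Q x y * d x y) * chan_n Q xs ys + Q x y * (chan_n Q xs ys * ?D ys))"
    by (simp add: sum_lists_Suc algebra_simps)
  also have "\<dots> = 0"
    using Cons by (simp only: sum.distrib sum_distrib_left[symmetric] sum_distrib_right[symmetric] one d)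
  finally have 1: "(\<Sum>ys\<in>{ys. length ys = length (x # xs)}. chan_n Q (x # xs) ys * (\<Sum>(x, y)\<leftarrow>zip (x # xs) ys. d x y)) = 0" .
  have "(\<Sum>ys\<in>{ys. length ys = length (x # xs)}. chan_n Q (x # xs) ys * (\<Sum>(x, y)\<leftarrow>zip (x # xs) ys. d x y)\<^sup>2)
      = (\<Sum>y\<in>UNIV. \<Sum>ys\<in>?Y. (Q x y * (d x y)\<^sup>2) * chan_n Q xs ys
        + (2 * (Q x y * d x y)) * (chan_n Q xs ys * ?D ys) + Q x y * (chan_n Q xs ys * (?D ys)\<^sup>2))"
    by (simp add: sum_lists_Suc power2_sum algebra_simps)
  also have "\<dots> = (\<Sum>y\<in>UNIV. Q x y * (d x y)\<^sup>2) + (\<Sum>x\<leftarrow>xs. \<Sum>y\<in>UNIV. Q x y * (d x y)\<^sup>2)"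
    using Cons by (simp only: sum.distrib sum_distrib_left[symmetric] sum_distrib_right[symmetric] one d Q1)
  finally show ?case using 1 by simp
qed simp

lemma chan_n_chebyshev:
  fixes Q :: "'x::finite \<Rightarrow> 'y::finite \<Rightarrow> real"
  assumes Q: "stoch Q" and d: "\<And>x. (\<Sum>y\<in>UNIV. Q x y * d x y) = 0"
  shows "(\<Sum>ys\<in>{ys. length ys = length xs}. chan_n Q xs ys * (\<Sum>(x, y)\<leftarrow>zip xs ys. d x y)\<^sup>2)
      \<le> length xs * (\<Sum>x\<in>UNIV. \<Sum>y\<in>UNIV. Q x y * (d x y)\<^sup>2)"
proof -
  have Q0: "0 \<le> Q x y" for x y using Q by (simp add: stoch_def pdist_def)
  have le: "(\<Sum>y\<in>UNIV. Q x y * (d x y)\<^sup>2) \<le> (\<Sum>x\<in>UNIV. \<Sum>y\<in>UNIV. Q x y * (d x y)\<^sup>2)" for x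
    by (rule member_le_sum) (auto intro!: sum_nonneg simp: Q0)
  have "(\<Sum>x\<leftarrow>xs. \<Sum>y\<in>UNIV. Q x y * (d x y)\<^sup>2) \<le> length xs * (\<Sum>x\<in>UNIV. \<Sum>y\<in>UNIV. Q x y * (d x y)\<^sup>2)"
  proof (induction xs)
    case (Cons x xs)
    then show ?case using le[of x] by (simp add: distrib_right)
  qed simp
  then show ?thesis using chan_n_variance[OF assms, of xs] by simp
qed

lemma sum_list_zip_diff:
  fixes g :: "'a \<Rightarrow> 'b \<Rightarrow> real"
  assumes "length xs = length ys"
  shows "(\<Sum>(x, y)\<leftarrow>zip xs ys. g x y - h x y - m x)
    = (\<Sum>(x, y)\<leftarrow>zip xs ys. g x y) - (\<Sum>(x, y)\<leftarrow>zip xs ys. h x y) - (\<Sum>x\<leftarrow>xs. m x)"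
  using assms by (induction rule: list_induct2) auto

context channel begin

text \<open>\<open>E1\<close> provides the factor 2 demanded by \<open>cb_exp_abs_dev_lower\<close>.
  \<open>E2\<close> limits the exceptional pairs to half of the \<open>Q\<close>-mass: Chebyshev for
  the two log-likelihood ratios with variance bounds \<open>K\<close>, and Markov, at the price of
  \<open>pol\<close>, for outputs whose mean likelihood exceeds \<open>S^n\<close> by a factor above
  \<open>exp (n * \<delta>)\<close>.\<close>

lemma codebook_deviation_lower:
  fixes n M :: nat and R \<delta> :: real
  assumes mt: "m_type m P" "m > 0" "k > 0" "n = m * k" and T: "T = typ_class n P" and M: "M > 0" "M \<le> exp (n * R) + 1"
    and Q: "Q \<in> dom" and \<delta>: "\<delta> > 0"
  defines "pol \<equiv> (exp 1 * real n) ^ card (UNIV :: 'x set)"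
    and "K \<equiv> \<lambda>l. \<Sum>x\<in>UNIV. \<Sum>y\<in>UNIV. Q x y * (l x y - (\<Sum>y\<in>UNIV. Q x y * l x y))\<^sup>2"
  assumes E1: "n * (minf Q - cdiv Q - 3 * \<delta>) \<ge> ln 2"
    and E2: "(K (\<lambda>x y. ln (Q x y) - ln (W x y)) + K (\<lambda>x y. ln (Q x y) - ln (marginal P Q y))) / (n * \<delta>\<^sup>2)
        + pol * exp (- (n * \<delta>)) \<le> 1 / 2"
  shows "exp (- (n * (cdiv Q + 1 / 2 * max 0 (R - minf Q) + 3 / 2 * \<delta>))) / (16 * sqrt (4 + 3 * pol))
    \<le> (\<Sum>ys\<in>{ys. length ys = n}. cb_exp T M
      (\<lambda>c. \<bar>(\<Sum>j<M. chan_n W (c j) ys) / real M - avg T (\<lambda>xs. chan_n W xs ys)\<bar>))"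
proof -
  let ?Y = "{ys. length ys = n} :: 'y list set"
  have n: "real n > 0" using mt by simp
  note sQ = dom_stoch[OF Q]
  have Q0: "0 \<le> Q x y" and W0: "0 \<le> W x y" for x y by (simp_all add: stoch_nonneg sQ W)
  define S where "S = marginal P Q"
  have S0: "0 \<le> S y" for y by (simp add: S_def marginal_nonneg sQ)
  define Sn where "Sn ys = (\<Prod>y\<leftarrow>ys. S y)" for ys :: "'y list"
  have Sn0: "0 \<le> Sn ys" for ys unfolding Sn_def by (intro prod_list_nonneg' S0)
  have finT: "finite T" by (simp add: T)
  have Tne: "T \<noteq> {}" using typ_class_nonempty[OF mt(1-3)] mt(4) T by simp
  have cT: "real (card T) > 0" using finT Tne by (simp add: card_gt_0_iff)
  have lenT: "length xs = n" if "xs \<in> T" for xs using that T by (simp add: typ_class_def)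
  define D where "D = cdiv Q"
  define J where "J = minf Q"
  define \<mu> where "\<mu> ys = avg T (\<lambda>xs. chan_n W xs ys)" for ys
  have chanQ0: "0 \<le> chan_n Q xs ys" and chanW0: "0 \<le> chan_n W xs ys" for xs ys
    by (intro chan_n_nonneg Q0 W0)+
  have \<mu>0: "0 \<le> \<mu> ys" for ys by (auto simp: \<mu>_def avg_def intro!: divide_nonneg_nonneg sum_nonneg chanW0)
  have pol: "pol \<ge> 0" by (simp add: pol_def)
  have RQ: "avg T (\<lambda>xs. chan_n Q xs ys) \<le> pol * Sn ys" if "ys \<in> ?Y" for ys
    using out_dist_le_iid[OF mt, of ys Q] that Q0
    by (simp add: pol_def Sn_def S_def out_dist_def avg_def T)

  define l1 where "l1 x y = ln (Q x y) - ln (W x y)" for x y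
  define l2 where "l2 x y = ln (Q x y) - ln (S y)" for x y
  define mean where "mean l x = (\<Sum>y\<in>UNIV. Q x y * l x y)" for l x
  define dev where "dev l xs ys = (\<Sum>(x, y)\<leftarrow>zip xs ys. l x y - mean l x)" for l xs ys
  have centered: "(\<Sum>y\<in>UNIV. Q x y * (l x y - mean l x)) = 0" for l x
    by (simp add: mean_def right_diff_distrib sum_subtractf sum_distrib_right[symmetric] stoch_sum sQ)
  have cheb: "(\<Sum>ys\<in>?Y. chan_n Q xs ys * (dev l xs ys)\<^sup>2) \<le> n * K l" if "xs \<in> T" for xs l
    using chan_n_chebyshev[OF sQ centered, of xs] lenT[OF that] by (simp add: dev_def K_def mean_def)

  have mean1: "(\<Sum>x\<leftarrow>xs. mean l1 x) = n * D" if "xs \<in> T" for xs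
  proof -
    have *: "P x * mean l1 x = P x * (\<Sum>y\<in>UNIV. eta (Q x y) - Q x y * ln (W x y))" for x
      by (simp add: mean_def l1_def eta_def right_diff_distrib)
    have "(\<Sum>x\<in>UNIV. P x * mean l1 x) = D" unfolding D_def cdiv_def by (rule sum.cong[OF refl *])
    then show ?thesis using sum_list_typ_class[of xs n P "mean l1"] that T by simp
  qed
  have mean2: "(\<Sum>x\<leftarrow>xs. mean l2 x) = n * J" if "xs \<in> T" for xs
  proof -
    have "(\<Sum>x\<in>UNIV. P x * mean l2 x) = (\<Sum>x\<in>UNIV. P x * (\<Sum>y\<in>UNIV. eta (Q x y)))
        - (\<Sum>x\<in>UNIV. \<Sum>y\<in>UNIV. P x * Q x y * ln (S y))"
      by (simp add: mean_def l2_def eta_def right_diff_distrib sum_subtractf sum_distrib_left mult.assoc)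
    also have "(\<Sum>x\<in>UNIV. \<Sum>y\<in>UNIV. P x * Q x y * ln (S y)) = (\<Sum>y\<in>UNIV. eta (S y))"
      by (subst sum.swap) (simp add: eta_def S_def marginal_def sum_distrib_right)
    finally show ?thesis
      using sum_list_typ_class[of xs n P "mean l2"] that T by (simp add: J_def minf_def S_def)
  qed

  \<comment> \<open>The change of measure: identities valid wherever the \<open>Q\<close>-likelihood
    is positive, with \<open>dev\<close> as the only fluctuating part.\<close>
  have paths: "0 < chan_n W xs ys" "0 < Sn ys"
      "chan_n Q xs ys = exp (n * D + dev l1 xs ys) * chan_n W xs ys"
      "chan_n Q xs ys = exp (n * J + dev l2 xs ys) * Sn ys"
    if xs: "xs \<in> T" and ys: "ys \<in> ?Y" and pos: "0 < chan_n Q xs ys" for xs ys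
  proof -
    have ll: "length xs = length ys" using lenT[OF xs] ys by simp
    have Qp: "\<forall>(x, y)\<in>set (zip xs ys). 0 < Q x y" using pos chan_n_pos_iff[OF ll Q0] by simp
    have WS: "0 < W x y \<and> 0 < S y" if xy: "(x, y) \<in> set (zip xs ys)" for x y
    proof -
      have "0 < P x" using set_zip_typ_class_pos[OF _ P xy] xs T by simp
      moreover have "0 < Q x y" using Qp xy by auto
      moreover from calculation have "W x y \<noteq> 0" using Q by (auto simp: dom_def)
      ultimately show ?thesis using W0[of x y] marginal_pos[OF sQ] by (simp add: S_def)
    qed
    then have Wp: "\<forall>(x, y)\<in>set (zip xs ys). 0 < W x y" and Sp: "\<forall>(x, y)\<in>set (zip xs ys). 0 < S y"
      by auto
    show "0 < chan_n W xs ys" using Wp chan_n_pos_iff[OF ll W0] by simp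
    have Sn: "Sn ys = chan_n (\<lambda>_. S) xs ys" by (simp add: Sn_def chan_n_const_fst[OF ll])
    show "0 < Sn ys" unfolding Sn using Sp by (subst chan_n_pos_iff[OF ll S0]) simp
    have "dev l1 xs ys = (\<Sum>(x, y)\<leftarrow>zip xs ys. ln (Q x y)) - (\<Sum>(x, y)\<leftarrow>zip xs ys. ln (W x y)) - n * D"
      unfolding dev_def l1_def mean1[OF xs, unfolded l1_def, symmetric] by (rule sum_list_zip_diff[OF ll])
    then show "chan_n Q xs ys = exp (n * D + dev l1 xs ys) * chan_n W xs ys"
      unfolding chan_n_exp_ln[OF ll Qp] chan_n_exp_ln[OF ll Wp] exp_add[symmetric] by simp
    have "dev l2 xs ys = (\<Sum>(x, y)\<leftarrow>zip xs ys. ln (Q x y)) - (\<Sum>(x, y)\<leftarrow>zip xs ys. ln (S y)) - n * J"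
      unfolding dev_def l2_def mean2[OF xs, unfolded l2_def, symmetric] by (rule sum_list_zip_diff[OF ll])
    then show "chan_n Q xs ys = exp (n * J + dev l2 xs ys) * Sn ys"
      unfolding chan_n_exp_ln[OF ll Qp] Sn chan_n_exp_ln[OF ll Sp] exp_add[symmetric] by simp
  qed

  \<comment> \<open>The last condition ties the true mean \<open>\<mu>\<close> to
    \<open>S^n\<close>, which the two ratios do not control.\<close>
  define A where "A ys = {xs \<in> T. 0 < chan_n Q xs ys \<and> \<bar>dev l1 xs ys\<bar> \<le> n * \<delta>
      \<and> \<bar>dev l2 xs ys\<bar> \<le> n * \<delta> \<and> \<mu> ys \<le> exp (n * \<delta>) * Sn ys}" for ys
  have AT: "A ys \<subseteq> T" and finA: "finite (A ys)" for ys using finT by (auto simp: A_def)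
  have A1: "exp (- (n * (D + \<delta>))) * chan_n Q xs ys \<le> chan_n W xs ys"
    and A2: "exp (n * (J - \<delta>)) * Sn ys \<le> chan_n Q xs ys" and A3: "0 < Sn ys"
    if xs: "xs \<in> A ys" and ys: "ys \<in> ?Y" for xs ys
  proof -
    have *: "xs \<in> T" "0 < chan_n Q xs ys" using xs by (auto simp: A_def)
    note p = paths[OF *(1) ys *(2)]
    show "0 < Sn ys" by (rule p)
    have "dev l1 xs ys \<le> n * \<delta>" "- (n * \<delta>) \<le> dev l2 xs ys" using xs by (auto simp: A_def)
    then have 1: "exp (- (n * (D + \<delta>)) + (n * D + dev l1 xs ys)) \<le> 1" and 2: "exp (n * (J - \<delta>)) \<le> exp (n * J + dev l2 xs ys)"
      by (simp_all add: algebra_simps)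
    have "exp (- (n * (D + \<delta>))) * chan_n Q xs ys = exp (- (n * (D + \<delta>)) + (n * D + dev l1 xs ys)) * chan_n W xs ys"
      by (simp only: p(3) exp_add mult.assoc)
    also have "\<dots> \<le> 1 * chan_n W xs ys" by (intro mult_right_mono 1 chanW0)
    finally show "exp (- (n * (D + \<delta>))) * chan_n Q xs ys \<le> chan_n W xs ys" by simp
    show "exp (n * (J - \<delta>)) * Sn ys \<le> chan_n Q xs ys"
      unfolding p(4) by (intro mult_right_mono 2 Sn0)
  qed
  \<comment> \<open>The three \<open>\<delta>\<close> in \<open>E1\<close> pay for the two
    deviations and for the comparison of \<open>\<mu>\<close> with \<open>S^n\<close>.\<close>
  have big: "2 * \<mu> ys \<le> chan_n W xs ys" if xs: "xs \<in> A ys" and ys: "ys \<in> ?Y" for xs ys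
  proof -
    have "exp (ln 2) \<le> exp (n * (J - D - 3 * \<delta>))"
      using E1 by (simp only: D_def J_def exp_le_cancel_iff)
    then have "2 \<le> exp (n * (J - D - 3 * \<delta>))" by simp
    then have "2 * \<mu> ys \<le> exp (n * (J - D - 3 * \<delta>)) * \<mu> ys" using \<mu>0 by (intro mult_right_mono) auto
    also have "\<dots> \<le> exp (n * (J - D - 3 * \<delta>)) * (exp (n * \<delta>) * Sn ys)"
      using xs by (intro mult_left_mono) (auto simp: A_def)
    also have "\<dots> = exp (- (n * (D + \<delta>))) * (exp (n * (J - \<delta>)) * Sn ys)"
      by (simp add: mult.assoc[symmetric] exp_add[symmetric]) (simp add: algebra_simps)
    also have "\<dots> \<le> exp (- (n * (D + \<delta>))) * chan_n Q xs ys"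
      using A2[OF xs ys] by (intro mult_left_mono) auto
    also have "\<dots> \<le> chan_n W xs ys" by (rule A1[OF xs ys])
    finally show ?thesis .
  qed
  define G where "G = max 0 (R - J)"
  have small: "1 + 3 * (M * (card (A ys) / card T)) \<le> (4 + 3 * pol) * exp (n * (G + \<delta>))" if ys: "ys \<in> ?Y" for ys
  proof -
    \<comment> \<open>Counting by mass: each element of \<open>A ys\<close> has
      \<open>Q\<close>-likelihood at least \<open>exp (n * (J - \<delta>)) * Sn ys\<close>, while
      the whole class has at most \<open>card T * pol * Sn ys\<close>.\<close>
    have frac: "card (A ys) / card T \<le> pol * exp (- (n * (J - \<delta>)))"
    proof (cases "A ys = {}")
      case False
      then have Sp: "0 < Sn ys" using A3 ys by blast
      have "real (card (A ys)) * (exp (n * (J - \<delta>)) * Sn ys) = (\<Sum>xs\<in>A ys. exp (n * (J - \<delta>)) * Sn ys)" by simp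
      also have "\<dots> \<le> (\<Sum>xs\<in>A ys. chan_n Q xs ys)" using A2 ys by (intro sum_mono) auto
      also have "\<dots> \<le> (\<Sum>xs\<in>T. chan_n Q xs ys)" by (intro sum_mono2 finT AT chanQ0)
      also have "\<dots> \<le> card T * (pol * Sn ys)"
        using RQ[OF ys] cT by (simp add: avg_def divide_le_eq mult.commute)
      finally have "(card (A ys) * exp (n * (J - \<delta>))) * Sn ys \<le> (card T * pol) * Sn ys" by (simp add: mult.assoc)
      then have le: "card (A ys) * exp (n * (J - \<delta>)) \<le> card T * pol" using Sp by simp
      define e where "e = n * (J - \<delta>)"
      have "real (card (A ys)) = card (A ys) * exp e * exp (- e)"
        by (simp add: mult.assoc exp_minus_inverse)
      also have "\<dots> \<le> card T * pol * exp (- e)"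
        using le by (intro mult_right_mono) (auto simp: e_def)
      finally show ?thesis using cT unfolding e_def[symmetric] by (simp add: divide_le_eq mult_ac)
    qed (use pol in simp)
    have e1: "exp (n * R) * exp (- (n * (J - \<delta>))) \<le> exp (n * (G + \<delta>))"
    proof -
      have "n * (R - J) \<le> n * G" by (intro mult_left_mono) (auto simp: G_def)
      then show ?thesis unfolding exp_add[symmetric] by (simp add: algebra_simps)
    qed
    have "0 \<le> real n * (G + \<delta>)" using \<delta> by (simp add: G_def)
    then have e2: "1 \<le> exp (n * (G + \<delta>))" by simp
    have c1: "card (A ys) / card T \<le> 1" using card_mono[OF finT AT] cT by simp
    have "M * (card (A ys) / card T) \<le> (exp (n * R) + 1) * (card (A ys) / card T)"
      using M by (intro mult_right_mono) auto
    also have "\<dots> = exp (n * R) * (card (A ys) / card T) + card (A ys) / card T" by (simp only: distrib_right mult_1_left)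
    also have "\<dots> \<le> exp (n * R) * (pol * exp (- (n * (J - \<delta>)))) + 1"
      using frac c1 by (intro add_mono mult_left_mono) auto
    also have "\<dots> = pol * (exp (n * R) * exp (- (n * (J - \<delta>)))) + 1" by simp
    also have "\<dots> \<le> pol * exp (n * (G + \<delta>)) + exp (n * (G + \<delta>))"
      using e1 e2 pol by (intro add_mono mult_left_mono) auto
    \<comment> \<open>\<open>4 + 3 * pol\<close> is \<open>1 + 3 * (pol + 1)\<close>; the inner 1
      pays for rounding \<open>M\<close> up.\<close>
    finally have "1 + 3 * (M * (card (A ys) / card T))
        \<le> exp (n * (G + \<delta>)) + 3 * (pol * exp (n * (G + \<delta>)) + exp (n * (G + \<delta>)))"
      using e2 by (intro add_mono mult_left_mono) (assumption | simp)+
    also have "\<dots> = (4 + 3 * pol) * exp (n * (G + \<delta>))" by (simp add: distrib_left distrib_right)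
    finally show ?thesis .
  qed

  \<comment> \<open>The square root halves the exponent \<open>G\<close>: this is the factor 1/2
    before the positive part.\<close>
  define C where "C = 8 * sqrt ((4 + 3 * pol) * exp (n * (G + \<delta>)))"
  have C: "C > 0" using pol by (simp add: C_def)
  let ?E = "\<lambda>ys. cb_exp T M (\<lambda>c. \<bar>(\<Sum>j<M. chan_n W (c j) ys) / real M - avg T (\<lambda>xs. chan_n W xs ys)\<bar>)"
  have each: "exp (- (n * (D + \<delta>))) * ((\<Sum>xs\<in>A ys. chan_n Q xs ys) / card T) / C \<le> ?E ys" if ys: "ys \<in> ?Y" for ys
  proof -
    have "exp (- (n * (D + \<delta>))) * ((\<Sum>xs\<in>A ys. chan_n Q xs ys) / card T) / C
        \<le> (\<Sum>xs\<in>A ys. chan_n W xs ys) / card T / C"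
      using A1 ys C by (auto simp: sum_distrib_left intro!: divide_right_mono sum_mono)
    also have "\<dots> \<le> (\<Sum>xs\<in>A ys. chan_n W xs ys) / card T / (8 * sqrt (1 + 3 * (M * (card (A ys) / card T))))"
    proof (rule divide_left_mono)
      show "8 * sqrt (1 + 3 * (M * (card (A ys) / card T))) \<le> C"
        unfolding C_def using small[OF ys] by simp
      have "0 < 1 + 3 * (M * (card (A ys) / card T))" by (intro add_pos_nonneg) auto
      then show "0 < C * (8 * sqrt (1 + 3 * (M * (card (A ys) / card T))))" using C by simp
      show "0 \<le> (\<Sum>xs\<in>A ys. chan_n W xs ys) / card T" by (intro divide_nonneg_nonneg sum_nonneg chanW0) auto
    qed
    also have "\<dots> \<le> ?E ys"
      using big ys by (intro cb_exp_abs_dev_lower finT Tne M chanW0 AT) (auto simp: \<mu>_def)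
    finally show ?thesis .
  qed

  have mass: "1 / 2 \<le> (\<Sum>ys\<in>?Y. (\<Sum>xs\<in>A ys. chan_n Q xs ys) / card T)"
  proof -
    let ?I = "\<lambda>xs ys. if xs \<in> A ys then chan_n Q xs ys else 0"
    let ?c = "1 / (n * \<delta>)\<^sup>2"
    let ?z = "\<lambda>ys. exp (- (n * \<delta>)) * \<mu> ys / Sn ys"
    have cpos: "0 \<le> ?c" by simp
    \<comment> \<open>A union bound in pointwise form: outside \<open>A ys\<close> one of the last
      three terms is at least the \<open>Q\<close>-likelihood.\<close>
    have pt: "chan_n Q xs ys \<le> ?I xs ys + ?c * (chan_n Q xs ys * (dev l1 xs ys)\<^sup>2)
        + ?c * (chan_n Q xs ys * (dev l2 xs ys)\<^sup>2) + chan_n Q xs ys * ?z ys"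
      if xs: "xs \<in> T" and ys: "ys \<in> ?Y" for xs ys
    proof (cases "0 < chan_n Q xs ys \<and> xs \<notin> A ys")
      case True
      then have Sp: "0 < Sn ys" using paths(2)[OF xs ys] by blast
      from True consider "n * \<delta> < \<bar>dev l1 xs ys\<bar>" | "n * \<delta> < \<bar>dev l2 xs ys\<bar>" | "exp (n * \<delta>) * Sn ys < \<mu> ys"
        using xs by (auto simp: A_def not_le)
      then have "1 \<le> ?c * (dev l1 xs ys)\<^sup>2 + ?c * (dev l2 xs ys)\<^sup>2 + ?z ys"
      proof cases
        case 1
        then have "(n * \<delta>)\<^sup>2 \<le> (dev l1 xs ys)\<^sup>2" using \<delta> by (intro abs_le_square_iff[THEN iffD1]) auto
        then have "1 \<le> ?c * (dev l1 xs ys)\<^sup>2" using \<delta> n by (simp add: le_divide_eq)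
        moreover have "0 \<le> ?c * (dev l2 xs ys)\<^sup>2" "0 \<le> ?z ys" using Sn0[of ys] \<mu>0[of ys] by simp_all
        ultimately show ?thesis by linarith
      next
        case 2
        then have "(n * \<delta>)\<^sup>2 \<le> (dev l2 xs ys)\<^sup>2" using \<delta> by (intro abs_le_square_iff[THEN iffD1]) auto
        then have "1 \<le> ?c * (dev l2 xs ys)\<^sup>2" using \<delta> n by (simp add: le_divide_eq)
        moreover have "0 \<le> ?c * (dev l1 xs ys)\<^sup>2" "0 \<le> ?z ys" using Sn0[of ys] \<mu>0[of ys] by simp_all
        ultimately show ?thesis by linarith
      next
        case 3
        then have "1 \<le> ?z ys" using Sp by (simp add: exp_minus le_divide_eq field_simps)
        moreover have "0 \<le> ?c * (dev l1 xs ys)\<^sup>2" "0 \<le> ?c * (dev l2 xs ys)\<^sup>2" by simp_all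
        ultimately show ?thesis by linarith
      qed
      then have "chan_n Q xs ys * 1 \<le> chan_n Q xs ys * (?c * (dev l1 xs ys)\<^sup>2 + ?c * (dev l2 xs ys)\<^sup>2 + ?z ys)"
        by (intro mult_left_mono chanQ0)
      then show ?thesis using True by (simp add: distrib_left mult_ac)
    next
      case False
      have "0 \<le> ?c * (chan_n Q xs ys * (dev l1 xs ys)\<^sup>2)" "0 \<le> ?c * (chan_n Q xs ys * (dev l2 xs ys)\<^sup>2)"
          "0 \<le> chan_n Q xs ys * ?z ys"
        using chanQ0[of xs ys] Sn0[of ys] \<mu>0[of ys] by simp_all
      moreover have "chan_n Q xs ys \<le> ?I xs ys" using False chanQ0[of xs ys] by auto
      ultimately show ?thesis by linarith
    qed
    have row: "1 \<le> (\<Sum>ys\<in>?Y. ?I xs ys) + (K l1 + K l2) / (n * \<delta>\<^sup>2) + (\<Sum>ys\<in>?Y. chan_n Q xs ys * ?z ys)"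
      if xs: "xs \<in> T" for xs
    proof -
      have "1 = (\<Sum>ys\<in>?Y. chan_n Q xs ys)" using sum_chan_n_stoch[OF sQ, of xs] lenT[OF xs] by simp
      also have "\<dots> \<le> (\<Sum>ys\<in>?Y. ?I xs ys + ?c * (chan_n Q xs ys * (dev l1 xs ys)\<^sup>2)
        + ?c * (chan_n Q xs ys * (dev l2 xs ys)\<^sup>2) + chan_n Q xs ys * ?z ys)"
        using pt[OF xs] by (rule sum_mono)
      also have "\<dots> = (\<Sum>ys\<in>?Y. ?I xs ys) + ?c * (\<Sum>ys\<in>?Y. chan_n Q xs ys * (dev l1 xs ys)\<^sup>2)
        + ?c * (\<Sum>ys\<in>?Y. chan_n Q xs ys * (dev l2 xs ys)\<^sup>2) + (\<Sum>ys\<in>?Y. chan_n Q xs ys * ?z ys)"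
        by (simp only: sum.distrib sum_distrib_left)
      also have "\<dots> \<le> (\<Sum>ys\<in>?Y. ?I xs ys) + ?c * (n * K l1) + ?c * (n * K l2) + (\<Sum>ys\<in>?Y. chan_n Q xs ys * ?z ys)"
        by (intro add_mono mult_left_mono cheb xs cpos order_refl)
      also have "?c * (n * K l1) + ?c * (n * K l2) = (K l1 + K l2) / (n * \<delta>\<^sup>2)"
        using n \<delta> by (simp add: power_mult_distrib power2_eq_square field_simps)
      then have "(\<Sum>ys\<in>?Y. ?I xs ys) + ?c * (n * K l1) + ?c * (n * K l2) + (\<Sum>ys\<in>?Y. chan_n Q xs ys * ?z ys)
        = (\<Sum>ys\<in>?Y. ?I xs ys) + (K l1 + K l2) / (n * \<delta>\<^sup>2) + (\<Sum>ys\<in>?Y. chan_n Q xs ys * ?z ys)" by simp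
      finally show ?thesis .
    qed
    have "1 = avg T (\<lambda>xs. 1)" by (simp add: avg_const finT Tne)
    also have "\<dots> \<le> avg T (\<lambda>xs. (\<Sum>ys\<in>?Y. ?I xs ys) + (K l1 + K l2) / (n * \<delta>\<^sup>2) + (\<Sum>ys\<in>?Y. chan_n Q xs ys * ?z ys))"
      by (rule avg_mono) (rule row)
    also have "\<dots> = avg T (\<lambda>xs. \<Sum>ys\<in>?Y. ?I xs ys) + (K l1 + K l2) / (n * \<delta>\<^sup>2)
        + avg T (\<lambda>xs. \<Sum>ys\<in>?Y. chan_n Q xs ys * ?z ys)"
      by (simp only: avg_add avg_const[OF finT Tne])
    also have "avg T (\<lambda>xs. \<Sum>ys\<in>?Y. ?I xs ys) = (\<Sum>ys\<in>?Y. (\<Sum>xs\<in>A ys. chan_n Q xs ys) / card T)"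
    proof -
      have "(\<Sum>xs\<in>T. ?I xs ys) = (\<Sum>xs\<in>A ys. chan_n Q xs ys)" for ys
        using finT AT[of ys] by (simp add: sum.If_cases Int_absorb1)
      then show ?thesis
        unfolding avg_def sum_divide_distrib[symmetric] by (subst sum.swap) simp
    qed
    also have "avg T (\<lambda>xs. \<Sum>ys\<in>?Y. chan_n Q xs ys * ?z ys) \<le> pol * exp (- (n * \<delta>))"
    proof -
      have "avg T (\<lambda>xs. \<Sum>ys\<in>?Y. chan_n Q xs ys * ?z ys) = (\<Sum>ys\<in>?Y. avg T (\<lambda>xs. chan_n Q xs ys) * ?z ys)"
        unfolding avg_sum using avg_cmult[of T "?z ys" "\<lambda>xs. chan_n Q xs ys" for ys]
        by (simp only: mult.commute)
      \<comment> \<open>The \<open>Q\<close>-output law is at most \<open>pol * Sn ys\<close>, which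
        cancels the denominator; what remains is the total mass 1 of the true output law
        \<open>\<mu>\<close>.\<close>
      also have "\<dots> \<le> (\<Sum>ys\<in>?Y. pol * exp (- (n * \<delta>)) * \<mu> ys)"
      proof (rule sum_mono)
        fix ys assume ys: "ys \<in> ?Y"
        have "avg T (\<lambda>xs. chan_n Q xs ys) * ?z ys \<le> (pol * Sn ys) * ?z ys"
          using RQ[OF ys] \<mu>0 Sn0 by (intro mult_right_mono) auto
        also have "\<dots> \<le> pol * exp (- (n * \<delta>)) * \<mu> ys"
          using pol \<mu>0[of ys] by (cases "Sn ys = 0") auto
        finally show "avg T (\<lambda>xs. chan_n Q xs ys) * ?z ys \<le> pol * exp (- (n * \<delta>)) * \<mu> ys" .
      qed
      also have "\<dots> = pol * exp (- (n * \<delta>)) * (\<Sum>ys\<in>?Y. \<mu> ys)" by (simp add: sum_distrib_left)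
      also have "(\<Sum>ys\<in>?Y. \<mu> ys) = avg T (\<lambda>xs. \<Sum>ys\<in>?Y. chan_n W xs ys)"
        unfolding \<mu>_def avg_sum ..
      also have "\<dots> = 1"
      proof -
        have "(\<Sum>ys\<in>?Y. chan_n W xs ys) = 1" if "xs \<in> T" for xs
          using sum_chan_n_stoch[OF W, of xs] lenT[OF that] by simp
        then show ?thesis using cT by (simp add: avg_def)
      qed
      finally show ?thesis by simp
    qed
    finally show ?thesis using E2 unfolding l1_def[abs_def] l2_def[abs_def] S_def by linarith
  qed

  have "exp (- (n * (cdiv Q + 1 / 2 * max 0 (R - minf Q) + 3 / 2 * \<delta>))) / (16 * sqrt (4 + 3 * pol))
      = exp (- (n * (D + \<delta>))) * (1 / 2) / C"
  proof -
    have "sqrt (exp (n * (G + \<delta>))) = exp (n * (G + \<delta>) / 2)"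
      by (rule real_sqrt_unique) (simp_all add: power2_eq_square exp_add[symmetric])
    then have "C = 8 * sqrt (4 + 3 * pol) * exp (n * (G + \<delta>) / 2)" by (simp add: C_def real_sqrt_mult)
    moreover have "exp (- (n * (D + \<delta>))) = exp (- (n * (D + 1 / 2 * G + 3 / 2 * \<delta>))) * exp (n * (G + \<delta>) / 2)"
      by (simp add: exp_add[symmetric] algebra_simps add_divide_distrib)
    ultimately show ?thesis by (simp add: D_def G_def J_def)
  qed
  also have "\<dots> \<le> exp (- (n * (D + \<delta>))) * (\<Sum>ys\<in>?Y. (\<Sum>xs\<in>A ys. chan_n Q xs ys) / card T) / C"
    using mass C by (intro divide_right_mono mult_left_mono) auto
  also have "\<dots> = (\<Sum>ys\<in>?Y. exp (- (n * (D + \<delta>))) * ((\<Sum>xs\<in>A ys. chan_n Q xs ys) / card T) / C)"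
    by (simp only: sum_distrib_left sum_divide_distrib)
  also have "\<dots> \<le> (\<Sum>ys\<in>?Y. ?E ys)" by (rule sum_mono) (rule each)
  finally show ?thesis .
qed

end

section \<open>Translation to the divergences of the statement\<close>

lemma eta_gt_tangent:
  assumes "u \<ge> 0" "c > 0" "u \<noteq> c"
  shows "u * ln c + u - c < eta u"
proof (cases "u = 0")
  case False
  with assms have u: "u > 0" by simp
  have "ln (c / u) \<le> c / u - 1" using assms u by (intro ln_le_minus_one) auto
  moreover have "ln (c / u) \<noteq> c / u - 1"
    using ln_eq_minus_one[of "c / u"] assms u by auto
  ultimately have "u * ln (c / u) < u * (c / u - 1)" using u by simp
  then show ?thesis using assms u by (simp add: eta_def ln_div algebra_simps)
qed (use assms in simp)

context channel begin

text \<open>The tangent of \<open>eta\<close> at \<open>W x y\<close> bounds each entry below by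
  \<open>Q x y - W x y\<close>, which sums to 0 over a row; \<open>dom\<close> covers the entries
  with \<open>W x y = 0\<close>.\<close>

lemma cdiv_nonneg:
  assumes "Q \<in> dom" shows "0 \<le> cdiv Q"
proof -
  note sQ = dom_stoch[OF assms]
  have "0 \<le> P x * (\<Sum>y\<in>UNIV. eta (Q x y) - Q x y * ln (W x y))" for x
  proof (cases "0 < P x")
    case True
    have "Q x y - W x y \<le> eta (Q x y) - Q x y * ln (W x y)" for y
    proof (cases "W x y = 0")
      case False
      then have "0 < W x y" using stoch_nonneg[OF W, of x y] by simp
      then show ?thesis using eta_ge_tangent[OF stoch_nonneg[OF sQ], of "W x y" x y] by simp
    qed (use assms True in \<open>simp add: dom_def\<close>)
    then have "(\<Sum>y\<in>UNIV. Q x y - W x y) \<le> (\<Sum>y\<in>UNIV. eta (Q x y) - Q x y * ln (W x y))" by (rule sum_mono)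
    then show ?thesis using True by (simp add: sum_subtractf stoch_sum sQ W)
  qed (use P_nonneg[of x] in simp)
  then show ?thesis unfolding cdiv_def by (rule sum_nonneg)
qed

lemma cdiv_W [simp]: "cdiv W = 0"
  by (simp add: cdiv_def eta_def)

lemma minf_eq: "minf Q = (\<Sum>x\<in>UNIV. P x * (\<Sum>y\<in>UNIV. eta (Q x y) - Q x y * ln (marginal P Q y)))"
proof -
  have "(\<Sum>x\<in>UNIV. P x * (\<Sum>y\<in>UNIV. Q x y * ln (marginal P Q y)))
      = (\<Sum>x\<in>UNIV. \<Sum>y\<in>UNIV. P x * Q x y * ln (marginal P Q y))"
    by (simp add: sum_distrib_left mult.assoc)
  also have "\<dots> = (\<Sum>y\<in>UNIV. \<Sum>x\<in>UNIV. P x * Q x y * ln (marginal P Q y))" by (rule sum.swap)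
  also have "\<dots> = (\<Sum>y\<in>UNIV. eta (marginal P Q y))"
    by (simp only: sum_distrib_right[symmetric] eta_def marginal_def)
  finally show ?thesis by (simp add: minf_def sum_subtractf right_diff_distrib)
qed

lemma minf_W_pos:
  assumes "0 < P x0" "W x0 y0 \<noteq> marginal P W y0"
  shows "0 < minf W"
proof -
  define S where "S = marginal P W"
  have S0: "0 \<le> S y" for y by (simp add: S_def marginal_nonneg W)
  have W0: "0 \<le> W x y" for x y by (rule stoch_nonneg[OF W])
  \<comment> \<open>The added linear terms sum to 0 over each row and make every entry with
    \<open>P x > 0\<close> nonnegative by the tangent inequality, strictly so at
    \<open>(x0, y0)\<close>.\<close>
  define t where "t x y = eta (W x y) - W x y * ln (S y) - W x y + S y" for x y
  have "minf W = (\<Sum>x\<in>UNIV. P x * (\<Sum>y\<in>UNIV. eta (W x y) - W x y * ln (S y)))"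
    by (simp add: minf_eq S_def)
  also have "\<dots> = (\<Sum>x\<in>UNIV. P x * (\<Sum>y\<in>UNIV. t x y))"
    using marginal_sum[OF W] stoch_sum[OF W] by (simp add: t_def sum.distrib sum_subtractf S_def)
  finally have eq: "minf W = (\<Sum>x\<in>UNIV. P x * (\<Sum>y\<in>UNIV. t x y))" .
  have t0: "0 \<le> t x y" if "0 < P x" for x y
  proof (cases "S y = 0")
    case True
    then have "W x y = 0" using marginal_pos[OF W that, of y] W0[of x y] by (force simp: S_def)
    then show ?thesis by (simp add: t_def True)
  next
    case False
    then have "0 < S y" using S0[of y] by simp
    then show ?thesis using eta_ge_tangent[OF W0, of "S y" x y] by (simp add: t_def)
  qed
  have "S y0 \<noteq> 0"
    using assms marginal_pos[OF W assms(1), of y0] W0[of x0 y0] by (force simp: S_def)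
  then have "0 < S y0" using S0[of y0] by simp
  then have "0 < t x0 y0"
    using eta_gt_tangent[OF W0, of "S y0" x0 y0] assms(2) by (simp add: t_def S_def)
  then have "0 < (\<Sum>y\<in>UNIV. t x0 y)"
    using t0[OF assms(1)] by (intro sum_pos2[of _ y0]) auto
  then show ?thesis unfolding eq
  proof (intro sum_pos2[of _ x0])
    fix x show "0 \<le> P x * (\<Sum>y\<in>UNIV. t x y)"
      using t0[of x] P_nonneg[of x] by (cases "P x = 0") (auto intro!: mult_nonneg_nonneg sum_nonneg)
  qed (use assms(1) in auto)
qed

text \<open>If every row used by \<open>P\<close> were the output law, all codewords of the class
  would give \<open>ys\<close> the same likelihood, which would then equal its mean
  \<open>out_dist\<close>.\<close>

lemma nondegenerate_witness:
  assumes "xs \<in> typ_class n P" "length ys = n" "chan_n W xs ys \<noteq> out_dist n P W ys"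
  obtains x y where "0 < P x" "W x y \<noteq> marginal P W y"
proof (rule ccontr)
  assume "\<not> thesis"
  with that have eq: "W x y = marginal P W y" if "0 < P x" for x y using \<open>0 < P x\<close> by blast
  have const: "chan_n W zs ys = (\<Prod>y\<leftarrow>ys. marginal P W y)" if z: "zs \<in> typ_class n P" for zs
  proof -
    have ll: "length zs = length ys" using z assms(2) by (simp add: typ_class_def)
    have "chan_n W zs ys = chan_n (\<lambda>_. marginal P W) zs ys"
      unfolding chan_n_def using typ_class_pos[OF z _ P] by (intro prod.cong refl eq) auto
    then show ?thesis using chan_n_const_fst[OF ll] by simp
  qed
  have "typ_class n P \<noteq> {}" using assms(1) by auto
  then have "out_dist n P W ys = (\<Prod>y\<leftarrow>ys. marginal P W y)" by (simp add: out_dist_def const)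
  with const[OF assms(1)] assms(3) show False by simp
qed

section \<open>Divergences in base b expressed in nats\<close>

lemma sum_prod_UNIV: "(\<Sum>a\<in>UNIV. f a) = (\<Sum>x\<in>UNIV. \<Sum>y\<in>UNIV. f (x, y))"
  for f :: "'x \<times> 'y \<Rightarrow> real"
  by (simp add: sum.cartesian_product flip: UNIV_Times_UNIV)

lemma joint_pos_iff:
  fixes Q :: "'x \<Rightarrow> 'y \<Rightarrow> real"
  shows "stoch Q \<Longrightarrow> 0 < joint P Q (x, y) \<longleftrightarrow> 0 < P x \<and> 0 < Q x y"
  using P_nonneg[of x] stoch_nonneg[of Q x y] by (auto simp: joint_def zero_less_mult_iff)

lemma divKL_joint_sum:
  fixes Q V :: "'x \<Rightarrow> 'y \<Rightarrow> real"
  assumes b: "b > 1" and Q: "stoch Q" and V: "\<And>x y. 0 < P x \<Longrightarrow> 0 < Q x y \<Longrightarrow> 0 < V x y"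
  shows "(\<Sum>a | joint P Q a > 0. joint P Q a * log b (joint P Q a / joint P V a))
    = (\<Sum>x\<in>UNIV. P x * (\<Sum>y\<in>UNIV. eta (Q x y) - Q x y * ln (V x y))) / ln b"
proof -
  have "(\<Sum>a | joint P Q a > 0. joint P Q a * log b (joint P Q a / joint P V a))
      = (\<Sum>a\<in>UNIV. joint P Q a * log b (joint P Q a / joint P V a))"
  proof (rule sum.mono_neutral_left)
    have "joint P Q a \<ge> 0" for a
      using P_nonneg stoch_nonneg[OF Q] by (simp add: joint_def split: prod.split)
    then show "\<forall>a\<in>UNIV - {a. joint P Q a > 0}. joint P Q a * log b (joint P Q a / joint P V a) = 0"
      by (metis DiffE UNIV_I less_le mem_Collect_eq mult_zero_left)
  qed auto
  also have "\<dots> = (\<Sum>x\<in>UNIV. \<Sum>y\<in>UNIV. P x * (eta (Q x y) - Q x y * ln (V x y)) / ln b)"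
    unfolding sum_prod_UNIV
  proof (intro sum.cong refl)
    fix x y
    show "joint P Q (x, y) * log b (joint P Q (x, y) / joint P V (x, y)) = P x * (eta (Q x y) - Q x y * ln (V x y)) / ln b"
    proof (cases "0 < P x \<and> 0 < Q x y")
      case True
      then have "0 < V x y" using V by blast
      moreover have "joint P Q (x, y) / joint P V (x, y) = Q x y / V x y" using True by (simp add: joint_def)
      ultimately show ?thesis using True by (simp add: joint_def log_def ln_div eta_def algebra_simps)
    next
      case False
      then have "P x = 0 \<or> Q x y = 0" using P_nonneg[of x] stoch_nonneg[OF Q, of x y] by auto
      then show ?thesis by (auto simp: joint_def)
    qed
  qed
  finally show ?thesis by (simp add: sum_distrib_left sum_divide_distrib)
qed

lemma divKL_joint:
  assumes b: "b > 1" and Q: "stoch Q"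
  shows "divKL b (joint P Q) (joint P W) = (if Q \<in> dom then ereal (cdiv Q / ln b) else \<infinity>)"
proof (cases "Q \<in> dom")
  case True
  have *: "0 < W x y" if "0 < P x" "0 < Q x y" for x y
  proof -
    have "W x y \<noteq> 0" using True that by (auto simp: dom_def)
    then show ?thesis using stoch_nonneg[OF W, of x y] by simp
  qed
  have "\<not> (joint P Q (x, y) > 0 \<and> joint P W (x, y) = 0)" for x y
    using *[of x y] by (auto simp: joint_pos_iff[OF Q]) (simp add: joint_def)
  then have "\<not> (\<exists>a. joint P Q a > 0 \<and> joint P W a = 0)" by auto
  then show ?thesis using True divKL_joint_sum[OF b Q *] by (simp add: divKL_def cdiv_def)
next
  case False
  then obtain x y where "0 < P x" "W x y = 0" "Q x y \<noteq> 0" using Q by (auto simp: dom_def)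
  then have "joint P Q (x, y) > 0 \<and> joint P W (x, y) = 0"
    using stoch_nonneg[OF Q, of x y] by (simp add: joint_def)
  then show ?thesis using False by (auto simp: divKL_def)
qed

lemma divKL_prodd:
  assumes b: "b > 1" and Q: "stoch Q"
  shows "divKL b (joint P Q) (prodd P (marginal P Q)) = ereal (minf Q / ln b)"
proof -
  have pj: "prodd P (marginal P Q) = joint P (\<lambda>_. marginal P Q)"
    by (simp add: prodd_def joint_def)
  have *: "0 < marginal P Q y" if "0 < P x" "0 < Q x y" for x y
    using marginal_pos[OF Q that] .
  have "\<not> (joint P Q (x, y) > 0 \<and> joint P (\<lambda>_. marginal P Q) (x, y) = 0)" for x y
    using *[of x y] by (auto simp: joint_pos_iff[OF Q]) (simp add: joint_def)
  then have "\<not> (\<exists>a. joint P Q a > 0 \<and> joint P (\<lambda>_. marginal P Q) a = 0)" by auto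
  then show ?thesis using divKL_joint_sum[OF b Q, of "\<lambda>_. marginal P Q"] * by (simp add: divKL_def pj minf_eq)
qed

text \<open>Passing to nats divides both divergences by \<open>ln b\<close>; the rate is scaled by
  \<open>ln b\<close> so that the factor can be pulled out of the positive part.\<close>

lemma objective_eq:
  assumes b: "b > 1" and Q: "stoch Q"
  shows "divKL b (joint P Q) (joint P W)
      + ereal (1/2) * max 0 (ereal R - divKL b (joint P Q) (prodd P (marginal P Q)))
    = (if Q \<in> dom then ereal (expo (ln b * R) Q / ln b) else \<infinity>)"
proof -
  have lb: "ln b > 0" using b by simp
  have "max 0 (ereal R - ereal (minf Q / ln b)) = ereal (max 0 (R - minf Q / ln b))"
    by (simp add: max_def)
  moreover have "max 0 (R - minf Q / ln b) = max 0 (ln b * R - minf Q) / ln b"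
    using lb by (auto simp: max_def field_simps)
  ultimately show ?thesis
    unfolding divKL_joint[OF b Q] divKL_prodd[OF b Q]
    by (auto simp: expo_def add_divide_distrib)
qed

lemma renyi_sum_eq:
  assumes b: "b > 1" and l: "l > 1" and S: "pdist S"
  shows "(\<Sum>x | P x > 0. ereal (P x) * renyi b l (W x) S)
    = (if dominates S then ereal ((\<Sum>x\<in>UNIV. P x * ln (rsum l S x)) / ((l - 1) * ln b)) else \<infinity>)"
proof (cases "dominates S")
  case True
  have r: "renyi b l (W x) S = ereal (ln (rsum l S x) / ((l - 1) * ln b))" if "0 < P x" for x
  proof -
    have "\<not> (\<exists>a. W x a > 0 \<and> S a = 0)" using True that by (force simp: dominates_def)
    moreover have "(\<Sum>a | W x a > 0. W x a powr l * S a powr (1 - l)) = rsum l S x"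
      unfolding rsum_def
      by (rule sum.mono_neutral_left) (use stoch_nonneg[OF W, of x] in \<open>auto simp: less_le\<close>)
    ultimately show ?thesis using l by (simp add: renyi_def log_def)
  qed
  have "(\<Sum>x | P x > 0. ereal (P x) * renyi b l (W x) S)
      = ereal (\<Sum>x | P x > 0. P x * (ln (rsum l S x) / ((l - 1) * ln b)))"
    by (simp add: r)
  also have "(\<Sum>x | P x > 0. P x * (ln (rsum l S x) / ((l - 1) * ln b)))
      = (\<Sum>x\<in>UNIV. P x * (ln (rsum l S x) / ((l - 1) * ln b)))"
    by (rule sum.mono_neutral_left) (use P_nonneg in \<open>auto simp: not_less antisym\<close>)
  finally show ?thesis using True by (simp add: sum_divide_distrib)
next
  case False
  then obtain x y where xy: "0 < P x" "0 < W x y" "\<not> 0 < S y" using S by (auto simp: dominates_def pdist_def)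
  then have "S y = 0" using S by (auto simp: pdist_def less_le)
  then have "renyi b l (W x) S = \<infinity>" using l xy by (auto simp: renyi_def)
  then have "ereal (P x) * renyi b l (W x) S = \<infinity>" using xy by simp
  then have "(\<Sum>x | P x > 0. ereal (P x) * renyi b l (W x) S) = \<infinity>"
    using xy(1) by (subst sum_Pinfty) force
  then show ?thesis using False by simp
qed

end

lemma eventually_lower_conditions:
  fixes \<delta> K \<gamma> :: real and c :: nat
  assumes "\<delta> > 0" "\<gamma> > 0"
  shows "eventually (\<lambda>n::nat. n * \<gamma> \<ge> ln 2 \<and> K / (n * \<delta>\<^sup>2) + (exp 1 * n) ^ c * exp (- (n * \<delta>)) \<le> 1 / 2
    \<and> 16 * sqrt (4 + 3 * (exp 1 * n) ^ c) \<le> exp (n * \<delta> / 2)) at_top"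
proof (intro eventually_conj)
  show "eventually (\<lambda>n::nat. n * \<gamma> \<ge> ln 2) at_top" using assms(2) by real_asymp
  have "((\<lambda>n::nat. K / (n * \<delta>\<^sup>2) + (exp 1 * n) ^ c * exp (- (n * \<delta>))) \<longlongrightarrow> 0) at_top"
    using assms(1) by real_asymp
  then have "eventually (\<lambda>n::nat. K / (n * \<delta>\<^sup>2) + (exp 1 * n) ^ c * exp (- (n * \<delta>)) < 1 / 2) at_top"
    by (rule order_tendstoD) simp
  then show "eventually (\<lambda>n::nat. K / (n * \<delta>\<^sup>2) + (exp 1 * n) ^ c * exp (- (n * \<delta>)) \<le> 1 / 2) at_top"
    by eventually_elim simp
  \<comment> \<open>The square root is bounded by its argument, which is at least 1; 64 and 48 are
    16 times the coefficients 4 and 3.\<close>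
  have "((\<lambda>n::nat. 64 * exp (- (n * \<delta> / 2)) + 48 * ((exp 1 * n) ^ c * exp (- (n * \<delta> / 2)))) \<longlongrightarrow> 0) at_top"
    using assms(1) by real_asymp
  then have "eventually (\<lambda>n::nat. 64 * exp (- (n * \<delta> / 2)) + 48 * ((exp 1 * n) ^ c * exp (- (n * \<delta> / 2))) < 1) at_top"
    by (rule order_tendstoD) simp
  then show "eventually (\<lambda>n::nat. 16 * sqrt (4 + 3 * (exp 1 * n) ^ c) \<le> exp (n * \<delta> / 2)) at_top"
  proof eventually_elim
    case (elim n)
    define u where "u = 4 + 3 * (exp 1 * real n) ^ c"
    have "u \<ge> 1" by (simp add: u_def)
    then have "u \<le> u\<^sup>2" using power_increasing[of 1 2 u] by simp
    then have "sqrt u \<le> u" using \<open>u \<ge> 1\<close> by (intro real_le_lsqrt) auto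
    moreover have "16 * u * exp (- (n * \<delta> / 2)) \<le> 1" using elim by (simp add: u_def algebra_simps)
    then have "16 * u \<le> exp (n * \<delta> / 2)" by (simp add: exp_minus field_simps)
    ultimately show ?case by (simp add: u_def)
  qed
qed

context channel begin

lemma exp_l1_upper:
  fixes b R l :: real and n :: nat
  assumes b: "b > 1" and T: "typ_class n P \<noteq> {}" and l: "1 \<le> l" "l \<le> 2"
    and S: "pdist S" "dominates S"
  shows "exp_l1 b n R P W
    \<le> 3 * exp (- (n * ((l - 1) / l * (ln b * R) - (\<Sum>x\<in>UNIV. P x * ln (rsum l S x)) / l)))"
proof -
  define M where "M = nat \<lceil>b powr (real n * R)\<rceil>"
  have pw: "b powr (real n * R) > 0" using b by simp
  then have M: "M > 0" "b powr (real n * R) \<le> M" by (simp_all add: M_def)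
  have "ln (b powr (real n * R)) \<le> ln (real M)" using pw M by (subst ln_le_cancel_iff) auto
  then have lnM: "n * (ln b * R) \<le> ln M" using b by (simp add: ln_powr mult_ac)
  have "exp_l1 b n R P W \<le> 3 * exp (n * (\<Sum>x\<in>UNIV. P x * ln (rsum l S x)) / l - (l - 1) / l * ln M)"
    unfolding exp_l1_eq[OF M_def refl] by (rule codebook_deviation_upper[OF refl T M(1) l S])
  also have "\<dots> \<le> 3 * exp (- (n * ((l - 1) / l * (ln b * R) - (\<Sum>x\<in>UNIV. P x * ln (rsum l S x)) / l)))"
  proof -
    have "(l - 1) / l * (n * (ln b * R)) \<le> (l - 1) / l * ln M" using lnM l by (intro mult_left_mono) auto
    then show ?thesis by (simp add: right_diff_distrib mult_ac)
  qed
  finally show ?thesis .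
qed

lemma eventually_exp_l1_lower:
  fixes b R \<delta> :: real
  assumes b: "b > 1" and mt: "m_type m P" "m > 0" and Q: "Q \<in> dom"
    and gap: "cdiv Q < minf Q" and \<delta>: "\<delta> > 0"
  shows "\<forall>\<^sub>F k in sequentially. exp (- (real (m * k) * (expo (ln b * R) Q + \<delta>))) \<le> exp_l1 b (m * k) R P W"
proof -
  \<comment> \<open>The finite-length bound loses \<open>3 / 2 * \<epsilon>\<close> and its
    prefactor \<open>\<epsilon> / 2\<close>, hence \<open>2 * \<epsilon> \<le> \<delta>\<close>. The
    sixth of the gap leaves at least half of it for \<open>\<gamma>\<close>.\<close>
  define \<epsilon> where "\<epsilon> = min (\<delta> / 2) ((minf Q - cdiv Q) / 6)"
  have \<epsilon>: "\<epsilon> > 0" "2 * \<epsilon> \<le> \<delta>" using \<delta> gap by (auto simp: \<epsilon>_def)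
  define \<gamma> where "\<gamma> = minf Q - cdiv Q - 3 * \<epsilon>"
  have "6 * \<epsilon> \<le> minf Q - cdiv Q" by (auto simp: \<epsilon>_def min_def)
  then have \<gamma>: "\<gamma> > 0" unfolding \<gamma>_def using \<epsilon>(1) by linarith
  define K where "K l = (\<Sum>x\<in>UNIV. \<Sum>y\<in>UNIV. Q x y * (l x y - (\<Sum>y\<in>UNIV. Q x y * l x y))\<^sup>2)" for l
  let ?K = "K (\<lambda>x y. ln (Q x y) - ln (W x y)) + K (\<lambda>x y. ln (Q x y) - ln (marginal P Q y))"
  have "filterlim (\<lambda>k. m * k) sequentially sequentially"
    using mt(2) by (rule mult_nat_left_at_top)
  from eventually_compose_filterlim[OF eventually_lower_conditions[OF \<epsilon>(1) \<gamma>, of ?K "card (UNIV :: 'x set)"] this]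
    eventually_gt_at_top[of 0]
  show ?thesis
  proof eventually_elim
    case (elim k)
    define n where "n = m * k"
    define M where "M = nat \<lceil>b powr (real n * R)\<rceil>"
    define pol where "pol = (exp 1 * real n) ^ card (UNIV :: 'x set)"
    have pw: "b powr (real n * R) = exp (n * (ln b * R))" using b by (simp add: powr_def mult_ac)
    have "b powr (real n * R) > 0" using b by simp
    then have M: "M > 0" by (simp add: M_def)
    have "real M = of_int \<lceil>b powr (real n * R)\<rceil>" using \<open>b powr (real n * R) > 0\<close> by (simp add: M_def)
    then have M2: "M \<le> exp (n * (ln b * R)) + 1"
      using of_int_ceiling_le_add_one[of "b powr (real n * R)"] pw by simp
    have low: "exp (- (n * (cdiv Q + 1 / 2 * max 0 (ln b * R - minf Q) + 3 / 2 * \<epsilon>))) / (16 * sqrt (4 + 3 * pol))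
        \<le> exp_l1 b n R P W"
      unfolding exp_l1_eq[OF M_def refl] pol_def
      using elim by (intro codebook_deviation_lower[OF mt _ n_def refl M M2 Q \<epsilon>(1)])
        (auto simp: n_def K_def \<gamma>_def)
    have "exp (- (n * (expo (ln b * R) Q + \<delta>))) \<le> exp (- (n * (expo (ln b * R) Q + 3 / 2 * \<epsilon> + \<epsilon> / 2)))"
      using \<epsilon> by (simp add: mult_left_mono)
    also have "\<dots> = exp (- (n * (expo (ln b * R) Q + 3 / 2 * \<epsilon>))) / exp (n * \<epsilon> / 2)"
      by (simp add: exp_diff[symmetric] algebra_simps)
    also have "\<dots> \<le> exp (- (n * (expo (ln b * R) Q + 3 / 2 * \<epsilon>))) / (16 * sqrt (4 + 3 * pol))"
    proof (rule divide_left_mono)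
      show "16 * sqrt (4 + 3 * pol) \<le> exp (n * \<epsilon> / 2)" using elim by (simp add: n_def pol_def)
      have "0 \<le> pol" by (simp add: pol_def)
      then show "0 < exp (n * \<epsilon> / 2) * (16 * sqrt (4 + 3 * pol))" by simp
    qed simp
    also have "\<dots> \<le> exp_l1 b n R P W" using low by (simp add: expo_def)
    finally show ?case by (simp only: n_def)
  qed
qed

end

theorem theorem2:
  fixes W :: "'x::finite \<Rightarrow> 'y::finite \<Rightarrow> real"
    and P :: "'x \<Rightarrow> real" and m :: nat and b R :: real
  assumes "b > 1" and "stoch W" and "m > 0" and "m_type m P"
    and nondeg: "\<forall>k>0. \<exists>xs\<in>typ_class (m * k) P. \<exists>ys::'y list. length ys = m * k \<and>
                    chan_n W xs ys \<noteq> out_dist (m * k) P W ys"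
    and "R > mutinf b P W"
  shows "\<exists>L::real.
     ((\<lambda>k. - (1 / real (m * k)) * log b (exp_l1 b (m * k) R P W)) \<longlonglongrightarrow> L)
   \<and> (\<exists>Q. stoch Q \<and> divKL b (joint P Q) (joint P W)
            + ereal (1/2) * max 0 (ereal R - divKL b (joint P Q) (prodd P (marginal P Q))) = ereal L)
   \<and> (\<forall>Q. stoch Q \<longrightarrow> ereal L \<le> divKL b (joint P Q) (joint P W)
            + ereal (1/2) * max 0 (ereal R - divKL b (joint P Q) (prodd P (marginal P Q))))
   \<and> (\<exists>l\<in>{1..2}. ereal ((l - 1) / l) * (ereal R - csiszar b l P W) = ereal L)
   \<and> (\<forall>l\<in>{1..2}. ereal ((l - 1) / l) * (ereal R - csiszar b l P W) \<le> ereal L)"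
proof -
  note b = \<open>b > 1\<close> and W = \<open>stoch W\<close> and mt = \<open>m_type m P\<close> \<open>m > 0\<close>
  interpret channel P W using mt(1) W by unfold_locales (simp_all add: m_type_def)
  define \<beta> where "\<beta> = ln b"
  have \<beta>: "\<beta> > 0" using b by (simp add: \<beta>_def)
  obtain x0 y0 where "0 < P x0" "W x0 y0 \<noteq> marginal P W y0"
    using nondeg[rule_format, of 1] nondegenerate_witness by (metis zero_less_one)
  then have IW: "0 < minf W" by (rule minf_W_pos)
  have "mutinf b P W = minf W / \<beta>" using divKL_prodd[OF b W] by (simp add: mutinf_def \<beta>_def)
  then have "minf W / \<beta> < R" using \<open>R > mutinf b P W\<close> by simp
  then have RI: "minf W < \<beta> * R" using \<beta> by (simp add: divide_less_eq mult.commute)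
  obtain Q \<rho> S where Q: "Q \<in> dom" and Qmin: "\<And>V. V \<in> dom \<Longrightarrow> expo (\<beta> * R) Q \<le> expo (\<beta> * R) V"
    and \<rho>: "0 \<le> \<rho>" "\<rho> \<le> 1 / 2" and S: "pdist S" "dominates S"
    and dual: "expo (\<beta> * R) Q \<le> \<rho> * (\<beta> * R) - (1 - \<rho>) * (\<Sum>x\<in>UNIV. P x * ln (rsum (1 / (1 - \<rho>)) S x))"
    using minimax[of "\<beta> * R"] by blast
  define L where "L = expo (\<beta> * R) Q / \<beta>"
  have eL: "expo (\<beta> * R) Q = \<beta> * L" using \<beta> by (simp add: L_def)
  have "0 \<le> expo (\<beta> * R) Q" using cdiv_nonneg[OF Q] by (simp add: expo_def)
  then have L0: "0 \<le> L" using \<beta> by (simp add: L_def)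
  \<comment> \<open>The rate exceeds the mutual information of \<open>W\<close>, so the value at
    \<open>W\<close> is half of the excess. Bounding the positive part at \<open>Q\<close> below by
    its argument gives \<open>2 * cdiv Q + minf W \<le> minf Q\<close>, and
    \<open>minf W > 0\<close> makes the gap strict, as the lower bound requires.\<close>
  have gap: "cdiv Q < minf Q"
  proof -
    have "expo (\<beta> * R) W = 1 / 2 * (\<beta> * R - minf W)" using RI by (simp add: expo_def)
    then have "cdiv Q + 1 / 2 * max 0 (\<beta> * R - minf Q) \<le> 1 / 2 * (\<beta> * R - minf W)"
      using Qmin[OF W_dom] unfolding expo_def[of _ Q] by linarith
    moreover have "1 / 2 * (\<beta> * R - minf Q) \<le> 1 / 2 * max 0 (\<beta> * R - minf Q)"
      by (intro mult_left_mono max.cobounded2) simp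
    ultimately have "cdiv Q + 1 / 2 * (\<beta> * R - minf Q) \<le> 1 / 2 * (\<beta> * R - minf W)" by (rule order_trans[OF add_left_mono, rotated])
    then have "2 * cdiv Q + minf W \<le> minf Q" by (simp add: field_simps)
    then show ?thesis using cdiv_nonneg[OF Q] IW by linarith
  qed
  define c where "c k = - (1 / real (m * k)) * log b (exp_l1 b (m * k) R P W)" for k
  have lower: "\<forall>\<^sub>F k in sequentially. exp (- (real (m * k) * (\<beta> * L + \<delta>))) \<le> exp_l1 b (m * k) R P W"
    if "\<delta> > 0" for \<delta>
    using eventually_exp_l1_lower[OF b mt Q gap that, of R] by (simp add: \<beta>_def[symmetric] eL)
  have pos: "\<forall>\<^sub>F k in sequentially. 0 < exp_l1 b (m * k) R P W"
    using lower[OF zero_less_one] by eventually_elim (rule less_le_trans[OF exp_gt_zero])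
  \<comment> \<open>The achievable exponent in base \<open>b\<close>, written with
    \<open>rsum\<close> instead of the Renyi divergence so that order 1 is included.\<close>
  define G where "G l U = (l - 1) / l * R - (\<Sum>x\<in>UNIV. P x * ln (rsum l U x)) / (l * \<beta>)" for l U
  have upper: "\<forall>\<^sub>F k in sequentially. G l U - ln 3 / (\<beta> * m) / k \<le> c k"
    if l: "1 \<le> l" "l \<le> 2" and U: "pdist U" "dominates U" for l U
    using pos eventually_gt_at_top[of 0]
  proof eventually_elim
    case (elim k)
    have n: "real (m * k) > 0" using elim mt by simp
    let ?E = "exp_l1 b (m * k) R P W"
    have "?E \<le> 3 * exp (- (real (m * k) * ((l - 1) / l * (ln b * R) - (\<Sum>x\<in>UNIV. P x * ln (rsum l U x)) / l)))"
      using elim by (intro exp_l1_upper b l U typ_class_nonempty[OF mt]) auto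
    also have "(l - 1) / l * (ln b * R) - (\<Sum>x\<in>UNIV. P x * ln (rsum l U x)) / l = \<beta> * G l U"
      using \<beta> l by (simp add: G_def \<beta>_def[symmetric] right_diff_distrib mult_ac)
    finally have "ln ?E \<le> ln (3 * exp (- (real (m * k) * (\<beta> * G l U))))"
      using elim by (subst ln_le_cancel_iff) auto
    then have "ln ?E \<le> ln 3 - real (m * k) * (\<beta> * G l U)" by (simp add: ln_mult)
    then have "(real (m * k) * (\<beta> * G l U) - ln 3) / (real (m * k) * \<beta>) \<le> - ln ?E / (real (m * k) * \<beta>)"
      using n \<beta> by (intro divide_right_mono) auto
    also have "- ln ?E / (real (m * k) * \<beta>) = c k" by (simp add: c_def log_def \<beta>_def)
    also have "(real (m * k) * (\<beta> * G l U) - ln 3) / (real (m * k) * \<beta>) = G l U - ln 3 / (\<beta> * m) / k"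
      using elim(2) mt(2) \<beta> by (simp add: diff_divide_distrib mult_ac)
    finally show ?case .
  qed
  have err: "(\<lambda>k. a - ln 3 / (\<beta> * m) / real k) \<longlonglongrightarrow> a" for a
  proof -
    have "(\<lambda>k. ln 3 / (\<beta> * m) / real k) \<longlonglongrightarrow> 0" by (rule lim_const_over_n)
    from tendsto_diff[OF tendsto_const this] show ?thesis by simp
  qed
  define l where "l = 1 / (1 - \<rho>)"
  have l: "1 \<le> l" "l \<le> 2" using \<rho> by (auto simp: l_def field_simps)
  have l\<rho>: "1 / l = 1 - \<rho>" "(l - 1) / l = \<rho>" using \<rho> by (auto simp: l_def field_simps)
  have GL: "L \<le> G l S"
  proof -
    have "\<beta> * G l S = \<rho> * (\<beta> * R) - 1 / l * (\<Sum>x\<in>UNIV. P x * ln (rsum l S x))"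
      using \<beta> by (simp add: G_def l\<rho>(2) right_diff_distrib)
    then have "\<beta> * L \<le> \<beta> * G l S" using dual unfolding eL l\<rho>(1) l_def by simp
    then show ?thesis using \<beta> by simp
  qed
  \<comment> \<open>Achievability at the dual pair \<open>(l, S)\<close> controls the limit
    inferior, the converse at the minimiser \<open>Q\<close> the limit superior.\<close>
  have lim: "c \<longlonglongrightarrow> L"
  proof (rule order_tendstoI)
    fix a assume "a < L"
    then have "a < G l S" using GL by simp
    from order_tendstoD(1)[OF err this] upper[OF l S]
    show "\<forall>\<^sub>F k in sequentially. a < c k" by eventually_elim simp
  next
    fix a assume a: "L < a"
    define \<delta> where "\<delta> = \<beta> * (a - L) / 2"
    have \<delta>: "\<delta> > 0" using a \<beta> by (simp add: \<delta>_def)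
    from lower[OF \<delta>] eventually_gt_at_top[of 0]
    show "\<forall>\<^sub>F k in sequentially. c k < a"
    proof eventually_elim
      case (elim k)
      have n: "real (m * k) > 0" using elim mt by simp
      let ?E = "exp_l1 b (m * k) R P W"
      have "0 < ?E" using elim(1) by (rule less_le_trans[OF exp_gt_zero])
      then have "- (real (m * k) * (\<beta> * L + \<delta>)) \<le> ln ?E"
        using elim by (subst (asm) ln_ge_iff[symmetric]) auto
      then have "- ln ?E / (real (m * k) * \<beta>) \<le> (real (m * k) * (\<beta> * L + \<delta>)) / (real (m * k) * \<beta>)"
        using n \<beta> by (intro divide_right_mono) auto
      also have "- ln ?E / (real (m * k) * \<beta>) = c k" by (simp add: c_def log_def \<beta>_def)
      also have "(real (m * k) * (\<beta> * L + \<delta>)) / (real (m * k) * \<beta>) = L + (a - L) / 2"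
        using elim(2) mt(2) \<beta> by (simp add: \<delta>_def add_divide_distrib)
      also have "L + (a - L) / 2 < a" using a by (simp add: field_simps)
      finally show ?case .
    qed
  qed
  have G_le: "G l' U \<le> L" if "1 \<le> l'" "l' \<le> 2" "pdist U" "dominates U" for l' U
    by (rule tendsto_le[OF _ lim err upper[OF that]]) simp
  define r where "r l' U = (\<Sum>x\<in>UNIV. P x * ln (rsum l' U x)) / ((l' - 1) * \<beta>)" for l' U
  have G_r: "G l' U = (l' - 1) / l' * (R - r l' U)" if "1 < l'" for l' U
    using that by (simp add: G_def r_def right_diff_distrib)
  have csiszar: "csiszar b l' P W = (INF U\<in>{U. pdist U}. if dominates U then ereal (r l' U) else \<infinity>)"
    if "1 < l'" for l'
    unfolding csiszar_def r_def \<beta>_def by (rule INF_cong) (auto simp: renyi_sum_eq[OF b that])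
  have csiszar_ge: "ereal (R - L / ((l' - 1) / l')) \<le> csiszar b l' P W" if l': "1 < l'" "l' \<le> 2" for l'
    unfolding csiszar[OF l'(1)]
  proof (rule INF_greatest)
    fix U :: "'y \<Rightarrow> real" assume "U \<in> {U. pdist U}"
    then have "(l' - 1) / l' * (R - r l' U) \<le> L" if "dominates U"
      using G_le[of l' U] G_r[OF l'(1), of U] that l' by simp
    then have "R - r l' U \<le> L / ((l' - 1) / l')" if "dominates U"
      using that l' by (subst pos_le_divide_eq) (auto simp: mult.commute)
    then show "ereal (R - L / ((l' - 1) / l')) \<le> (if dominates U then ereal (r l' U) else \<infinity>)"
      by (simp add: algebra_simps)
  qed
  have dual_le: "ereal ((l' - 1) / l') * (ereal R - csiszar b l' P W) \<le> ereal L" if l': "l' \<in> {1..2}" for l'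
  proof (cases "l' = 1")
    case False
    then have l'': "1 < l'" "l' \<le> 2" using l' by auto
    define q where "q = (l' - 1) / l'"
    have q: "q > 0" using l'' by (simp add: q_def)
    show ?thesis
    proof (cases "csiszar b l' P W")
      case (real d)
      then have "R - L / q \<le> d" using csiszar_ge[OF l''] by (simp add: q_def)
      then have "q * (R - d) \<le> L" using q by (simp add: field_simps)
      then show ?thesis by (simp add: real flip: q_def)
    next
      case PInf
      then show ?thesis using q by (simp flip: q_def)
    next
      case MInf
      then show ?thesis using csiszar_ge[OF l''] by simp
    qed
  \<comment> \<open>At order 1 the prefactor is 0 and annihilates every extended real, so the claim
    is \<open>0 \<le> L\<close>.\<close>
  qed (use L0 in \<open>simp flip: zero_ereal_def\<close>)
  have dual_ge: "ereal L \<le> ereal ((l - 1) / l) * (ereal R - csiszar b l P W)"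
  proof (cases "l = 1")
    \<comment> \<open>Order 1 means slope 0: the sums \<open>rsum\<close> are 1 on the support of
      \<open>P\<close>, and the dual bound forces \<open>L \<le> 0\<close>.\<close>
    case True
    have "rsum 1 S x = 1" if "0 < P x" for x
    proof -
      have "W x y powr 1 * S y powr (1 - 1) = W x y" for y
        using S(2) that stoch_nonneg[OF W, of x y] by (cases "W x y = 0") (auto simp: dominates_def less_le)
      then show ?thesis by (simp add: rsum_def stoch_sum[OF W])
    qed
    then have *: "P x * ln (rsum 1 S x) = 0" for x using P_nonneg[of x] by (cases "P x = 0") auto
    have "G l S = 0" unfolding True G_def * by simp
    then show ?thesis using GL True by (simp flip: zero_ereal_def)
  next
    case False
    then have l1: "1 < l" using l by simp
    have "csiszar b l P W \<le> ereal (r l S)"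
      unfolding csiszar[OF l1] by (rule INF_lower2[of S]) (use S in auto)
    then obtain d where d: "csiszar b l P W = ereal d" "d \<le> r l S"
      using csiszar_ge[OF l1 l(2)] by (cases "csiszar b l P W") auto
    have "L \<le> (l - 1) / l * (R - r l S)" using GL G_r[OF l1] by simp
    also have "\<dots> \<le> (l - 1) / l * (R - d)" using d(2) l1 by (intro mult_left_mono) auto
    finally show ?thesis by (simp add: d(1))
  qed
  have obj: "divKL b (joint P V) (joint P W)
      + ereal (1/2) * max 0 (ereal R - divKL b (joint P V) (prodd P (marginal P V)))
      = (if V \<in> dom then ereal (expo (\<beta> * R) V / \<beta>) else \<infinity>)" if "stoch V" for V
    using objective_eq[OF b that] by (simp add: \<beta>_def)
  show ?thesis
  proof (intro exI[of _ L] conjI)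
    show "(\<lambda>k. - (1 / real (m * k)) * log b (exp_l1 b (m * k) R P W)) \<longlonglongrightarrow> L"
      using lim unfolding c_def[abs_def] .
    show "\<exists>Q. stoch Q \<and> divKL b (joint P Q) (joint P W)
            + ereal (1/2) * max 0 (ereal R - divKL b (joint P Q) (prodd P (marginal P Q))) = ereal L"
      using obj[OF dom_stoch[OF Q]] Q dom_stoch[OF Q] by (auto simp: L_def)
    show "\<forall>Q. stoch Q \<longrightarrow> ereal L \<le> divKL b (joint P Q) (joint P W)
            + ereal (1/2) * max 0 (ereal R - divKL b (joint P Q) (prodd P (marginal P Q)))"
      using Qmin \<beta> by (auto simp: obj L_def intro!: divide_right_mono)
    show "\<exists>l\<in>{1..2}. ereal ((l - 1) / l) * (ereal R - csiszar b l P W) = ereal L"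
      using dual_le[of l] dual_ge l by (intro bexI[of _ l] antisym) auto
    show "\<forall>l\<in>{1..2}. ereal ((l - 1) / l) * (ereal R - csiszar b l P W) \<le> ereal L"
      using dual_le by blast
  qed
qed

end
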